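(* Let $A,B\in\mathbb{B}(\mathscr{H})$ be $G_1$ operators with $\sigma(A)\cup\sigma(B)\subset\mathbb{D}$, let $X\in\mathbb{B}(\mathscr{H})$, let $f,g\in\mathfrak{H}$ and let $|||\cdot|||$ be a unitarily invariant norm. Then $$|||f(A)X+Xg(B)|||\le\frac{2\sqrt2}{d_Ad_B}\,|||\,|AXB|+|X|\,|||$$ and $$|||f(A)X-Xg(B)|||\le\frac{2\sqrt2}{d_Ad_B}\,|||\,|AX|+|XB|\,|||.$$
   Context: $\mathscr{H}$ is a separable complex Hilbert space; $|T|=(T^*T)^{1/2}$. An operator $A$ is a $G_1$ operator if $\|(z-A)^{-1}\|=1/\mathrm{dist}(z,\sigma(A))$ for all $z\notin\sigma(A)$. $\mathbb{D}$ is the open unit disk, $d_A=\mathrm{dist}(\partial\mathbb{D},\sigma(A))$. $\mathfrak{H}$ is the set of analytic $f:\mathbb{D}\to\mathbb{C}$ with $\operatorname{Re}f>0$ and $f(0)=1$; $f(A)$ is defined by the Riesz–Dunford holomorphic functional calculus. A unitarily invariant norm is $|||T|||=\Phi(s_1(T),s_2(T),\dots)$ for a symmetric norming function $\Phi$ of the singular values; all operators whose norms appear are assumed to lie in the associated norm ideal. *)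

theory Defs
  imports "HOL-Analysis.Analysis"
begin

text \<open>The library has no complex vector spaces or complex inner products, so we
introduce a class of complex Hilbert spaces: a real Banach space carrying a complex
scalar multiplication compatible with the real one, and a complex inner product
(linear in the second argument) inducing the norm.  Separability is expressed by
the class second_countable_topology in the theorem.\<close>

class chilbert = real_normed_vector + complete_space +
  fixes scaleC :: "complex \<Rightarrow> 'a \<Rightarrow> 'a" (infixr \<open>*\<^sub>C\<close> 75)
    and cinner :: "'a \<Rightarrow> 'a \<Rightarrow> complex"
  assumes scaleC_add_right: "a *\<^sub>C (x + y) = a *\<^sub>C x + a *\<^sub>C y"
    and scaleC_add_left: "(a + b) *\<^sub>C x = a *\<^sub>C x + b *\<^sub>C x"
    and scaleC_scaleC: "a *\<^sub>C (b *\<^sub>C x) = (a * b) *\<^sub>C x"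
    and scaleC_of_real: "(complex_of_real r) *\<^sub>C x = r *\<^sub>R x"
    and cinner_commute: "cinner x y = cnj (cinner y x)"
    and cinner_add_right: "cinner x (y + z) = cinner x y + cinner x z"
    and cinner_scaleC_right: "cinner x (a *\<^sub>C y) = a * cinner x y"
    and cinner_self_real: "Im (cinner x x) = 0"
    and cinner_self_nonneg: "0 \<le> Re (cinner x x)"
    and cinner_self_eq_zero: "cinner x x = 0 \<longleftrightarrow> x = 0"
    and norm_eq_sqrt_cinner: "norm x = sqrt (Re (cinner x x))"

definition bounded_clinear :: "('a::chilbert \<Rightarrow> 'a) \<Rightarrow> bool" where
  "bounded_clinear T \<longleftrightarrow>
     (\<forall>x y. T (x + y) = T x + T y) \<and> (\<forall>c x. T (c *\<^sub>C x) = c *\<^sub>C T x) \<and>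
     (\<exists>K. \<forall>x. norm (T x) \<le> norm x * K)"

definition spec :: "('a::chilbert \<Rightarrow> 'a) \<Rightarrow> complex set" where
  "spec T = {z. \<not> (\<exists>S. bounded_clinear S \<and> (\<forall>x. S (z *\<^sub>C x - T x) = x) \<and>
                          (\<forall>y. z *\<^sub>C S y - T (S y) = y))}"

definition resolvent :: "('a::chilbert \<Rightarrow> 'a) \<Rightarrow> complex \<Rightarrow> 'a \<Rightarrow> 'a" where
  "resolvent T z = (\<lambda>y. THE x. z *\<^sub>C x - T x = y)"

definition G1 :: "('a::chilbert \<Rightarrow> 'a) \<Rightarrow> bool" where
  "G1 A \<longleftrightarrow> bounded_clinear A \<and>
     (\<forall>z. z \<notin> spec A \<longrightarrow> onorm (resolvent A z) = 1 / infdist z (spec A))"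

definition dD :: "('a::chilbert \<Rightarrow> 'a) \<Rightarrow> real" where
  "dD A = setdist (frontier (ball (0::complex) 1)) (spec A)"

definition adj :: "('a::chilbert \<Rightarrow> 'a) \<Rightarrow> 'a \<Rightarrow> 'a" where
  "adj T = (THE S. \<forall>x y. cinner (T x) y = cinner x (S y))"

definition positive_op :: "('a::chilbert \<Rightarrow> 'a) \<Rightarrow> bool" where
  "positive_op P \<longleftrightarrow> bounded_clinear P \<and>
     (\<forall>x. Im (cinner x (P x)) = 0 \<and> 0 \<le> Re (cinner x (P x)))"

definition op_sqrt :: "('a::chilbert \<Rightarrow> 'a) \<Rightarrow> 'a \<Rightarrow> 'a" where
  "op_sqrt P = (THE R. positive_op R \<and> R \<circ> R = P)"

definition abs_op :: "('a::chilbert \<Rightarrow> 'a) \<Rightarrow> 'a \<Rightarrow> 'a" where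
  "abs_op T = op_sqrt (adj T \<circ> T)"

definition herglotz :: "(complex \<Rightarrow> complex) \<Rightarrow> bool" where
  "herglotz f \<longleftrightarrow> f holomorphic_on ball 0 1 \<and> (\<forall>z\<in>ball 0 1. 0 < Re (f z)) \<and> f 0 = 1"

text \<open>Riesz--Dunford calculus for f holomorphic on the unit disk and sigma(A) inside
the disk: f(A) = (1/(2 pi i)) times the contour integral of f(z)(z-A)^(-1) over the
circle |z| = r, where r = (1 + spectral radius)/2 lies strictly between the spectral
radius and 1.  The integral is taken strongly (pointwise in x).\<close>
definition calc_radius :: "('a::chilbert \<Rightarrow> 'a) \<Rightarrow> real" where
  "calc_radius A = (1 + Sup (cmod ` spec A)) / 2"

definition hfc :: "(complex \<Rightarrow> complex) \<Rightarrow> ('a::chilbert \<Rightarrow> 'a) \<Rightarrow> 'a \<Rightarrow> 'a" where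
  "hfc f A x =
     (1 / (2 * complex_of_real pi * \<i>)) *\<^sub>C
       integral {0..2*pi} (\<lambda>t::real.
         (f (complex_of_real (calc_radius A) * exp (\<i> * t)) *
          (\<i> * complex_of_real (calc_radius A) * exp (\<i> * t))) *\<^sub>C
         resolvent A (complex_of_real (calc_radius A) * exp (\<i> * t)) x)"

text \<open>Singular values (approximation numbers), indexed from 0:
s j T = inf { norm(T - F) : rank F <= j }.\<close>
definition sval :: "nat \<Rightarrow> ('a::chilbert \<Rightarrow> 'a) \<Rightarrow> real" where
  "sval j T = Inf {onorm (\<lambda>x. T x - F x) | F. bounded_clinear F \<and>
      (\<exists>v::nat \<Rightarrow> 'a. range F \<subseteq> {\<Sum>i<j. c i *\<^sub>C v i | c. True})}"

definition fin_supp :: "(nat \<Rightarrow> real) \<Rightarrow> bool" where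
  "fin_supp \<xi> \<longleftrightarrow> finite {i. \<xi> i \<noteq> 0}"

definition symm_norming :: "((nat \<Rightarrow> real) \<Rightarrow> real) \<Rightarrow> bool" where
  "symm_norming \<Phi> \<longleftrightarrow>
     (\<forall>\<xi>. fin_supp \<xi> \<and> \<xi> \<noteq> (\<lambda>_. 0) \<longrightarrow> 0 < \<Phi> \<xi>) \<and>
     (\<forall>\<xi> a. fin_supp \<xi> \<longrightarrow> \<Phi> (\<lambda>i. a * \<xi> i) = \<bar>a\<bar> * \<Phi> \<xi>) \<and>
     (\<forall>\<xi> \<eta>. fin_supp \<xi> \<and> fin_supp \<eta> \<longrightarrow> \<Phi> (\<lambda>i. \<xi> i + \<eta> i) \<le> \<Phi> \<xi> + \<Phi> \<eta>) \<and>
     \<Phi> (\<lambda>i. if i = 0 then 1 else 0) = 1 \<and>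
     (\<forall>\<xi> \<pi>. fin_supp \<xi> \<and> bij \<pi> \<longrightarrow> \<Phi> (\<lambda>i. \<bar>\<xi> (\<pi> i)\<bar>) = \<Phi> \<xi>)"

definition trunc_sv :: "((nat \<Rightarrow> real) \<Rightarrow> real) \<Rightarrow> ('a::chilbert \<Rightarrow> 'a) \<Rightarrow> nat \<Rightarrow> real" where
  "trunc_sv \<Phi> T n = \<Phi> (\<lambda>i. if i < n then sval i T else 0)"

definition in_ideal :: "((nat \<Rightarrow> real) \<Rightarrow> real) \<Rightarrow> ('a::chilbert \<Rightarrow> 'a) \<Rightarrow> bool" where
  "in_ideal \<Phi> T \<longleftrightarrow> bounded_clinear T \<and> bdd_above (range (trunc_sv \<Phi> T))"

definition uinorm :: "((nat \<Rightarrow> real) \<Rightarrow> real) \<Rightarrow> ('a::chilbert \<Rightarrow> 'a) \<Rightarrow> real" where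
  "uinorm \<Phi> T = (SUP n. trunc_sv \<Phi> T n)"

end

theory Submission
  imports Defs "HOL-Complex_Analysis.Complex_Analysis"
begin

text \<open>For \<open>\<rho> < 1\<close> above the spectral radii, Schwarz's formula writes \<open>f(A)\<close> as the average of
  \<open>(z + A) (z - A)\<inverse>\<close> over \<open>\<bar>z\<bar> = \<rho>\<close> with the probability weight \<open>Re f(z) / 2\<pi>\<close>, and similarly for \<open>g(B)\<close>.
  For fixed \<open>z\<close> and \<open>w\<close> the two integrands combine to
  \<open>(z + A) (z - A)\<inverse> X + X (w + B) (w - B)\<inverse> = 2 (z - A)\<inverse> (z w X - A X B) (w - B)\<inverse>\<close>, where the \<open>G\<^sub>1\<close>
  condition bounds the outer factors; the case of the difference is analogous.  It remains to compare
  \<open>a S + b T\<close> with \<open>|S| + |T|\<close>, which costs a factor \<open>sqrt 2\<close>, and to let \<open>\<rho>\<close> tend to 1.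

  All estimates are made for Ky Fan norms, in the form of bounds on \<open>\<bar>\<Sum> \<langle>f\<^sub>j, T e\<^sub>j\<rangle>\<bar>\<close> over \<open>k\<close>-tuples of
  vectors that are contractive images of orthonormal systems; the suprema of these sums are the partial
  sums of the singular values.  A symmetric norming function is monotone under weak majorization.\<close>

section \<open>Complex Hilbert spaces\<close>

text \<open>The calculus enters only through the coefficients \<open>cinner y (hfc f A x)\<close>
  and the norm only through finite sums of them, so apart from the definition of \<open>hfc\<close>
  every integral is scalar, and the two averages can be taken one after the other. Contractive test
  systems, unlike orthonormal ones, absorb the outer factors: a resolvent divided by its norm bound
  maps such a system to another one. This takes the place of the ideal property of the norm.

  The calculus is defined on one fixed circle, whereas the constant needs \<rho> near 1, where the
  distance to the spectrum is at least \<open>dD A - (1 - \<rho>)\<close>; a change of radius by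
  Cauchy's theorem connects the two. The kernel is handled in the variable u = 1 / z, where (z +
  A)(z - A)^{-1} becomes 2 (1 - u A)^{-1} - 1. Infinity is then the ordinary point u = 0, and the
  subtracted 1 is the value there.

  With \<sigma> = 1 or -1 both inequalities come from R ((1 + u A) X (1 - v B) + \<sigma> (1 - u A)
  X (1 + v B)) Q, where R = (1 - u A)^{-1} and Q = (1 - v B)^{-1}. The middle factor is 2 X - 2 u v
  A X B for the sum and 2 u A X - 2 v X B for the difference.\<close>

instance chilbert \<subseteq> banach ..

lemma cinner_add_left: "cinner (x + y) (z::'a::chilbert) = cinner x z + cinner y z"
  by (metis cinner_add_right cinner_commute complex_cnj_add)

lemma cinner_scaleC_left: "cinner (a *\<^sub>C x) (y::'a::chilbert) = cnj a * cinner x y"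
  by (metis cinner_scaleC_right cinner_commute complex_cnj_mult)

lemma scaleR_eq_scaleC: "r *\<^sub>R (x::'a::chilbert) = complex_of_real r *\<^sub>C x"
  by (simp add: scaleC_of_real)

lemma cinner_scaleR_right: "cinner x (r *\<^sub>R (y::'a::chilbert)) = of_real r * cinner x y"
  by (simp add: scaleR_eq_scaleC cinner_scaleC_right)

lemma cinner_scaleR_left: "cinner (r *\<^sub>R x) (y::'a::chilbert) = of_real r * cinner x y"
  by (simp add: scaleR_eq_scaleC cinner_scaleC_left)

lemma cinner_zero_right [simp]: "cinner x (0::'a::chilbert) = 0"
  using cinner_add_right[of x 0 0] by simp

lemma cinner_zero_left [simp]: "cinner (0::'a::chilbert) x = 0"
  using cinner_add_left[of 0 0 x] by simp

lemma cinner_minus_right: "cinner x (- y) = - cinner x (y::'a::chilbert)"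
  using cinner_scaleR_right[of x "-1" y] by simp

lemma cinner_minus_left: "cinner (- x) y = - cinner x (y::'a::chilbert)"
  using cinner_scaleR_left[of "-1" x y] by simp

lemma cinner_diff_right: "cinner x (y - z) = cinner x y - cinner x (z::'a::chilbert)"
  using cinner_add_right[of x y "- z"] by (simp add: cinner_minus_right)

lemma cinner_diff_left: "cinner (x - y) z = cinner x z - cinner y (z::'a::chilbert)"
  using cinner_add_left[of x "- y" z] by (simp add: cinner_minus_left)

lemma cinner_sum_right: "cinner x (\<Sum>i\<in>I. f i) = (\<Sum>i\<in>I. cinner x (f i :: 'a::chilbert))"
  by (induction I rule: infinite_finite_induct) (auto simp: cinner_add_right)

lemma cinner_sum_left: "cinner (\<Sum>i\<in>I. f i) x = (\<Sum>i\<in>I. cinner (f i) (x :: 'a::chilbert))"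
  by (induction I rule: infinite_finite_induct) (auto simp: cinner_add_left)

lemma cinner_self: "cinner x x = complex_of_real ((norm (x::'a::chilbert))\<^sup>2)"
  by (simp add: norm_eq_sqrt_cinner cinner_self_nonneg complex_eq_iff cinner_self_real)

lemma scaleC_zero_left [simp]: "0 *\<^sub>C (x::'a::chilbert) = 0"
  using scaleC_of_real[of 0 x] by simp

lemma scaleC_one [simp]: "1 *\<^sub>C (x::'a::chilbert) = x"
  using scaleC_of_real[of 1 x] by simp

lemma scaleC_zero_right [simp]: "a *\<^sub>C (0::'a::chilbert) = 0"
  using scaleC_add_right[of a 0 0] by simp

lemma scaleC_minus_right: "a *\<^sub>C (- x) = - (a *\<^sub>C (x::'a::chilbert))"
  using scaleC_add_right[of a x "- x"] by (simp add: add_eq_0_iff)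

lemma scaleC_diff_right: "a *\<^sub>C (x - y) = a *\<^sub>C x - a *\<^sub>C (y::'a::chilbert)"
  using scaleC_add_right[of a x "- y"] by (simp add: scaleC_minus_right)

lemma scaleC_minus_left: "(- a) *\<^sub>C x = - (a *\<^sub>C (x::'a::chilbert))"
  using scaleC_add_left[of a "- a" x] by (simp add: add_eq_0_iff)

lemma scaleC_diff_left: "(a - b) *\<^sub>C x = a *\<^sub>C x - b *\<^sub>C (x::'a::chilbert)"
  using scaleC_add_left[of a "- b" x] by (simp add: scaleC_minus_left)

lemma scaleC_sum_right: "a *\<^sub>C (\<Sum>i\<in>I. f i) = (\<Sum>i\<in>I. a *\<^sub>C (f i :: 'a::chilbert))"
  by (induction I rule: infinite_finite_induct) (auto simp: scaleC_add_right)

lemma scaleC_sum_left: "(\<Sum>i\<in>I. f i) *\<^sub>C x = (\<Sum>i\<in>I. f i *\<^sub>C (x :: 'a::chilbert))"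
  by (induction I rule: infinite_finite_induct) (auto simp: scaleC_add_left)

lemma norm_scaleC: "norm (a *\<^sub>C x) = cmod a * norm (x::'a::chilbert)"
proof -
  have "cinner (a *\<^sub>C x) (a *\<^sub>C x) = (a * cnj a) * cinner x x"
    by (simp add: cinner_scaleC_left cinner_scaleC_right mult.assoc)
  also have "\<dots> = of_real ((cmod a * norm x)\<^sup>2)"
    by (simp only: complex_norm_square[symmetric] cinner_self power_mult_distrib of_real_mult)
  finally have "(norm (a *\<^sub>C x))\<^sup>2 = (cmod a * norm x)\<^sup>2"
    unfolding cinner_self of_real_eq_iff .
  then show ?thesis by (simp add: power2_eq_iff_nonneg)
qed

lemma norm_add_sq: "(norm (x + y))\<^sup>2 = (norm x)\<^sup>2 + (norm y)\<^sup>2 + 2 * Re (cinner x (y::'a::chilbert))"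
proof -
  have "Re (cinner (x + y) (x + y)) = Re (cinner x x) + Re (cinner y y) + 2 * Re (cinner x y)"
    using arg_cong[OF cinner_commute[of y x], of Re] by (simp add: cinner_add_left cinner_add_right)
  then show ?thesis by (simp add: cinner_self)
qed

lemma norm_diff_sq: "(norm (x - y))\<^sup>2 = (norm x)\<^sup>2 + (norm y)\<^sup>2 - 2 * Re (cinner x (y::'a::chilbert))"
  using norm_add_sq[of x "- y"] by (simp add: cinner_minus_right)

lemma cinner_Cauchy_Schwarz: "cmod (cinner x y) \<le> norm x * norm (y::'a::chilbert)"
proof (cases "y = 0")
  case False
  define n where "n = (norm y)\<^sup>2"
  have n: "n > 0" using False by (simp add: n_def)
  define c where "c = cinner y x / of_real n"
  have "cinner x (c *\<^sub>C y) = of_real ((cmod (cinner x y))\<^sup>2 / n)"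
    using complex_norm_square[of "cinner y x"] cinner_commute[of x y]
    by (simp add: c_def cinner_scaleC_right complex_mod_cnj)
  moreover have "(norm (c *\<^sub>C y))\<^sup>2 = (cmod (cinner x y))\<^sup>2 / n"
    using n cinner_commute[of x y]
    by (simp add: norm_scaleC c_def norm_divide power_divide power_mult_distrib complex_mod_cnj)
       (simp add: n_def power2_eq_square)
  ultimately have "0 \<le> (norm x)\<^sup>2 - (cmod (cinner x y))\<^sup>2 / n"
    using norm_diff_sq[of x "c *\<^sub>C y"] by (smt (verit) Re_complex_of_real zero_le_power2)
  then have "(cmod (cinner x y))\<^sup>2 \<le> (norm x * norm y)\<^sup>2"
    using n by (simp add: field_simps n_def)
  then show ?thesis by (simp add: power2_le_iff_abs_le)
qed auto

lemma cinner_eqI: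
  assumes "\<And>z. cinner z x = cinner z (y::'a::chilbert)" shows "x = y"
proof -
  have "cinner (x - y) (x - y) = 0" using assms by (simp add: cinner_diff_right)
  then show ?thesis by (simp add: cinner_self_eq_zero)
qed

lemma bounded_linear_cinner_right: "bounded_linear (\<lambda>y::'a::chilbert. cinner x y)"
  by (rule bounded_linear_intro[where K = "norm x"])
     (auto simp: cinner_add_right cinner_scaleR_right scaleR_conv_of_real
       intro: order_trans[OF cinner_Cauchy_Schwarz] simp: mult.commute)

lemma bounded_linear_scaleC: "bounded_linear (\<lambda>y::'a::chilbert. c *\<^sub>C y)"
  by (rule bounded_linear_intro[where K = "cmod c"])
     (auto simp: scaleC_add_right scaleR_eq_scaleC scaleC_scaleC norm_scaleC mult.commute)

lemma tendsto_cinner: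
  fixes x y :: "'a::chilbert"
  assumes "(u \<longlongrightarrow> x) F" "(v \<longlongrightarrow> y) F"
  shows "((\<lambda>n. cinner (u n) (v n)) \<longlongrightarrow> cinner x y) F"
proof -
  have "bounded_bilinear (\<lambda>x y :: 'a. cinner x y)"
    by (rule bounded_bilinear.intro)
       (auto simp: cinner_add_left cinner_add_right cinner_scaleR_right cinner_scaleR_left
         scaleR_conv_of_real intro!: exI[of _ 1] cinner_Cauchy_Schwarz)
  then show ?thesis using assms by (rule bounded_bilinear.tendsto)
qed

lemma bounded_clinear_add: "bounded_clinear T \<Longrightarrow> T (x + y) = T x + T y"
  and bounded_clinear_scaleC: "bounded_clinear T \<Longrightarrow> T (c *\<^sub>C x) = c *\<^sub>C T x"
  by (auto simp: bounded_clinear_def)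

lemma bounded_clinear_scaleR: "bounded_clinear T \<Longrightarrow> T (r *\<^sub>R x) = r *\<^sub>R T x"
  by (simp add: scaleR_eq_scaleC bounded_clinear_scaleC)

lemma bounded_clinear_imp_bounded_linear: "bounded_clinear T \<Longrightarrow> bounded_linear T"
  unfolding bounded_clinear_def
  by (metis bounded_linear_intro scaleR_eq_scaleC)

lemma bounded_clinear_zero: "bounded_clinear T \<Longrightarrow> T 0 = 0"
  and bounded_clinear_diff: "bounded_clinear T \<Longrightarrow> T (x - y) = T x - T y"
  and bounded_clinear_sum: "bounded_clinear T \<Longrightarrow> T (sum h I) = (\<Sum>i\<in>I. T (h i))"
  by (auto dest!: bounded_clinear_imp_bounded_linear bounded_linear.linear
      simp: linear_0 linear_diff linear_sum)

lemma bounded_clinear_bound: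
  assumes "bounded_clinear T"
  obtains K where "K > 0" "\<And>x. norm (T x) \<le> K * norm x"
  using bounded_linear.pos_bounded[OF bounded_clinear_imp_bounded_linear[OF assms]]
  by (metis mult.commute)

lemma bounded_clinearI:
  assumes "\<And>x y. T (x + y) = T x + T y" "\<And>c x. T (c *\<^sub>C x) = c *\<^sub>C T x"
    "\<And>x. norm (T x) \<le> K * norm x"
  shows "bounded_clinear T"
  using assms unfolding bounded_clinear_def by (metis mult.commute)

lemma bounded_clinear_id: "bounded_clinear (\<lambda>x. x)"
  by (rule bounded_clinearI[where K = 1]) auto

lemma bounded_clinear_compose:
  assumes "bounded_clinear S" "bounded_clinear T"
  shows "bounded_clinear (\<lambda>x. S (T x))"
proof -
  obtain K where K: "K > 0" "\<And>x. norm (S x) \<le> K * norm x" using bounded_clinear_bound[OF assms(1)] by blast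
  obtain L where L: "L > 0" "\<And>x. norm (T x) \<le> L * norm x" using bounded_clinear_bound[OF assms(2)] by blast
  have "norm (S (T x)) \<le> K * L * norm x" for x
    using K(2)[of "T x"] mult_left_mono[OF L(2)[of x], of K] K(1) by (simp add: mult.assoc order_trans)
  then show ?thesis
    by (intro bounded_clinearI)
       (auto simp: assms bounded_clinear_add bounded_clinear_scaleC)
qed

lemma bounded_clinear_add_op:
  assumes "bounded_clinear S" "bounded_clinear T"
  shows "bounded_clinear (\<lambda>x. S x + T x)"
proof -
  obtain K where K: "K > 0" "\<And>x. norm (S x) \<le> K * norm x" using bounded_clinear_bound[OF assms(1)] by blast
  obtain L where L: "L > 0" "\<And>x. norm (T x) \<le> L * norm x" using bounded_clinear_bound[OF assms(2)] by blast
  have "norm (S x + T x) \<le> (K + L) * norm x" for x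
    using K(2)[of "x"] L(2)[of x] norm_triangle_ineq[of "S x" "T x"] by (simp add: algebra_simps)
  then show ?thesis
    by (intro bounded_clinearI)
       (auto simp: assms bounded_clinear_add bounded_clinear_scaleC scaleC_add_right)
qed

lemma bounded_clinear_scaleC_op:
  assumes "bounded_clinear T"
  shows "bounded_clinear (\<lambda>x. c *\<^sub>C T x)"
proof -
  have "bounded_clinear (\<lambda>x::'a. c *\<^sub>C x)"
    by (rule bounded_clinearI[where K = "cmod c"])
       (auto simp: scaleC_add_right scaleC_scaleC mult.commute norm_scaleC)
  from bounded_clinear_compose[OF this assms] show ?thesis .
qed

lemma bounded_clinear_scaleR_op:
  "bounded_clinear T \<Longrightarrow> bounded_clinear (\<lambda>x. r *\<^sub>R T x)"
  by (simp add: scaleR_eq_scaleC bounded_clinear_scaleC_op)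

lemma bounded_clinear_diff_op:
  assumes "bounded_clinear S" "bounded_clinear T"
  shows "bounded_clinear (\<lambda>x. S x - T x)"
  using bounded_clinear_add_op[OF assms(1) bounded_clinear_scaleR_op[OF assms(2), of "-1"]] by simp

section \<open>Riesz representation, Douglas factorisation and adjoints\<close>

lemma quadratic_nonneg_imp_linear_coeff_zero:
  fixes a b :: real
  assumes "\<And>t. 0 \<le> b * t + a * t\<^sup>2"
  shows "b = 0"
proof (rule ccontr)
  assume b: "b \<noteq> 0"
  \<comment> \<open>Since d exceeds \<bar>a\<bar>, at t = - b / d the linear term outweighs the
    quadratic one.\<close>
  define d where "d = 1 + \<bar>a\<bar>"
  have "d > 0" by (simp add: d_def)
  then have "b * (- b / d) + a * (- b / d)\<^sup>2 = (b\<^sup>2 / d) * (a / d - 1)"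
    by (simp add: field_simps power2_eq_square)
  moreover have "b\<^sup>2 / d * (a / d - 1) < 0"
    by (rule mult_pos_neg) (use b in \<open>auto simp: d_def divide_simps\<close>)
  ultimately have "b * (- b / d) + a * (- b / d)\<^sup>2 < 0" by simp
  with assms[of "- b / d"] show False by simp
qed

text \<open>A minimising sequence of \<open>\<parallel>P x\<parallel>\<^sup>2 - 2 Re \<langle>f, S x\<rangle>\<close> need not converge, but its image under
  \<open>P\<close> does, by the parallelogram law.\<close>

lemma riesz_majorized:
  fixes P S :: "'a::chilbert \<Rightarrow> 'a"
  assumes P: "bounded_clinear P" and S: "bounded_clinear S"
    and le: "\<And>x. norm (S x) \<le> norm (P x)"
  shows "\<exists>h. h \<in> closure (range P) \<and> norm h \<le> norm f \<and> (\<forall>x. cinner f (S x) = cinner h (P x))"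
proof -
  define J where "J x = (norm (P x))\<^sup>2 - 2 * Re (cinner f (S x))" for x
  have lower: "J x \<ge> - (norm f)\<^sup>2" for x
  proof -
    have "Re (cinner f (S x)) \<le> norm f * norm (P x)"
      using complex_Re_le_cmod[of "cinner f (S x)"] cinner_Cauchy_Schwarz[of f "S x"]
        mult_left_mono[OF le[of x] norm_ge_zero[of f]] by linarith
    moreover have "0 \<le> (norm (P x) - norm f)\<^sup>2" by simp
    ultimately show ?thesis unfolding J_def power2_diff by (simp add: mult.commute mult.left_commute)
  qed
  define m where "m = Inf (range J)"
  have bdd: "bdd_below (range J)" using lower by (auto intro!: bdd_belowI)
  have m_le: "m \<le> J x" for x unfolding m_def by (rule cInf_lower[OF _ bdd]) auto
  define d where "d n = inverse (real (Suc n))" for n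
  have d_pos: "0 < d n" for n by (simp add: d_def)
  have d_mono: "N \<le> n \<Longrightarrow> d n \<le> d N" for n N by (simp add: d_def)
  have d_tendsto: "d \<longlonglongrightarrow> 0" unfolding d_def by (rule LIMSEQ_inverse_real_of_nat)
  have "\<exists>x. J x < m + d n" for n
    using cInf_lessD[of "range J" "m + d n"] d_pos[of n] by (auto simp: m_def)
  then obtain xs where xs: "\<And>n. J (xs n) < m + d n" by metis
  have expand: "J (u + t *\<^sub>R x) = J u + 2 * (Re (cinner (P u) (P x)) - Re (cinner f (S x))) * t + (norm (P x))\<^sup>2 * t\<^sup>2"
    for u x t
    by (simp add: J_def bounded_clinear_add[OF P] bounded_clinear_add[OF S]
        bounded_clinear_scaleR[OF P] bounded_clinear_scaleR[OF S] norm_add_sq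
        cinner_add_right cinner_scaleR_right algebra_simps power_mult_distrib)
  \<comment> \<open>The parallelogram law at the midpoint, written as b + (a - b) / 2 so that
    \<open>expand\<close> applies.\<close>
  have par: "(norm (P a - P b))\<^sup>2 \<le> 2 * J a + 2 * J b - 4 * m" for a b
  proof -
    have "Re (cinner (P b) (P a)) = Re (cinner (P a) (P b))"
      using arg_cong[OF cinner_commute[of "P b" "P a"], of Re] by simp
    then have "J (b + (1/2) *\<^sub>R (a - b)) = J a / 2 + J b / 2 - (norm (P a - P b))\<^sup>2 / 4"
      unfolding expand unfolding J_def bounded_clinear_diff[OF P] bounded_clinear_diff[OF S] norm_diff_sq
      by (simp add: cinner_diff_right cinner_self power2_eq_square field_simps)
    with m_le[of "b + (1/2) *\<^sub>R (a - b)"] have "m \<le> J a / 2 + J b / 2 - (norm (P a - P b))\<^sup>2 / 4"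
      by simp
    then show ?thesis by (simp add: field_simps)
  qed
  have "Cauchy (\<lambda>n. P (xs n))"
  proof (rule metric_CauchyI)
    fix e :: real assume e: "e > 0"
    obtain N where N: "d N < e\<^sup>2 / 4" using reals_Archimedean[of "e\<^sup>2 / 4"] e by (auto simp: d_def)
    have "dist (P (xs i)) (P (xs j)) < e" if "i \<ge> N" "j \<ge> N" for i j
    proof -
      have "(norm (P (xs i) - P (xs j)))\<^sup>2 < e\<^sup>2"
        using par[of "xs i" "xs j"] xs[of i] xs[of j] N d_mono[OF that(1)] d_mono[OF that(2)] by linarith
      then show ?thesis using e by (simp add: dist_norm power2_less_imp_less)
    qed
    then show "\<exists>M. \<forall>i\<ge>M. \<forall>j\<ge>M. dist (P (xs i)) (P (xs j)) < e" by blast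
  qed
  then obtain h where h: "(\<lambda>n. P (xs n)) \<longlonglongrightarrow> h" using Cauchy_convergent convergent_def by blast
  \<comment> \<open>First variation: since J (xs n + t x) is at least m, which exceeds J (xs n) - d
    n, the quadratic in t is nonnegative up to \<open>d n\<close>, and nonnegative in the
    limit.\<close>
  have re: "Re (cinner f (S x)) = Re (cinner h (P x))" for x
  proof -
    have "0 \<le> 2 * (Re (cinner h (P x)) - Re (cinner f (S x))) * t + (norm (P x))\<^sup>2 * t\<^sup>2" for t
    proof (rule LIMSEQ_le)
      show "(\<lambda>n. 0) \<longlonglongrightarrow> (0::real)" by simp
      show "(\<lambda>n. d n + 2 * (Re (cinner (P (xs n)) (P x)) - Re (cinner f (S x))) * t + (norm (P x))\<^sup>2 * t\<^sup>2)
        \<longlonglongrightarrow> 2 * (Re (cinner h (P x)) - Re (cinner f (S x))) * t + (norm (P x))\<^sup>2 * t\<^sup>2"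
        using tendsto_add[OF tendsto_add[OF d_tendsto tendsto_mult[OF tendsto_mult[OF tendsto_const[of 2]
          tendsto_diff[OF tendsto_Re[OF tendsto_cinner[OF h tendsto_const[of "P x"]]]
            tendsto_const[of "Re (cinner f (S x))"]]] tendsto_const[of t]]]
          tendsto_const[of "(norm (P x))\<^sup>2 * t\<^sup>2"]]
        by simp
      show "\<exists>N. \<forall>n\<ge>N. 0 \<le> d n + 2 * (Re (cinner (P (xs n)) (P x)) - Re (cinner f (S x))) * t + (norm (P x))\<^sup>2 * t\<^sup>2"
      proof (intro exI allI impI)
        fix n :: nat
        show "0 \<le> d n + 2 * (Re (cinner (P (xs n)) (P x)) - Re (cinner f (S x))) * t + (norm (P x))\<^sup>2 * t\<^sup>2"
          using m_le[of "xs n + t *\<^sub>R x"] xs[of n] unfolding expand by linarith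
      qed
    qed
    from quadratic_nonneg_imp_linear_coeff_zero[OF this] show ?thesis by simp
  qed
  have eq: "cinner f (S x) = cinner h (P x)" for x
    using re[of x] re[of "\<i> *\<^sub>C x"]
    by (simp add: bounded_clinear_scaleC[OF P] bounded_clinear_scaleC[OF S] cinner_scaleC_right complex_eq_iff)
  have cl: "h \<in> closure (range P)" unfolding closure_sequential
    by (intro exI[of _ "\<lambda>n. P (xs n)"] conjI allI rangeI h)
  have "(norm h)\<^sup>2 \<le> norm f * norm h"
  proof (rule LIMSEQ_le)
    show "(\<lambda>n. Re (cinner h (P (xs n)))) \<longlonglongrightarrow> (norm h)\<^sup>2"
      using tendsto_Re[OF tendsto_cinner[OF tendsto_const[of h] h]] by (simp add: cinner_self)
    show "(\<lambda>n. norm f * norm (P (xs n))) \<longlonglongrightarrow> norm f * norm h" by (intro tendsto_intros h)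
    have "Re (cinner h (P x)) \<le> norm f * norm (P x)" for x
      using complex_Re_le_cmod[of "cinner f (S x)"] cinner_Cauchy_Schwarz[of f "S x"]
        mult_left_mono[OF le[of x] norm_ge_zero[of f]] eq[of x] by simp
    then show "\<exists>N. \<forall>n\<ge>N. Re (cinner h (P (xs n))) \<le> norm f * norm (P (xs n))" by blast
  qed
  then have "norm h \<le> norm f" by (cases "h = 0") (auto simp: power2_eq_square)
  with cl eq show ?thesis by blast
qed

lemma closure_range_orthogonal_eq_zero:
  fixes P :: "'a::chilbert \<Rightarrow> 'a"
  assumes "h \<in> closure (range P)" "\<And>x. cinner h (P x) = 0"
  shows "h = 0"
proof -
  obtain v where v: "\<And>n. v n \<in> range P" "v \<longlonglongrightarrow> h"
    using assms(1) by (auto simp: closure_sequential)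
  have "cinner h (v n) = 0" for n using v(1)[of n] assms(2) by auto
  then have "(\<lambda>n. 0) \<longlonglongrightarrow> cinner h h" using tendsto_cinner[OF tendsto_const[of h] v(2)] by simp
  then have "cinner h h = 0" by (simp add: LIMSEQ_const_iff)
  then show ?thesis by (simp add: cinner_self_eq_zero)
qed

lemma closure_range_clinear:
  fixes P :: "'a::chilbert \<Rightarrow> 'a"
  assumes P: "bounded_clinear P" and "h \<in> closure (range P)" "g \<in> closure (range P)"
  shows "a *\<^sub>C h + g \<in> closure (range P)"
proof -
  obtain v where v: "\<And>n. v n \<in> range P" "v \<longlonglongrightarrow> h"
    using assms(2) by (auto simp: closure_sequential)
  obtain w where w: "\<And>n. w n \<in> range P" "w \<longlonglongrightarrow> g"
    using assms(3) by (auto simp: closure_sequential)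
  have "a *\<^sub>C v n + w n \<in> range P" for n
    using v(1)[of n] w(1)[of n] by (metis (no_types, lifting) P bounded_clinear_add bounded_clinear_scaleC image_iff rangeI)
  moreover have "(\<lambda>n. a *\<^sub>C v n + w n) \<longlonglongrightarrow> a *\<^sub>C h + g"
    by (intro tendsto_add bounded_linear.tendsto[OF bounded_linear_scaleC] v w)
  ultimately show ?thesis unfolding closure_sequential
    by (intro exI[of _ "\<lambda>n. a *\<^sub>C v n + w n"] conjI allI)
qed

text \<open>Douglas factorisation: S is the adjoint of W composed with P. Choosing the representing
  vectors in the closure of the range of P makes them unique, and uniqueness makes W linear. With P
  a multiple of the identity this gives adjoints, with P = |T| the polar decomposition.\<close>

lemma majorized_factor:
  fixes P S :: "'a::chilbert \<Rightarrow> 'a"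
  assumes P: "bounded_clinear P" and S: "bounded_clinear S"
    and le: "\<And>x. norm (S x) \<le> norm (P x)"
  obtains W where "bounded_clinear W" "\<And>x. norm (W x) \<le> norm x"
    "\<And>f x. cinner f (S x) = cinner (W f) (P x)"
proof -
  obtain W where W: "\<And>f. W f \<in> closure (range P)" "\<And>f. norm (W f) \<le> norm f"
     "\<And>f x. cinner f (S x) = cinner (W f) (P x)"
    using riesz_majorized[OF assms] by metis
  have lin: "W (a *\<^sub>C f + g) = a *\<^sub>C W f + W g" for a f g
  proof -
    have "(-1) *\<^sub>C (a *\<^sub>C W f + W g) + W (a *\<^sub>C f + g) \<in> closure (range P)"
      by (intro closure_range_clinear P W)
    moreover have "cinner ((-1) *\<^sub>C (a *\<^sub>C W f + W g) + W (a *\<^sub>C f + g)) (P x) = 0" for x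
      by (simp add: cinner_add_left cinner_scaleC_left W(3)[symmetric])
    ultimately have "(-1) *\<^sub>C (a *\<^sub>C W f + W g) + W (a *\<^sub>C f + g) = 0"
      by (rule closure_range_orthogonal_eq_zero)
    then show ?thesis by (simp add: scaleC_minus_left add_eq_0_iff)
  qed
  have "W 0 = 0" using W(2)[of 0] by simp
  then have "bounded_clinear W"
    using lin[of 1] lin[of _ _ 0] W(2) by (intro bounded_clinearI[where K = 1]) auto
  with W that show ?thesis by blast
qed

lemma adj_exists:
  fixes T :: "'a::chilbert \<Rightarrow> 'a"
  assumes T: "bounded_clinear T"
  shows "\<exists>S. bounded_clinear S \<and> (\<forall>x y. cinner (T x) y = cinner x (S y))"
proof -
  obtain K where K: "K > 0" "\<And>x. norm (T x) \<le> K * norm x" using bounded_clinear_bound[OF T] by blast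
  obtain W where W: "bounded_clinear W" "\<And>f x. cinner f (T x) = cinner (W f) (K *\<^sub>R x)"
  proof (rule majorized_factor[OF bounded_clinear_scaleR_op[OF bounded_clinear_id, of K] T])
    show "norm (T x) \<le> norm (K *\<^sub>R x)" for x using K by simp
  qed blast
  have "cinner (T x) y = cinner x (K *\<^sub>R W y)" for x y
    using W(2)[of y x] cinner_commute[of "T x" y] cinner_commute[of x "W y"]
    by (simp add: cinner_scaleR_right cinner_scaleR_left)
  then show ?thesis using bounded_clinear_scaleR_op[OF W(1)] by blast
qed

lemma adj_props:
  fixes T :: "'a::chilbert \<Rightarrow> 'a"
  assumes T: "bounded_clinear T"
  shows bounded_clinear_adj: "bounded_clinear (adj T)"
    and cinner_adj_right: "cinner x (adj T y) = cinner (T x) y"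
proof -
  obtain S where S: "bounded_clinear S" "\<forall>x y. cinner (T x) y = cinner x (S y)"
    using adj_exists[OF T] by blast
  have "adj T = S" unfolding adj_def
  proof (rule the_equality)
    fix S' assume "\<forall>x y. cinner (T x) y = cinner x (S' y)"
    with S(2) have "cinner z (S' y) = cinner z (S y)" for y z by simp
    then show "S' = S" by (intro ext cinner_eqI)
  qed (rule S)
  with S show "bounded_clinear (adj T)" "cinner x (adj T y) = cinner (T x) y" by auto
qed

lemma cinner_adj_left:
  "bounded_clinear T \<Longrightarrow> cinner (adj T x) y = cinner x (T y)"
  by (metis cinner_adj_right cinner_commute)

lemma norm_adj_le:
  assumes T: "bounded_clinear T" and K: "\<And>x. norm (T x) \<le> K * norm x"
  shows "norm (adj T x) \<le> K * norm x"
proof -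
  have "(norm (adj T x))\<^sup>2 = Re (cinner x (T (adj T x)))"
    using arg_cong[OF cinner_adj_left[OF T, of x "adj T x"], of Re] by (simp add: cinner_self)
  also have "\<dots> \<le> norm x * norm (T (adj T x))"
    using complex_Re_le_cmod cinner_Cauchy_Schwarz order_trans by blast
  also have "\<dots> \<le> norm x * (K * norm (adj T x))" by (intro mult_left_mono K) auto
  finally have "norm (adj T x) * norm (adj T x) \<le> (K * norm x) * norm (adj T x)"
    by (simp add: power2_eq_square mult_ac)
  moreover have "0 \<le> K * norm x" using K[of x] norm_ge_zero order_trans by blast
  ultimately show ?thesis by (cases "adj T x = 0") auto
qed

section \<open>Square roots and polar decomposition\<close>

lemma positive_op_bounded: "positive_op P \<Longrightarrow> bounded_clinear P"
  and positive_op_Re: "positive_op P \<Longrightarrow> 0 \<le> Re (cinner x (P x))"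
  and positive_op_Im: "positive_op P \<Longrightarrow> Im (cinner x (P x)) = 0"
  by (auto simp: positive_op_def)

text \<open>Polarisation: a form that is real at x + y and at x + i y (and at x and y) is Hermitian;
  the first vector settles imaginary parts, the second real parts.\<close>

lemma positive_op_symmetric:
  assumes P: "positive_op P"
  shows "cinner (P x) y = cinner x (P y)"
proof -
  note B = positive_op_bounded[OF P]
  have 1: "Im (cinner x (P y) + cinner y (P x)) = 0"
    using positive_op_Im[OF P, of "x + y"] positive_op_Im[OF P, of x] positive_op_Im[OF P, of y]
    by (simp add: bounded_clinear_add[OF B] cinner_add_left cinner_add_right)
  have 2: "Re (cinner x (P y) - cinner y (P x)) = 0"
    using positive_op_Im[OF P, of "x + \<i> *\<^sub>C y"] positive_op_Im[OF P, of x] positive_op_Im[OF P, of y]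
    by (simp add: bounded_clinear_add[OF B] bounded_clinear_scaleC[OF B] cinner_add_left
        cinner_add_right cinner_scaleC_left cinner_scaleC_right)
  have "cinner y (P x) = cnj (cinner x (P y))" using 1 2 by (simp add: complex_eq_iff)
  then show ?thesis using cinner_commute[of "P x" y] by simp
qed

text \<open>This is P^2 \<le> K P, read off from positivity of the form at x - P x / K. It gives
  both the kernel of a positive operator and the contractivity of 1 - P / K.\<close>

lemma positive_op_norm_sq_le:
  assumes P: "positive_op P" and K: "K > 0" "\<And>x. norm (P x) \<le> K * norm x"
  shows "(norm (P x))\<^sup>2 \<le> K * Re (cinner x (P x))"
proof -
  note B = positive_op_bounded[OF P]
  define q where "q = Re (cinner (P x) (P (P x)))"
  have "q \<le> norm (P x) * norm (P (P x))"
    unfolding q_def using complex_Re_le_cmod cinner_Cauchy_Schwarz order_trans by blast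
  also have "\<dots> \<le> norm (P x) * (K * norm (P x))" by (intro mult_left_mono K) auto
  finally have q: "q \<le> K * (norm (P x))\<^sup>2" by (simp add: power2_eq_square mult_ac)
  have "0 \<le> Re (cinner (x - (1 / K) *\<^sub>R P x) (P (x - (1 / K) *\<^sub>R P x)))"
    by (rule positive_op_Re[OF P])
  also have "\<dots> = Re (cinner x (P x)) - 2 * (norm (P x))\<^sup>2 / K + q / K\<^sup>2"
    using arg_cong[OF positive_op_symmetric[OF P, of x "P x"], of Re] K(1)
    by (simp add: field_simps bounded_clinear_diff[OF B] bounded_clinear_scaleR[OF B] cinner_diff_left
        cinner_diff_right cinner_scaleR_left cinner_scaleR_right cinner_self q_def power2_eq_square)
  also have "\<dots> \<le> Re (cinner x (P x)) - 2 * (norm (P x))\<^sup>2 / K + (norm (P x))\<^sup>2 / K"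
    using divide_right_mono[OF q, of "K\<^sup>2"] K(1) by (simp add: power2_eq_square)
  finally show ?thesis using K(1) by (simp add: field_simps)
qed

lemma positive_op_kernel:
  assumes P: "positive_op P" and "Re (cinner x (P x)) = 0"
  shows "P x = 0"
proof -
  obtain K where K: "K > 0" "\<And>x. norm (P x) \<le> K * norm x"
    using bounded_clinear_bound[OF positive_op_bounded[OF P]] by blast
  show ?thesis using positive_op_norm_sq_le[OF P K, of x] assms(2) by simp
qed

text \<open>The increasing iteration for \<open>1 - sqrt (1 - X)\<close>, together with its scalar version for \<open>X = 1\<close>,
  which dominates the increments in norm.\<close>

primrec sqrt_iter :: "('a::chilbert \<Rightarrow> 'a) \<Rightarrow> nat \<Rightarrow> 'a \<Rightarrow> 'a" where
  "sqrt_iter X 0 = (\<lambda>x. 0)"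
| "sqrt_iter X (Suc n) = (\<lambda>x. (1/2) *\<^sub>R (X x + sqrt_iter X n (sqrt_iter X n x)))"

primrec sqrt_iter_bound :: "nat \<Rightarrow> real" where
  "sqrt_iter_bound 0 = 0"
| "sqrt_iter_bound (Suc n) = (1 + (sqrt_iter_bound n)\<^sup>2) / 2"

lemma sqrt_iter_bound_range: "0 \<le> sqrt_iter_bound n \<and> sqrt_iter_bound n \<le> 1"
  by (induction n) (auto simp: power_le_one)

lemma sqrt_iter_bound_mono: "sqrt_iter_bound n \<le> sqrt_iter_bound (Suc n)"
  by (induction n) (use sqrt_iter_bound_range in \<open>auto intro!: power_mono\<close>)

lemma sqrt_iter_bounded_clinear: "bounded_clinear X \<Longrightarrow> bounded_clinear (sqrt_iter X n)"
proof (induction n)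
  case 0 then show ?case by (auto intro!: bounded_clinearI[where K = 0])
next
  case (Suc n)
  note Y = Suc.IH[OF Suc.prems]
  show ?case unfolding sqrt_iter.simps
    by (intro bounded_clinear_scaleR_op bounded_clinear_add_op Suc.prems bounded_clinear_compose[OF Y Y])
qed

lemma norm_sqrt_iter_le:
  assumes X: "\<And>x. norm (X x) \<le> norm x"
  shows "norm (sqrt_iter X n x) \<le> sqrt_iter_bound n * norm x"
proof (induction n arbitrary: x)
  case (Suc n)
  have "norm (sqrt_iter X n (sqrt_iter X n x)) \<le> sqrt_iter_bound n * (sqrt_iter_bound n * norm x)"
    using Suc[of "sqrt_iter X n x"] mult_left_mono[OF Suc[of x], of "sqrt_iter_bound n"]
      sqrt_iter_bound_range[of n] by linarith
  then have "norm (X x + sqrt_iter X n (sqrt_iter X n x)) \<le> norm x + sqrt_iter_bound n * (sqrt_iter_bound n * norm x)"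
    using norm_triangle_ineq[of "X x" "sqrt_iter X n (sqrt_iter X n x)"] X[of x] by linarith
  then show ?case unfolding sqrt_iter.simps sqrt_iter_bound.simps norm_scaleR
    by (simp add: field_simps power2_eq_square)
qed auto

lemma norm_sqrt_iter_diff_le:
  assumes B: "bounded_clinear X" and X: "\<And>x. norm (X x) \<le> norm x"
  shows "norm (sqrt_iter X (Suc n) x - sqrt_iter X n x)
    \<le> (sqrt_iter_bound (Suc n) - sqrt_iter_bound n) * norm x"
proof (induction n arbitrary: x)
  case 0
  then show ?case using X[of x] by simp
next
  case (Suc n)
  let ?Y = "sqrt_iter X n" and ?Z = "sqrt_iter X (Suc n)"
  let ?y = "sqrt_iter_bound n" and ?z = "sqrt_iter_bound (Suc n)"
  note Y = sqrt_iter_bounded_clinear[OF B, of "n"] and Z = sqrt_iter_bounded_clinear[OF B, of "Suc n"]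
  \<comment> \<open>With Z and Y the two preceding iterates, Z Z - Y Y is split as Z (Z - Y) + (Z -
    Y) Y; the bounds of the two terms add up to the scalar difference z^2 - y^2.\<close>
  have "sqrt_iter X (Suc (Suc n)) x - ?Z x = (1/2) *\<^sub>R (?Z (?Z x - ?Y x) + (?Z (?Y x) - ?Y (?Y x)))"
  proof -
    have "sqrt_iter X (Suc (Suc n)) x = (1/2) *\<^sub>R (X x + ?Z (?Z x))" by (simp only: sqrt_iter.simps(2)[of X "Suc n"])
    moreover have "?Z x = (1/2) *\<^sub>R (X x + ?Y (?Y x))" by simp
    ultimately show ?thesis unfolding bounded_clinear_diff[OF Z]
      by (simp only: scaleR_add_right scaleR_diff_right) (simp del: sqrt_iter.simps)
  qed
  moreover have "norm (?Z (?Z x - ?Y x)) \<le> ?z * ((?z - ?y) * norm x)"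
    using norm_sqrt_iter_le[OF X, of "Suc n" "?Z x - ?Y x"]
      mult_left_mono[OF Suc[of x], of ?z] sqrt_iter_bound_range[of "Suc n"] by linarith
  moreover have "norm (?Z (?Y x) - ?Y (?Y x)) \<le> (?z - ?y) * (?y * norm x)"
    using Suc[of "?Y x"] mult_left_mono[OF norm_sqrt_iter_le[OF X, of n x], of "?z - ?y"]
      sqrt_iter_bound_mono[of n] by linarith
  ultimately have "norm (sqrt_iter X (Suc (Suc n)) x - ?Z x)
      \<le> (?z * ((?z - ?y) * norm x) + (?z - ?y) * (?y * norm x)) / 2"
    using norm_triangle_ineq[of "?Z (?Z x - ?Y x)" "?Z (?Y x) - ?Y (?Y x)"]
    by (simp del: sqrt_iter.simps sqrt_iter_bound.simps)
  also have "\<dots> = (?z\<^sup>2 - ?y\<^sup>2) / 2 * norm x"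
    by (simp add: power2_eq_square algebra_simps del: sqrt_iter_bound.simps)
  also have "(?z\<^sup>2 - ?y\<^sup>2) / 2 = sqrt_iter_bound (Suc (Suc n)) - ?z"
    unfolding sqrt_iter_bound.simps(2)[of "Suc n"]
    by (subst (3) sqrt_iter_bound.simps(2)) (simp add: field_simps del: sqrt_iter_bound.simps)
  finally show ?case .
qed

lemma sqrt_iter_commute:
  assumes C: "bounded_clinear C" and "\<And>x. C (X x) = X (C x)"
  shows "C (sqrt_iter X n x) = sqrt_iter X n (C x)"
  by (induction n arbitrary: x)
     (auto simp: bounded_clinear_zero[OF C] bounded_clinear_add[OF C] bounded_clinear_scaleR[OF C] assms(2))

lemma sqrt_iter_symmetric:
  assumes "\<And>x y. cinner (X x) y = cinner x (X y)"
  shows "cinner (sqrt_iter X n x) y = cinner x (sqrt_iter X n y)"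
  by (induction n arbitrary: x y)
     (auto simp: cinner_scaleR_left cinner_scaleR_right cinner_add_left cinner_add_right assms)

text \<open>The equation \<open>2 *\<^sub>R Y x = X x + Y (Y x)\<close> says (1 - Y)^2 = 1 - X. The
  increments are summable because the scalar iteration is monotone and bounded. The commutation
  clause is carried along for the uniqueness of square roots.\<close>

lemma sqrt_one_minus:
  fixes X :: "'a::chilbert \<Rightarrow> 'a"
  assumes B: "bounded_clinear X" and X: "\<And>x. norm (X x) \<le> norm x"
    and sym: "\<And>x y. cinner (X x) y = cinner x (X y)"
  obtains Y where "bounded_clinear Y" "\<And>x. norm (Y x) \<le> norm x"
    "\<And>x y. cinner (Y x) y = cinner x (Y y)" "\<And>x. 2 *\<^sub>R Y x = X x + Y (Y x)"
    "\<And>C x. bounded_clinear C \<Longrightarrow> (\<And>x. C (X x) = X (C x)) \<Longrightarrow> C (Y x) = Y (C x)"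
proof -
  have "monoseq sqrt_iter_bound" using sqrt_iter_bound_mono by (simp add: monoseq_Suc)
  moreover have "Bseq sqrt_iter_bound"
    using sqrt_iter_bound_range by (intro BseqI'[where K = 1]) auto
  ultimately have "convergent sqrt_iter_bound" using Bseq_monoseq_convergent by blast
  then have sumd: "summable (\<lambda>n. sqrt_iter_bound (Suc n) - sqrt_iter_bound n)"
    using telescope_summable convergent_def by blast
  have "convergent (\<lambda>n. sqrt_iter X n x)" for x
  proof -
    have "summable (\<lambda>n. sqrt_iter X (Suc n) x - sqrt_iter X n x)"
      by (rule summable_comparison_test'[OF summable_mult2[OF sumd, of "norm x"]])
         (rule norm_sqrt_iter_diff_le[OF B X])
    then have "convergent (\<lambda>n. \<Sum>i<n. sqrt_iter X (Suc i) x - sqrt_iter X i x)"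
      by (simp add: summable_iff_convergent del: sqrt_iter.simps)
    moreover have "(\<lambda>n. \<Sum>i<n. sqrt_iter X (Suc i) x - sqrt_iter X i x) = (\<lambda>n. sqrt_iter X n x)"
      by (rule ext, subst sum_lessThan_telescope) simp
    ultimately show ?thesis by simp
  qed
  then obtain Y where Y: "\<And>x. (\<lambda>n. sqrt_iter X n x) \<longlonglongrightarrow> Y x"
    unfolding convergent_def by metis
  note lin = sqrt_iter_bounded_clinear[OF B]
  have bound: "norm (sqrt_iter X n x) \<le> norm x" for n x
    using norm_sqrt_iter_le[OF X, of n x] sqrt_iter_bound_range[of n]
      mult_right_mono[of "sqrt_iter_bound n" 1 "norm x"] by simp
  have normY: "norm (Y x) \<le> norm x" for x
    by (rule LIMSEQ_le_const2[OF tendsto_norm[OF Y]]) (use bound in blast)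
  have add: "Y (x + y) = Y x + Y y" for x y
    by (rule LIMSEQ_unique[OF Y]) (use tendsto_add[OF Y Y] in \<open>simp add: bounded_clinear_add[OF lin]\<close>)
  have scale: "Y (c *\<^sub>C x) = c *\<^sub>C Y x" for c x
    by (rule LIMSEQ_unique[OF Y])
       (use bounded_linear.tendsto[OF bounded_linear_scaleC Y] in \<open>simp add: bounded_clinear_scaleC[OF lin]\<close>)
  have BY: "bounded_clinear Y" by (rule bounded_clinearI[where K = 1]) (use add scale normY in auto)
  have symY: "cinner (Y x) y = cinner x (Y y)" for x y
    by (rule LIMSEQ_unique[OF tendsto_cinner[OF Y tendsto_const]])
       (use tendsto_cinner[OF tendsto_const Y] in \<open>simp add: sqrt_iter_symmetric[OF sym]\<close>)
  \<comment> \<open>The iterate acts on a moving vector; contractivity uniform in n reduces this to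
    convergence at the fixed vector \<open>Y x\<close>.\<close>
  have YY: "(\<lambda>n. sqrt_iter X n (sqrt_iter X n x)) \<longlonglongrightarrow> Y (Y x)" for x
  proof -
    have "(\<lambda>n. sqrt_iter X n (sqrt_iter X n x - Y x)) \<longlonglongrightarrow> 0"
    proof (rule Lim_null_comparison)
      show "(\<lambda>n. norm (sqrt_iter X n x - Y x)) \<longlonglongrightarrow> 0"
        using tendsto_norm[OF tendsto_diff[OF Y[of x] tendsto_const[of "Y x"]]] by simp
    qed (use bound in auto)
    from tendsto_add[OF this Y[of "Y x"]] show ?thesis by (simp add: bounded_clinear_diff[OF lin])
  qed
  have fixY: "2 *\<^sub>R Y x = X x + Y (Y x)" for x
  proof -
    have "(\<lambda>n. 2 *\<^sub>R sqrt_iter X (Suc n) x) \<longlonglongrightarrow> 2 *\<^sub>R Y x"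
      by (intro tendsto_intros LIMSEQ_Suc[OF Y])
    moreover have "(\<lambda>n. 2 *\<^sub>R sqrt_iter X (Suc n) x) \<longlonglongrightarrow> X x + Y (Y x)"
      using tendsto_add[OF tendsto_const[of "X x"] YY[of x]] by simp
    ultimately show ?thesis by (rule LIMSEQ_unique)
  qed
  have "C (Y x) = Y (C x)" if C: "bounded_clinear C" "\<And>x. C (X x) = X (C x)" for C x
    by (rule LIMSEQ_unique[OF bounded_linear.tendsto[OF bounded_clinear_imp_bounded_linear[OF C(1)] Y]])
       (use Y in \<open>simp add: sqrt_iter_commute[of C X, OF C]\<close>)
  with that BY normY symY fixY show ?thesis by blast
qed

text \<open>Write P = K (1 - X) with the contraction X = 1 - P / K; then R = sqrt K (1 - Y) for the
  Y of \<open>sqrt_one_minus\<close>, and R is positive because Y is a symmetric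
  contraction.\<close>

lemma positive_sqrt_exists:
  fixes P :: "'a::chilbert \<Rightarrow> 'a"
  assumes P: "positive_op P"
  obtains R where "positive_op R" "\<And>x. R (R x) = P x"
    "\<And>C x. bounded_clinear C \<Longrightarrow> (\<And>x. C (P x) = P (C x)) \<Longrightarrow> C (R x) = R (C x)"
proof -
  note BP = positive_op_bounded[OF P]
  obtain K where K: "K > 0" "\<And>x. norm (P x) \<le> K * norm x"
    using bounded_clinear_bound[OF BP] by blast
  define X where "X x = x - (1 / K) *\<^sub>R P x" for x
  have BX: "bounded_clinear X" unfolding X_def
    by (intro bounded_clinear_diff_op bounded_clinear_id bounded_clinear_scaleR_op BP)
  have normX: "norm (X x) \<le> norm x" for x
  proof -
    have "(norm (X x))\<^sup>2 = (norm x)\<^sup>2 + (norm (P x))\<^sup>2 / K\<^sup>2 - 2 * Re (cinner x (P x)) / K"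
      unfolding X_def norm_diff_sq by (simp add: cinner_scaleR_right power_divide)
    also have "(norm (P x))\<^sup>2 / K\<^sup>2 \<le> Re (cinner x (P x)) / K"
      using positive_op_norm_sq_le[OF P K, of x] K(1) by (simp add: field_simps power2_eq_square)
    also have "(norm x)\<^sup>2 + Re (cinner x (P x)) / K - 2 * Re (cinner x (P x)) / K \<le> (norm x)\<^sup>2"
      using positive_op_Re[OF P, of x] K(1) by (simp add: field_simps)
    finally show ?thesis by (simp add: power2_le_iff_abs_le)
  qed
  have symX: "cinner (X x) y = cinner x (X y)" for x y
    by (simp add: X_def cinner_diff_left cinner_diff_right cinner_scaleR_left cinner_scaleR_right
        positive_op_symmetric[OF P])
  obtain Y where Y: "bounded_clinear Y" "\<And>x. norm (Y x) \<le> norm x"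
    "\<And>x y. cinner (Y x) y = cinner x (Y y)" "\<And>x. 2 *\<^sub>R Y x = X x + Y (Y x)"
    "\<And>C x. bounded_clinear C \<Longrightarrow> (\<And>x. C (X x) = X (C x)) \<Longrightarrow> C (Y x) = Y (C x)"
    using sqrt_one_minus[OF BX normX symX] by blast
  define R where "R x = sqrt K *\<^sub>R (x - Y x)" for x
  have BR: "bounded_clinear R" unfolding R_def
    by (intro bounded_clinear_diff_op bounded_clinear_id bounded_clinear_scaleR_op Y)
  have "Im (cinner x (Y x)) = 0" for x
    using arg_cong[OF cinner_commute[of x "Y x"], of Im] Y(3)[of x x] by simp
  moreover have "Re (cinner x (Y x)) \<le> (norm x)\<^sup>2" for x
  proof -
    have "Re (cinner x (Y x)) \<le> norm x * norm (Y x)"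
      using complex_Re_le_cmod cinner_Cauchy_Schwarz order_trans by blast
    also have "\<dots> \<le> norm x * norm x" by (intro mult_left_mono Y) auto
    finally show ?thesis by (simp add: power2_eq_square)
  qed
  ultimately have posR: "positive_op R"
    unfolding positive_op_def using BR K(1)
    by (auto simp: R_def cinner_scaleR_right cinner_diff_right cinner_self)
  have RR: "R (R x) = P x" for x
  proof -
    have "R (R x) = sqrt K *\<^sub>R sqrt K *\<^sub>R ((x - Y x) - (Y x - Y (Y x)))"
      unfolding R_def bounded_clinear_scaleR[OF Y(1)] bounded_clinear_diff[OF Y(1)]
      by (simp only: scaleR_diff_right)
    also have "\<dots> = K *\<^sub>R ((x - Y x) - (Y x - Y (Y x)))" using K(1) by simp
    also have "(x - Y x) - (Y x - Y (Y x)) = x - X x"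
      using Y(4)[of x] by (simp add: scaleR_2 algebra_simps)
    also have "K *\<^sub>R (x - X x) = P x" using K(1) by (simp add: X_def)
    finally show ?thesis .
  qed
  have "C (R x) = R (C x)" if C: "bounded_clinear C" "\<And>x. C (P x) = P (C x)" for C x
  proof -
    have "C (X x) = X (C x)" for x
      by (simp add: X_def bounded_clinear_diff[OF C(1)] bounded_clinear_scaleR[OF C(1)] C(2))
    then show ?thesis using Y(5)[OF C(1)]
      by (simp add: R_def bounded_clinear_diff[OF C(1)] bounded_clinear_scaleR[OF C(1)])
  qed
  with that posR RR show ?thesis by blast
qed

text \<open>S commutes with P, hence with R, so (R + S)(R - S) = 0. For y = R x - S x the forms of R
  and S at y are nonnegative with sum 0, so R y = S y = 0, and then y is orthogonal to itself by
  symmetry.\<close>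

lemma positive_sqrt_unique:
  fixes P :: "'a::chilbert \<Rightarrow> 'a"
  assumes R: "positive_op R" "\<And>x. R (R x) = P x"
    and comm: "\<And>C x. bounded_clinear C \<Longrightarrow> (\<And>x. C (P x) = P (C x)) \<Longrightarrow> C (R x) = R (C x)"
    and S: "positive_op S" "\<And>x. S (S x) = P x"
  shows "S = R"
proof
  fix x
  note BR = positive_op_bounded[OF R(1)] and BS = positive_op_bounded[OF S(1)]
  have "S (P x) = P (S x)" for x by (simp add: S(2)[symmetric])
  with comm[OF BS] have SR: "S (R x) = R (S x)" for x by blast
  define y where "y = R x - S x"
  have "R y + S y = 0"
    by (simp add: y_def bounded_clinear_diff[OF BR] bounded_clinear_diff[OF BS] R(2) S(2) SR)
  then have "Re (cinner y (R y)) + Re (cinner y (S y)) = 0"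
    using cinner_add_right[of y "R y" "S y"] by (simp add: complex_eq_iff)
  then have "Re (cinner y (R y)) = 0" "Re (cinner y (S y)) = 0"
    using positive_op_Re[OF R(1), of y] positive_op_Re[OF S(1), of y] by linarith+
  then have 0: "R y = 0" "S y = 0" using positive_op_kernel R(1) S(1) by blast+
  have "cinner y y = cinner (R x) y - cinner (S x) y"
    by (subst y_def) (simp add: cinner_diff_left)
  also have "\<dots> = 0" by (simp add: positive_op_symmetric R(1) S(1) 0)
  finally show "S x = R x" by (simp add: cinner_self_eq_zero y_def)
qed

lemma op_sqrt_props:
  assumes P: "positive_op P"
  shows positive_op_sqrt: "positive_op (op_sqrt P)" and op_sqrt_op_sqrt: "op_sqrt P (op_sqrt P x) = P x"
proof -
  obtain R where R: "positive_op R" "\<And>x. R (R x) = P x"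
    "\<And>C x. bounded_clinear C \<Longrightarrow> (\<And>x. C (P x) = P (C x)) \<Longrightarrow> C (R x) = R (C x)"
    using positive_sqrt_exists[OF P] by blast
  have "op_sqrt P = R" unfolding op_sqrt_def
  proof (rule the_equality)
    show "positive_op R \<and> R \<circ> R = P" using R(1,2) by (auto simp: fun_eq_iff)
    show "S = R" if "positive_op S \<and> S \<circ> S = P" for S
      using that by (intro positive_sqrt_unique[OF R]) (auto simp: fun_eq_iff)
  qed
  with R show "positive_op (op_sqrt P)" "op_sqrt P (op_sqrt P x) = P x" by auto
qed

lemma abs_op_props:
  assumes T: "bounded_clinear T"
  shows positive_abs_op: "positive_op (abs_op T)" and norm_abs_op: "norm (abs_op T x) = norm (T x)"
proof -
  have P: "positive_op (adj T \<circ> T)" unfolding positive_op_def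
    using bounded_clinear_compose[OF bounded_clinear_adj[OF T] T]
    by (auto simp: cinner_adj_right[OF T] cinner_self o_def)
  show pos: "positive_op (abs_op T)" unfolding abs_op_def by (rule positive_op_sqrt[OF P])
  have "cinner (abs_op T x) (abs_op T x) = cinner x (abs_op T (abs_op T x))"
    by (rule positive_op_symmetric[OF pos])
  also have "\<dots> = cinner (T x) (T x)"
    using op_sqrt_op_sqrt[OF P, of x] by (simp add: abs_op_def cinner_adj_right[OF T])
  finally show "norm (abs_op T x) = norm (T x)" by (simp add: norm_eq_sqrt_cinner)
qed

text \<open>U is only claimed to be a contraction, with W as its adjoint. That W undoes U on the
  range of T is the equality case: W (T x) is no longer than T x, and its real inner product with
  |T| x already equals the square of their common bound.\<close>

lemma polar_decomposition:
  fixes T :: "'a::chilbert \<Rightarrow> 'a"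
  assumes T: "bounded_clinear T"
  obtains U W where "bounded_clinear U" "bounded_clinear W"
    "\<And>x. norm (U x) \<le> norm x" "\<And>x. norm (W x) \<le> norm x"
    "\<And>x y. cinner (W x) y = cinner x (U y)"
    "\<And>x. U (abs_op T x) = T x" "\<And>x. W (T x) = abs_op T x"
proof -
  note BA = positive_op_bounded[OF positive_abs_op[OF T]]
  obtain W where W: "bounded_clinear W" "\<And>x. norm (W x) \<le> norm x"
    "\<And>f x. cinner f (T x) = cinner (W f) (abs_op T x)"
    by (rule majorized_factor[OF BA T]) (auto simp: norm_abs_op[OF T])
  define U where "U = adj W"
  have U: "bounded_clinear U" unfolding U_def by (rule bounded_clinear_adj[OF W(1)])
  have WU: "cinner (W x) y = cinner x (U y)" for x y by (simp add: U_def cinner_adj_right[OF W(1)])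
  have normU: "norm (U x) \<le> norm x" for x
    using norm_adj_le[OF W(1), of 1] W(2) by (simp add: U_def)
  have UT: "U (abs_op T x) = T x" for x by (rule cinner_eqI) (simp add: WU[symmetric] W(3))
  have "W (T x) = abs_op T x" for x
  proof -
    have "Re (cinner (W (T x)) (abs_op T x)) = (norm (T x))\<^sup>2" by (simp add: WU UT cinner_self)
    then have "(norm (W (T x) - abs_op T x))\<^sup>2 \<le> 0"
      using power_mono[OF W(2)[of "T x"] norm_ge_zero, of 2]
      by (simp only: norm_diff_sq norm_abs_op[OF T])
    then show ?thesis by simp
  qed
  with that[OF U W(1) normU W(2) WU UT] show ?thesis by blast
qed

section \<open>Traces and singular values\<close>

lemma homogeneous_system_nontrivial:
  fixes a :: "nat \<Rightarrow> 'i \<Rightarrow> complex"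
  assumes "finite I" "n < card I"
  shows "\<exists>u. (\<exists>i\<in>I. u i \<noteq> 0) \<and> (\<forall>m<n. (\<Sum>i\<in>I. a m i * u i) = 0)"
  using assms
proof (induction n arbitrary: a I)
  case 0
  then have "I \<noteq> {}" by auto
  then show ?case by (intro exI[of _ "\<lambda>_. 1"]) auto
next
  case (Suc n)
  show ?case
  proof (cases "\<forall>i\<in>I. a n i = 0")
    case True
    obtain u where "\<exists>i\<in>I. u i \<noteq> 0" "\<forall>m<n. (\<Sum>i\<in>I. a m i * u i) = 0"
      using Suc.IH[of I a] Suc.prems by auto
    with True show ?thesis by (intro exI[of _ u]) (auto simp: less_Suc_eq)
  next
    case False
    then obtain p where p: "p \<in> I" "a n p \<noteq> 0" by blast
    define J where "J = I - {p}"
    have J: "finite J" "n < card J" using Suc.prems p(1) by (auto simp: J_def card_Diff_singleton)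
    have split: "sum h I = h p + sum h J" for h :: "'i \<Rightarrow> complex"
      unfolding J_def using Suc.prems(1) p(1) by (rule sum.remove)
    obtain u where u: "\<exists>i\<in>J. u i \<noteq> 0"
      "\<forall>m<n. (\<Sum>i\<in>J. (a m i - a m p * a n i / a n p) * u i) = 0"
      using Suc.IH[OF J, of "\<lambda>m i. a m i - a m p * a n i / a n p"] by blast
    define s where "s = (\<Sum>i\<in>J. a n i * u i)"
    \<comment> \<open>The pivot unknown p is recovered from equation n, having been eliminated from
      the others.\<close>
    define v where "v = u(p := - s / a n p)"
    have J_eq: "(\<Sum>i\<in>J. a m i * v i) = (\<Sum>i\<in>J. a m i * u i)" for m
      by (rule sum.cong) (auto simp: v_def J_def)
    have "(\<Sum>i\<in>I. a m i * v i) = 0" if "m < Suc n" for m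
    proof (cases "m = n")
      case True
      then show ?thesis unfolding split J_eq using p(2) by (simp add: v_def s_def)
    next
      case False
      then have "(\<Sum>i\<in>J. (a m i - a m p * a n i / a n p) * u i) = 0" using u(2) that by auto
      also have "(\<Sum>i\<in>J. (a m i - a m p * a n i / a n p) * u i) = (\<Sum>i\<in>J. a m i * u i) - a m p / a n p * s"
        by (simp add: s_def sum_distrib_left sum_subtractf[symmetric] algebra_simps)
      finally show ?thesis unfolding split J_eq by (simp add: v_def)
    qed
    moreover have "\<exists>i\<in>I. v i \<noteq> 0" using u(1) by (auto simp: v_def J_def)
    ultimately show ?thesis by blast
  qed
qed

text \<open>Rows are built from the last one upwards. Row i must satisfy its own i equations and be
  orthogonal to the k - 1 - i later rows: k - 1 conditions on k unknowns, so a nonzero solution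
  exists and can be normalised.\<close>

lemma triangular_orthonormal_rows:
  fixes c :: "nat \<Rightarrow> nat \<Rightarrow> nat \<Rightarrow> complex"
  shows "\<exists>u :: nat \<Rightarrow> nat \<Rightarrow> complex.
    (\<forall>i<k. \<forall>j<k. (\<Sum>l<k. cnj (u i l) * u j l) = of_bool (i = j)) \<and>
    (\<forall>i<k. \<forall>m<i. (\<Sum>l<k. c i m l * u i l) = 0)"
proof -
  define good where "good n u \<longleftrightarrow>
    (\<forall>i\<in>{n..<k}. \<forall>j\<in>{n..<k}. (\<Sum>l<k. cnj (u i l) * u j l) = of_bool (i = j)) \<and>
    (\<forall>i\<in>{n..<k}. \<forall>m<i. (\<Sum>l<k. c i m l * u i l) = 0)" for n and u :: "nat \<Rightarrow> nat \<Rightarrow> complex"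
  have "\<exists>u. good 0 u"
  proof (rule inc_induct[of 0 k])
    show "\<exists>u. good k u" by (simp add: good_def)
  next
    fix n assume n: "n < k" and "\<exists>u. good (Suc n) u"
    then obtain u where u: "good (Suc n) u" by blast
    \<comment> \<open>One numbering for both kinds of condition: m < n is a given equation, m \<ge>
      n is orthogonality to row m + 1.\<close>
    have "\<exists>x. (\<exists>l\<in>{..<k}. x l \<noteq> 0) \<and>
      (\<forall>m<k-1. (\<Sum>l<k. (if m < n then c n m l else cnj (u (Suc m) l)) * x l) = 0)"
      by (rule homogeneous_system_nontrivial) (use n in auto)
    then obtain x l0 where x: "l0 < k" "x l0 \<noteq> 0"
      "\<And>m. m < k - 1 \<Longrightarrow> (\<Sum>l<k. (if m < n then c n m l else cnj (u (Suc m) l)) * x l) = 0"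
      by auto
    define s where "s = (\<Sum>l<k. (cmod (x l))\<^sup>2)"
    have s: "s > 0" unfolding s_def using x(1,2) by (intro sum_pos2[of _ l0]) auto
    define y where "y l = x l / of_real (sqrt s)" for l
    have yy: "(\<Sum>l<k. cnj (y l) * y l) = 1"
    proof -
      have "cnj (y l) * y l = of_real ((cmod (x l))\<^sup>2 / s)" for l
        using s complex_norm_square[of "x l"]
        by (simp add: y_def mult.commute flip: of_real_mult)
      then have "(\<Sum>l<k. cnj (y l) * y l) = of_real (\<Sum>l<k. (cmod (x l))\<^sup>2 / s)"
        by (simp only: of_real_sum)
      also have "(\<Sum>l<k. (cmod (x l))\<^sup>2 / s) = s / s"
        by (simp only: s_def sum_divide_distrib)
      finally show ?thesis using s by simp
    qed
    have cy: "(\<Sum>l<k. c n m l * y l) = 0" if "m < n" for m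
      using x(3)[of m] that n by (simp add: y_def sum_divide_distrib[symmetric])
    have uy: "(\<Sum>l<k. cnj (u j l) * y l) = 0" if "Suc n \<le> j" "j < k" for j
    proof -
      have "j - 1 < k - 1" "\<not> j - 1 < n" "Suc (j - 1) = j" using that by auto
      then show ?thesis using x(3)[of "j - 1"] by (simp add: y_def sum_divide_distrib[symmetric])
    qed
    have yu: "(\<Sum>l<k. cnj (y l) * u j l) = 0" if "Suc n \<le> j" "j < k" for j
    proof -
      have "(\<Sum>l<k. cnj (y l) * u j l) = cnj (\<Sum>l<k. cnj (u j l) * y l)"
        by (simp add: mult.commute)
      then show ?thesis using uy[OF that] by simp
    qed
    have "good n (u(n := y))"
      unfolding good_def
    proof (intro conjI ballI allI impI)
      fix i j assume ij: "i \<in> {n..<k}" "j \<in> {n..<k}"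
      consider "i = n" "j = n" | "i = n" "Suc n \<le> j" | "j = n" "Suc n \<le> i" | "Suc n \<le> i" "Suc n \<le> j"
        using ij by force
      then show "(\<Sum>l<k. cnj ((u(n := y)) i l) * (u(n := y)) j l) = of_bool (i = j)"
        by cases (use ij yy yu uy u in \<open>auto simp: good_def\<close>)
    next
      fix i m assume im: "i \<in> {n..<k}" "m < i"
      show "(\<Sum>l<k. c i m l * (u(n := y)) i l) = 0"
        by (cases "i = n") (use im cy u in \<open>auto simp: good_def\<close>)
    qed
    then show "\<exists>u. good n u" by blast
  qed auto
  then obtain u where "good 0 u" by blast
  then show ?thesis by (intro exI[of _ u]) (simp add: good_def)
qed

text \<open>The Gram matrix p of the columns is a self-adjoint idempotent with trace k. Hence the
  squared Frobenius norm of 1 - p is its trace k - k = 0.\<close>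

lemma orthonormal_columns:
  fixes u :: "nat \<Rightarrow> nat \<Rightarrow> complex"
  assumes u: "\<And>i j. i < k \<Longrightarrow> j < k \<Longrightarrow> (\<Sum>l<k. cnj (u i l) * u j l) = of_bool (i = j)"
    and "l < k" "m < k"
  shows "(\<Sum>i<k. cnj (u i l) * u i m) = of_bool (l = m)"
proof -
  define t where "t l = (\<Sum>i<k. (cmod (u i l))\<^sup>2)" for l
  define p where "p l m = (\<Sum>i<k. cnj (u i l) * u i m)" for l m
  have sq: "(cmod z)\<^sup>2 = Re (cnj z * z)" for z by (simp add: cmod_power2) (simp add: power2_eq_square)
  have pll: "p l l = of_real (t l)" for l
    unfolding p_def t_def using complex_norm_square by (simp add: mult.commute)
  have psum: "(\<Sum>m<k. cnj (p l m) * p l m) = of_real (t l)" for l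
  proof -
    have "(\<Sum>m<k. cnj (p l m) * p l m) =
        (\<Sum>m<k. \<Sum>i<k. \<Sum>j<k. u i l * cnj (u j l) * (cnj (u i m) * u j m))"
      unfolding p_def cnj_sum sum_product by (simp add: mult_ac)
    also have "\<dots> = (\<Sum>i<k. \<Sum>j<k. \<Sum>m<k. u i l * cnj (u j l) * (cnj (u i m) * u j m))"
      by (subst sum.swap, rule sum.cong[OF refl], rule sum.swap)
    also have "\<dots> = (\<Sum>i<k. \<Sum>j<k. u i l * cnj (u j l) * of_bool (i = j))"
      by (intro sum.cong refl) (simp add: sum_distrib_left[symmetric] u)
    also have "\<dots> = p l l" unfolding p_def by (simp add: of_bool_def if_distrib mult.commute cong: if_cong)
    finally show ?thesis by (simp add: pll)
  qed
  have r: "(\<Sum>m<k. (cmod (of_bool (l = m) - p l m))\<^sup>2) = 1 - t l" if "l < k" for l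
  proof -
    have "(cmod (of_bool (l = m) - p l m))\<^sup>2 = of_bool (l = m) * (1 - 2 * Re (p l m)) + Re (cnj (p l m) * p l m)" for m
      by (simp add: sq algebra_simps)
    then have "(\<Sum>m<k. (cmod (of_bool (l = m) - p l m))\<^sup>2) =
        (\<Sum>m<k. of_bool (l = m) * (1 - 2 * Re (p l m))) + Re (\<Sum>m<k. cnj (p l m) * p l m)"
      by (simp only: sum.distrib Re_sum)
    also have "\<dots> = 1 - 2 * Re (p l l) + t l"
      unfolding psum using that by (simp add: of_bool_def if_distrib if_distribR cong: if_cong)
    finally show ?thesis by (simp add: pll)
  qed
  have "(\<Sum>l<k. t l) = (\<Sum>i<k. \<Sum>l<k. (cmod (u i l))\<^sup>2)"
    unfolding t_def by (rule sum.swap)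
  also have "\<dots> = (\<Sum>i<k. 1)"
  proof (rule sum.cong[OF refl])
    fix i assume "i \<in> {..<k}"
    then have "Re (\<Sum>l<k. cnj (u i l) * u i l) = 1" using u[of i i] by simp
    then show "(\<Sum>l<k. (cmod (u i l))\<^sup>2) = 1" by (simp only: sq Re_sum)
  qed
  finally have "(\<Sum>l<k. \<Sum>m<k. (cmod (of_bool (l = m) - p l m))\<^sup>2) = 0"
    using r by (simp add: sum_subtractf)
  then have "(cmod (of_bool (l = m) - p l m))\<^sup>2 = 0"
    using assms(2,3) by (simp add: sum_nonneg_eq_0_iff sum_nonneg)
  then show ?thesis by (simp add: p_def)
qed

text \<open>The synthesis map from C^k is a contraction. In contrast to orthonormality, this is
  preserved by every contraction and leaves room for zero vectors when k exceeds the dimension of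
  the space.\<close>

definition bessel :: "nat \<Rightarrow> (nat \<Rightarrow> 'a::chilbert) \<Rightarrow> bool" where
  "bessel k e \<longleftrightarrow> (\<forall>c. (norm (\<Sum>j<k. c j *\<^sub>C e j))\<^sup>2 \<le> (\<Sum>j<k. (cmod (c j))\<^sup>2))"

lemma bessel_image:
  assumes "bessel k e" "bounded_clinear U" "\<And>x. norm (U x) \<le> norm x"
  shows "bessel k (\<lambda>j. U (e j))"
  unfolding bessel_def
proof
  fix c
  have "(\<Sum>j<k. c j *\<^sub>C U (e j)) = U (\<Sum>j<k. c j *\<^sub>C e j)"
    by (simp add: bounded_clinear_sum[OF assms(2)] bounded_clinear_scaleC[OF assms(2)])
  then have "(norm (\<Sum>j<k. c j *\<^sub>C U (e j)))\<^sup>2 \<le> (norm (\<Sum>j<k. c j *\<^sub>C e j))\<^sup>2"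
    using assms(3) by (simp add: power_mono)
  also have "\<dots> \<le> (\<Sum>j<k. (cmod (c j))\<^sup>2)" using assms(1) by (simp add: bessel_def)
  finally show "(norm (\<Sum>j<k. c j *\<^sub>C U (e j)))\<^sup>2 \<le> (\<Sum>j<k. (cmod (c j))\<^sup>2)" .
qed

lemma bessel_orthogonal:
  assumes "\<And>j. j < k \<Longrightarrow> norm (e j) \<le> 1" "\<And>i j. i < j \<Longrightarrow> j < k \<Longrightarrow> cinner (e i) (e j) = 0"
  shows "bessel k e"
  unfolding bessel_def
proof
  fix c
  show "(norm (\<Sum>j<k. c j *\<^sub>C e j))\<^sup>2 \<le> (\<Sum>j<k. (cmod (c j))\<^sup>2)"
    using assms
  proof (induction k)
    case (Suc k)
    have "cinner (\<Sum>j<k. c j *\<^sub>C e j) (c k *\<^sub>C e k) = 0"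
      using Suc.prems(2) by (simp add: cinner_sum_left cinner_scaleC_left cinner_scaleC_right)
    then have "(norm (\<Sum>j<Suc k. c j *\<^sub>C e j))\<^sup>2 = (norm (\<Sum>j<k. c j *\<^sub>C e j))\<^sup>2 + (norm (c k *\<^sub>C e k))\<^sup>2"
      by (simp add: norm_add_sq)
    also have "(norm (c k *\<^sub>C e k))\<^sup>2 \<le> (cmod (c k))\<^sup>2"
      using Suc.prems(1)[of k] by (intro power_mono) (auto simp: norm_scaleC mult_left_le)
    also have "(norm (\<Sum>j<k. c j *\<^sub>C e j))\<^sup>2 \<le> (\<Sum>j<k. (cmod (c j))\<^sup>2)"
      using Suc by simp
    finally show ?case by simp
  qed auto
qed

section \<open>Approximation numbers and their description by traces\<close>

abbreviation rank_le :: "nat \<Rightarrow> ('a::chilbert \<Rightarrow> 'a) \<Rightarrow> bool" where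
  "rank_le j F \<equiv> \<exists>v::nat \<Rightarrow> 'a. range F \<subseteq> {\<Sum>i<j. c i *\<^sub>C v i | c. True}"

lemma onorm_op_diff_nonneg:
  assumes "bounded_clinear T" "bounded_clinear F"
  shows "0 \<le> onorm (\<lambda>x. T x - F x)"
  by (intro onorm_pos_le bounded_clinear_imp_bounded_linear bounded_clinear_diff_op assms)

lemma sval_set_bdd_below:
  assumes "bounded_clinear T"
  shows "bdd_below {onorm (\<lambda>x. T x - F x) | F. bounded_clinear F \<and> rank_le j F}"
  using onorm_op_diff_nonneg[OF assms] by (intro bdd_belowI[where m = 0]) auto

lemma bounded_clinear_zero_op: "bounded_clinear (\<lambda>x. 0)"
  by (rule bounded_clinearI[where K = 0]) auto

lemma sval_set_nonempty: "{onorm (\<lambda>x. T x - F x) | F. bounded_clinear F \<and> rank_le j F} \<noteq> {}"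
proof -
  have "rank_le j (\<lambda>x. 0 :: 'a)" by (intro exI[of _ "\<lambda>_. 0"]) auto
  then show ?thesis using bounded_clinear_zero_op by blast
qed

lemma sval_le:
  assumes T: "bounded_clinear T" "bounded_clinear F" and r: "rank_le j F"
    and p: "0 \<le> p" "\<And>x. norm (T x - F x) \<le> p * norm x"
  shows "sval j T \<le> p"
proof -
  have "sval j T \<le> onorm (\<lambda>x. T x - F x)"
    unfolding sval_def using T r by (intro cInf_lower sval_set_bdd_below) auto
  also have "\<dots> \<le> p" using p by (rule onorm_bound)
  finally show ?thesis .
qed

lemma sval_nonneg: "bounded_clinear T \<Longrightarrow> 0 \<le> sval j T"
  unfolding sval_def
  by (rule cInf_greatest[OF sval_set_nonempty]) (auto intro: onorm_op_diff_nonneg)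

lemma sval_approx:
  assumes T: "bounded_clinear T" and "\<epsilon> > 0"
  obtains F where "bounded_clinear F" "rank_le j F" "\<And>x. norm (T x - F x) \<le> (sval j T + \<epsilon>) * norm x"
proof -
  obtain F where F: "bounded_clinear F" "rank_le j F" "onorm (\<lambda>x. T x - F x) < sval j T + \<epsilon>"
    using cInf_lessD[OF sval_set_nonempty, of T j "sval j T + \<epsilon>"] \<open>\<epsilon> > 0\<close> unfolding sval_def by auto
  have "norm (T x - F x) \<le> (sval j T + \<epsilon>) * norm x" for x
    using onorm[OF bounded_clinear_imp_bounded_linear[OF bounded_clinear_diff_op[OF T F(1)]], of x]
      mult_right_mono[OF less_imp_le[OF F(3)], of "norm x"] by simp
  with F that show ?thesis by blast
qed

lemma sval_Suc_le:
  assumes T: "bounded_clinear T"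
  shows "sval (Suc j) T \<le> sval j T"
proof (rule field_le_epsilon)
  fix \<epsilon> :: real assume "\<epsilon> > 0"
  obtain F where F: "bounded_clinear F" "rank_le j F" "\<And>x. norm (T x - F x) \<le> (sval j T + \<epsilon>) * norm x"
    using sval_approx[OF T \<open>\<epsilon> > 0\<close>, of j] by blast
  then obtain v where v: "range F \<subseteq> {\<Sum>i<j. c i *\<^sub>C v i | c. True}" by blast
  have "{\<Sum>i<j. c i *\<^sub>C v i | c. True} \<subseteq> {\<Sum>i<Suc j. c i *\<^sub>C (v(j := 0)) i | c. True}"
    by (auto intro!: exI sum.cong)
  with v have "rank_le (Suc j) F" by blast
  then show "sval (Suc j) T \<le> sval j T + \<epsilon>"
    using F(3) sval_nonneg[OF T, of j] \<open>\<epsilon> > 0\<close> by (intro sval_le[OF T F(1)]) auto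
qed

text \<open>Vectors \<open>g i\<close>, obtained from \<open>e\<close> by a unitary change of coordinates, can be chosen successively
  from \<open>i = k - 1\<close> downwards such that \<open>g i\<close> is killed by a near-optimal rank \<open>i\<close> approximation of \<open>T\<close>;
  the trace does not see the change of coordinates.\<close>

lemma sum_cinner_le_sum_sval:
  fixes T :: "'a::chilbert \<Rightarrow> 'a"
  assumes T: "bounded_clinear T" and e: "bessel k e" and f: "bessel k f"
  shows "cmod (\<Sum>j<k. cinner (f j) (T (e j))) \<le> (\<Sum>j<k. sval j T)"
proof (rule field_le_epsilon)
  fix \<epsilon>' :: real assume \<epsilon>': "\<epsilon>' > 0"
  define \<epsilon> where "\<epsilon> = \<epsilon>' / real (Suc k)"
  have \<epsilon>: "\<epsilon> > 0" "real k * \<epsilon> \<le> \<epsilon>'" using \<epsilon>' by (auto simp: \<epsilon>_def field_simps)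
  have "\<exists>F. bounded_clinear F \<and> rank_le i F \<and> (\<forall>x. norm (T x - F x) \<le> (sval i T + \<epsilon>) * norm x)" for i
    by (rule sval_approx[OF T \<epsilon>(1), of i]) blast
  then have "\<forall>i. \<exists>F. bounded_clinear F \<and> rank_le i F \<and> (\<forall>x. norm (T x - F x) \<le> (sval i T + \<epsilon>) * norm x)"
    by blast
  from choice[OF this] obtain F where F: "\<And>i. bounded_clinear (F i)" "\<And>i. rank_le i (F i)"
    "\<And>i x. norm (T x - F i x) \<le> (sval i T + \<epsilon>) * norm x" by blast
  from F(2) have "\<forall>i. rank_le i (F i)" by blast
  from choice[OF this] obtain v where v: "\<And>i. range (F i) \<subseteq> {\<Sum>m<i. c m *\<^sub>C v i m | c. True}" by blast
  have "\<exists>c. F i (e l) = (\<Sum>m<i. c m *\<^sub>C v i m)" for i l using v[of i] by blast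
  then obtain c where c: "\<And>i l. F i (e l) = (\<Sum>m<i. c i l m *\<^sub>C v i m)" by metis
  \<comment> \<open>The i equations imposed on row i say that the coordinates of
    \<open>F i (g i)\<close> along the i vectors spanning the range of \<open>F i\<close>
    vanish.\<close>
  obtain u where u: "\<And>i j. i < k \<Longrightarrow> j < k \<Longrightarrow> (\<Sum>l<k. cnj (u i l) * u j l) = of_bool (i = j)"
    "\<And>i m. i < k \<Longrightarrow> m < i \<Longrightarrow> (\<Sum>l<k. c i l m * u i l) = 0"
    using triangular_orthonormal_rows[of k "\<lambda>i m l. c i l m"] by blast
  define g where "g i = (\<Sum>l<k. u i l *\<^sub>C e l)" for i
  define h where "h i = (\<Sum>l<k. u i l *\<^sub>C f l)" for i
  have row: "(\<Sum>l<k. (cmod (u i l))\<^sup>2) = 1" if "i < k" for i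
  proof -
    have "complex_of_real (\<Sum>l<k. (cmod (u i l))\<^sup>2) = (\<Sum>l<k. cnj (u i l) * u i l)"
      by (simp only: of_real_sum complex_norm_square mult.commute)
    also have "\<dots> = 1" using u(1)[OF that that] by simp
    finally show ?thesis by (simp only: of_real_eq_1_iff)
  qed
  have g1: "norm (g i) \<le> 1" if "i < k" for i
    using e[unfolded bessel_def, rule_format, of "u i"] row[OF that] by (simp add: g_def power_le_one_iff)
  have h1: "norm (h i) \<le> 1" if "i < k" for i
    using f[unfolded bessel_def, rule_format, of "u i"] row[OF that] by (simp add: h_def power_le_one_iff)
  have Fg: "F i (g i) = 0" if "i < k" for i
  proof -
    have "F i (g i) = (\<Sum>l<k. \<Sum>m<i. (c i l m * u i l) *\<^sub>C v i m)"
      by (simp add: g_def bounded_clinear_sum[OF F(1)] bounded_clinear_scaleC[OF F(1)] c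
          scaleC_sum_right scaleC_scaleC mult.commute)
    also have "\<dots> = (\<Sum>m<i. (\<Sum>l<k. c i l m * u i l) *\<^sub>C v i m)"
      by (subst sum.swap) (simp add: scaleC_sum_left)
    also have "\<dots> = 0" using u(2)[OF that] by simp
    finally show ?thesis .
  qed
  have "(\<Sum>i<k. cinner (h i) (T (g i))) =
      (\<Sum>i<k. \<Sum>l<k. \<Sum>m<k. (cnj (u i l) * u i m) * cinner (f l) (T (e m)))"
    unfolding g_def h_def cinner_sum_left
    by (simp add: bounded_clinear_sum[OF T] bounded_clinear_scaleC[OF T] cinner_sum_right cinner_scaleC_left cinner_scaleC_right sum_distrib_left mult_ac)
  also have "\<dots> = (\<Sum>l<k. \<Sum>m<k. \<Sum>i<k. (cnj (u i l) * u i m) * cinner (f l) (T (e m)))"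
    by (subst sum.swap, rule sum.cong[OF refl], rule sum.swap)
  \<comment> \<open>Summing over i pairs columns of u, whereas u was built with orthonormal
    rows.\<close>
  also have "\<dots> = (\<Sum>l<k. \<Sum>m<k. of_bool (l = m) * cinner (f l) (T (e m)))"
    by (intro sum.cong refl) (simp add: sum_distrib_right[symmetric] orthonormal_columns[OF u(1)])
  also have "\<dots> = (\<Sum>l<k. cinner (f l) (T (e l)))"
    by (simp add: of_bool_def if_distrib if_distribR cong: if_cong)
  finally have "cmod (\<Sum>l<k. cinner (f l) (T (e l))) = cmod (\<Sum>i<k. cinner (h i) (T (g i)))" by simp
  also have "\<dots> \<le> (\<Sum>i<k. cmod (cinner (h i) (T (g i))))" by (rule norm_sum)
  also have "\<dots> \<le> (\<Sum>i<k. sval i T + \<epsilon>)"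
  proof (rule sum_mono)
    fix i assume "i \<in> {..<k}"
    then have i: "i < k" by simp
    have "cmod (cinner (h i) (T (g i))) \<le> norm (h i) * norm (T (g i))" by (rule cinner_Cauchy_Schwarz)
    also have "\<dots> \<le> norm (T (g i))" using h1[OF i] by (simp add: mult_left_le_one_le)
    also have "\<dots> \<le> (sval i T + \<epsilon>) * norm (g i)" using F(3)[of "g i" i] Fg[OF i] by simp
    also have "\<dots> \<le> sval i T + \<epsilon>"
      using g1[OF i] sval_nonneg[OF T, of i] \<epsilon>(1) by (intro mult_left_le) auto
    finally show "cmod (cinner (h i) (T (g i))) \<le> sval i T + \<epsilon>" .
  qed
  also have "\<dots> \<le> (\<Sum>i<k. sval i T) + \<epsilon>'" using \<epsilon>(2) by (simp add: sum.distrib)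
  finally show "cmod (\<Sum>j<k. cinner (f j) (T (e j))) \<le> (\<Sum>j<k. sval j T) + \<epsilon>'" .
qed

lemma projection_exists:
  fixes v :: "nat \<Rightarrow> 'a::chilbert"
  shows "\<exists>E. bounded_clinear E \<and> (\<forall>x y. cinner (E x) y = cinner x (E y)) \<and> (\<forall>x. E (E x) = E x) \<and>
    (\<forall>i<n. E (v i) = v i) \<and> range E \<subseteq> {\<Sum>i<n. c i *\<^sub>C v i | c. True}"
proof (induction n)
  case 0
  show ?case by (intro exI[of _ "\<lambda>_. 0"]) (auto simp: bounded_clinear_zero_op)
next
  case (Suc n)
  then obtain E where E: "bounded_clinear E" "\<And>x y. cinner (E x) y = cinner x (E y)" "\<And>x. E (E x) = E x"
    "\<And>i. i < n \<Longrightarrow> E (v i) = v i" "range E \<subseteq> {\<Sum>i<n. c i *\<^sub>C v i | c. True}" by blast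
  define w where "w = v n - E (v n)"
  \<comment> \<open>Gram-Schmidt step. If \<open>v n\<close> is already fixed by E, then w = 0, g =
    0 and D = E; the identity \<open>gg\<close> holds in both cases.\<close>
  define g where "g = (1 / norm w) *\<^sub>R w"
  define D where "D x = E x + cinner g x *\<^sub>C g" for x
  have Ew: "E w = 0" by (simp add: w_def bounded_clinear_diff[OF E(1)] E(3))
  have Eg: "E g = 0" by (simp add: g_def bounded_clinear_scaleR[OF E(1)] Ew)
  have gE: "cinner g (E x) = 0" for x by (simp add: E(2)[symmetric] Eg)
  have gg: "cinner g g *\<^sub>C g = g"
    by (cases "w = 0") (auto simp: g_def cinner_scaleR_left cinner_scaleR_right cinner_self power2_eq_square)
  have "bounded_clinear (\<lambda>x. cinner g x *\<^sub>C g)"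
  proof (rule bounded_clinearI[where K = "norm g * norm g"])
    show "norm (cinner g x *\<^sub>C g) \<le> norm g * norm g * norm x" for x
      using mult_right_mono[OF cinner_Cauchy_Schwarz[of g x], of "norm g"]
      by (simp add: norm_scaleC mult_ac)
  qed (simp_all add: cinner_add_right cinner_scaleC_right scaleC_add_left scaleC_scaleC)
  then have bD: "bounded_clinear D" unfolding D_def by (rule bounded_clinear_add_op[OF E(1)])
  have symD: "cinner (D x) y = cinner x (D y)" for x y
    using cinner_commute[of x g]
    by (simp add: D_def cinner_add_left cinner_add_right cinner_scaleC_left cinner_scaleC_right E(2))
  have DD: "D (D x) = D x" for x
    by (simp add: D_def bounded_clinear_add[OF E(1)] bounded_clinear_scaleC[OF E(1)] E(3) Eg
        cinner_add_right cinner_scaleC_right gE scaleC_scaleC[symmetric] gg)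
  have "cinner g (v n) *\<^sub>C g = w"
  proof -
    have "cinner g (v n) = cinner g w" by (simp add: w_def cinner_diff_right gE)
    also have "\<dots> = norm w" by (simp add: g_def cinner_scaleR_left cinner_self power2_eq_square)
    finally show ?thesis by (cases "w = 0") (auto simp: g_def scaleR_eq_scaleC[symmetric])
  qed
  then have Dn: "D (v n) = v n" by (simp add: D_def w_def)
  have "D (v i) = v i" if "i < n" for i
    using gE[of "v i"] E(4)[OF that] by (simp add: D_def)
  with Dn have Dv: "D (v i) = v i" if "i < Suc n" for i using that by (auto simp: less_Suc_eq)
  have "D x \<in> {\<Sum>i<Suc n. c i *\<^sub>C v i | c. True}" for x
  proof -
    obtain a where a: "E x = (\<Sum>i<n. a i *\<^sub>C v i)" using E(5) by blast
    obtain b where b: "E (v n) = (\<Sum>i<n. b i *\<^sub>C v i)" using E(5) by blast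
    define s where "s = cinner g x / norm w"
    have "D x = E x + s *\<^sub>C (v n - E (v n))"
      by (simp add: D_def g_def scaleR_eq_scaleC scaleC_scaleC s_def w_def)
    also have "\<dots> = (\<Sum>i<Suc n. (if i = n then s else a i - s * b i) *\<^sub>C v i)"
      by (simp add: a b scaleC_diff_right scaleC_diff_left scaleC_sum_right scaleC_scaleC sum_subtractf)
    finally show ?thesis
      by (intro CollectI exI[of _ "\<lambda>i. if i = n then s else a i - s * b i"] conjI TrueI)
  qed
  then show ?case using bD symD DD Dv by (intro exI[of _ D]) blast
qed

lemma norm_projection_le:
  assumes "\<And>x y. cinner (E x) y = cinner x (E y)" "\<And>x. E (E x) = E x"
  shows "norm (E x) \<le> norm x"
proof -
  have "(norm (E x))\<^sup>2 = Re (cinner x (E x))"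
    using arg_cong[OF assms(1)[of x "E x"], of Re] by (simp add: assms(2) cinner_self)
  also have "\<dots> \<le> norm x * norm (E x)"
    using complex_Re_le_cmod cinner_Cauchy_Schwarz order_trans by blast
  finally show ?thesis by (cases "E x = 0") (auto simp: power2_eq_square)
qed

text \<open>The approximation is \<open>U Q E' Q\<close>, where \<open>T = U |T|\<close>, \<open>Q = |T|\<^sup>1\<^sup>/\<^sup>2\<close> and \<open>E'\<close> projects onto the span
  of the vectors \<open>Q (e i)\<close>.\<close>

lemma sval_le_compression:
  fixes T :: "'a::chilbert \<Rightarrow> 'a"
  assumes T: "bounded_clinear T" and p0: "0 \<le> p"
    and p: "\<And>x. norm x \<le> 1 \<Longrightarrow> (\<And>i. i < n \<Longrightarrow> cinner (e i) x = 0) \<Longrightarrow> Re (cinner x (abs_op T x)) \<le> p"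
  shows "sval n T \<le> p"
proof -
  note P = positive_abs_op[OF T]
  obtain U W where U: "bounded_clinear U" "\<And>x. norm (U x) \<le> norm x" "\<And>x. U (abs_op T x) = T x"
    using polar_decomposition[OF T] by metis
  obtain Q where Q: "positive_op Q" "\<And>x. Q (Q x) = abs_op T x"
    using op_sqrt_props[OF P] by blast
  note BQ = positive_op_bounded[OF Q(1)] and symQ = positive_op_symmetric[OF Q(1)]
  obtain E where E: "bounded_clinear E" "\<And>x y. cinner (E x) y = cinner x (E y)" "\<And>x. E (E x) = E x"
    "\<And>i. i < n \<Longrightarrow> E (e i) = e i" "range E \<subseteq> {\<Sum>i<n. c i *\<^sub>C e i | c. True}"
    using projection_exists[of n e] by blast
  obtain D where D: "bounded_clinear D" "\<And>x y. cinner (D x) y = cinner x (D y)" "\<And>x. D (D x) = D x"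
    "\<And>i. i < n \<Longrightarrow> D (Q (e i)) = Q (e i)" "range D \<subseteq> {\<Sum>i<n. c i *\<^sub>C Q (e i) | c. True}"
    using projection_exists[of n "\<lambda>i. Q (e i)"] by blast
  have DQE: "D (Q (E x)) = Q (E x)" for x
  proof -
    obtain c where "E x = (\<Sum>i<n. c i *\<^sub>C e i)" using E(5) by blast
    then show ?thesis
      by (simp add: bounded_clinear_sum[OF BQ] bounded_clinear_sum[OF D(1)]
          bounded_clinear_scaleC[OF BQ] bounded_clinear_scaleC[OF D(1)] D(4))
  qed
  have quad: "Re (cinner z (abs_op T z)) \<le> p * (norm z)\<^sup>2" if "\<And>i. i < n \<Longrightarrow> cinner (e i) z = 0" for z
  proof (cases "z = 0")
    case False
    have "Re (cinner ((1 / norm z) *\<^sub>R z) (abs_op T ((1 / norm z) *\<^sub>R z))) \<le> p"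
      by (rule p) (use that False in \<open>auto simp: cinner_scaleR_right\<close>)
    then show ?thesis using False
      by (simp add: bounded_clinear_scaleR[OF positive_op_bounded[OF P]] cinner_scaleR_left
          cinner_scaleR_right field_simps power2_eq_square)
  qed simp
  \<comment> \<open>C = (1 - D) Q equals (1 - D) Q (1 - E), since D fixes the range of Q E; so the
    form bound on the complement of the \<open>e i\<close> gives norm at most sqrt p. The error of
    the approximation is U Q C, and Q C is the adjoint of C composed with C, of norm at most
    p.\<close>
  define C where "C x = Q x - D (Q x)" for x
  have normC: "(norm (C x))\<^sup>2 \<le> p * (norm x)\<^sup>2" for x
  proof -
    define y where "y = x - E x"
    have "C x = Q y - D (Q y)"
      by (simp add: C_def y_def bounded_clinear_diff[OF BQ] bounded_clinear_diff[OF D(1)] DQE)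
    moreover have "norm (Q y - D (Q y)) \<le> norm (Q y)"
      by (rule norm_projection_le[where E = "\<lambda>y. y - D y"])
         (simp_all add: cinner_diff_left cinner_diff_right D(2,3) bounded_clinear_diff[OF D(1)])
    ultimately have "(norm (C x))\<^sup>2 \<le> (norm (Q y))\<^sup>2" by (simp add: power_mono)
    also have "\<dots> = Re (cinner y (abs_op T y))"
      using arg_cong[OF symQ[of y "Q y"], of Re] by (simp add: Q(2) cinner_self)
    also have "\<dots> \<le> p * (norm y)\<^sup>2"
      by (rule quad) (use E(2,4) in \<open>simp add: y_def cinner_diff_right flip: E(2)\<close>)
    also have "\<dots> \<le> p * (norm x)\<^sup>2" unfolding y_def
      by (intro mult_left_mono power_mono norm_projection_le[where E = "\<lambda>x. x - E x"] p0)
         (simp_all add: cinner_diff_left cinner_diff_right E(2,3) bounded_clinear_diff[OF E(1)])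
    finally show ?thesis .
  qed
  have QC: "norm (Q (C x)) \<le> p * norm x" for x
  proof -
    define y where "y = Q (C x)"
    have "cinner y y = cinner (C x) (Q y)" by (simp add: y_def symQ)
    also have "\<dots> = cinner (C x) (C y)"
      by (simp add: C_def cinner_diff_right cinner_diff_left D(2,3))
    finally have "(norm y)\<^sup>2 = Re (cinner (C x) (C y))" by (simp add: cinner_self complex_eq_iff)
    also have "\<dots> \<le> norm (C x) * norm (C y)"
      using complex_Re_le_cmod cinner_Cauchy_Schwarz order_trans by blast
    also have "\<dots> \<le> (sqrt p * norm x) * (sqrt p * norm y)"
      by (intro mult_mono real_le_rsqrt[of _ "p * (norm _)\<^sup>2", simplified real_sqrt_mult real_sqrt_abs abs_norm_cancel] normC)
         (auto simp: p0)
    also have "\<dots> = (p * norm x) * norm y" using p0 by (simp add: mult_ac)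
    finally have "norm y * norm y \<le> (p * norm x) * norm y" by (simp add: power2_eq_square)
    then show ?thesis unfolding y_def[symmetric] using p0 by (cases "y = 0") auto
  qed
  define F where "F x = U (Q (D (Q x)))" for x
  have "bounded_clinear F" unfolding F_def
    by (rule bounded_clinear_compose[OF U(1) bounded_clinear_compose[OF BQ bounded_clinear_compose[OF D(1) BQ]]])
  moreover have "F x \<in> {\<Sum>i<n. c i *\<^sub>C U (Q (Q (e i))) | c. True}" for x
  proof -
    obtain c where "D (Q x) = (\<Sum>i<n. c i *\<^sub>C Q (e i))" using D(5) by blast
    then have "F x = (\<Sum>i<n. c i *\<^sub>C U (Q (Q (e i))))"
      by (simp add: F_def bounded_clinear_sum[OF BQ] bounded_clinear_sum[OF U(1)]
          bounded_clinear_scaleC[OF BQ] bounded_clinear_scaleC[OF U(1)])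
    then show ?thesis by blast
  qed
  moreover have "norm (T x - F x) \<le> p * norm x" for x
  proof -
    have "T x - F x = U (Q (C x))"
      by (simp add: F_def C_def U(3)[symmetric] Q(2)[symmetric] bounded_clinear_diff[OF BQ]
          bounded_clinear_diff[OF U(1)])
    then show ?thesis using U(2)[of "Q (C x)"] QC[of x] by simp
  qed
  ultimately show ?thesis
    by (intro sval_le[OF T _ exI[of _ "\<lambda>i. U (Q (Q (e i)))"] p0]) blast+
qed

text \<open>Converse to \<open>sum_cinner_le_sum_sval\<close>. Vectors are chosen greedily: by
  \<open>sval_le_compression\<close> some vector of the unit ball orthogonal to the first n has
  |T|-form at least s_n - \<epsilon>. Pairing T e_j with U e_j turns these forms into an admissible
  trace.\<close>

lemma sum_sval_le:
  fixes T :: "'a::chilbert \<Rightarrow> 'a"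
  assumes T: "bounded_clinear T"
    and C: "\<And>e f. bessel k e \<Longrightarrow> bessel k f \<Longrightarrow> cmod (\<Sum>j<k. cinner (f j) (T (e j))) \<le> C"
  shows "(\<Sum>j<k. sval j T) \<le> C"
proof (rule field_le_epsilon)
  fix \<epsilon>' :: real assume \<epsilon>': "\<epsilon>' > 0"
  define \<epsilon> where "\<epsilon> = \<epsilon>' / real (Suc k)"
  have \<epsilon>: "\<epsilon> > 0" "real k * \<epsilon> \<le> \<epsilon>'" using \<epsilon>' by (auto simp: \<epsilon>_def field_simps)
  have "\<exists>e. (\<forall>j<n. norm (e j) \<le> 1 \<and> sval j T - \<epsilon> \<le> Re (cinner (e j) (abs_op T (e j)))) \<and>
     (\<forall>j<n. \<forall>i<j. cinner (e i) (e j) = 0)" for n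
  proof (induction n)
    case (Suc n)
    then obtain e where e: "\<And>j. j < n \<Longrightarrow> norm (e j) \<le> 1"
      "\<And>j. j < n \<Longrightarrow> sval j T - \<epsilon> \<le> Re (cinner (e j) (abs_op T (e j)))"
      "\<And>i j. j < n \<Longrightarrow> i < j \<Longrightarrow> cinner (e i) (e j) = 0" by blast
    have "\<exists>x. norm x \<le> 1 \<and> (\<forall>i<n. cinner (e i) x = 0) \<and> sval n T - \<epsilon> \<le> Re (cinner x (abs_op T x))"
    proof (rule ccontr)
      assume "\<not> ?thesis"
      then have *: "\<And>x. norm x \<le> 1 \<Longrightarrow> (\<And>i. i < n \<Longrightarrow> cinner (e i) x = 0) \<Longrightarrow>
          Re (cinner x (abs_op T x)) < sval n T - \<epsilon>" by (meson not_le)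
      \<comment> \<open>The zero vector is a competitor, so the negated claim itself supplies the
        sign condition of \<open>sval_le_compression\<close>.\<close>
      have "0 \<le> sval n T - \<epsilon>" using *[of 0] by simp
      then have "sval n T \<le> sval n T - \<epsilon>"
        by (rule sval_le_compression[OF T, where e = e]) (use * less_imp_le in blast)
      with \<epsilon>(1) show False by simp
    qed
    then obtain x where x: "norm x \<le> 1" "\<And>i. i < n \<Longrightarrow> cinner (e i) x = 0"
      "sval n T - \<epsilon> \<le> Re (cinner x (abs_op T x))" by blast
    show ?case
      by (intro exI[of _ "e(n := x)"]) (use e x in \<open>auto simp: less_Suc_eq\<close>)
  qed auto
  then obtain e where e: "\<And>j. j < k \<Longrightarrow> norm (e j) \<le> 1"
    "\<And>j. j < k \<Longrightarrow> sval j T - \<epsilon> \<le> Re (cinner (e j) (abs_op T (e j)))"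
    "\<And>i j. i < j \<Longrightarrow> j < k \<Longrightarrow> cinner (e i) (e j) = 0" by metis
  obtain U W where U: "bounded_clinear U" "\<And>x. norm (U x) \<le> norm x"
     and WU: "\<And>x y. cinner (W x) y = cinner x (U y)" and W: "\<And>x. W (T x) = abs_op T x"
    using polar_decomposition[OF T] by metis
  have b: "bessel k e" by (rule bessel_orthogonal) (use e in auto)
  have "cinner (U (e j)) (T (e j)) = cinner (e j) (abs_op T (e j))" for j
    by (metis WU W cinner_commute)
  then have C': "cmod (\<Sum>j<k. cinner (e j) (abs_op T (e j))) \<le> C"
    using C[OF b bessel_image[OF b U]] by simp
  have "(\<Sum>j<k. sval j T) - real k * \<epsilon> \<le> (\<Sum>j<k. Re (cinner (e j) (abs_op T (e j))))"
    using sum_mono[of "{..<k}" "\<lambda>j. sval j T - \<epsilon>"] e(2) by (simp add: sum_subtractf)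
  also have "\<dots> \<le> C" using C' complex_Re_le_cmod order_trans by (metis Re_sum)
  finally show "(\<Sum>j<k. sval j T) \<le> C + \<epsilon>'" using \<epsilon>(2) by simp
qed

text \<open>With Q the square root of |T| the left side is the inner product of Q (W f) and Q e;
  Cauchy-Schwarz is followed by the arithmetic-geometric inequality with a free weight t.\<close>

lemma cmod_cinner_abs_op_le:
  fixes T :: "'a::chilbert \<Rightarrow> 'a"
  assumes T: "bounded_clinear T"
    and W: "\<And>f x. cinner f (T x) = cinner (W f) (abs_op T x)" and "t > 0"
  shows "cmod (cinner f (T e)) \<le>
    (t * Re (cinner e (abs_op T e)) + Re (cinner (W f) (abs_op T (W f))) / t) / 2"
proof -
  obtain Q where Q: "positive_op Q" "\<And>x. Q (Q x) = abs_op T x"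
    using op_sqrt_props[OF positive_abs_op[OF T]] by blast
  have q: "Re (cinner z (abs_op T z)) = (norm (Q z))\<^sup>2" for z
    using arg_cong[OF positive_op_symmetric[OF Q(1), of z "Q z"], of Re] by (simp add: Q(2) cinner_self)
  have "cinner f (T e) = cinner (Q (W f)) (Q e)"
    by (simp add: W positive_op_symmetric[OF Q(1)] Q(2))
  then have "cmod (cinner f (T e)) \<le> norm (Q (W f)) * norm (Q e)"
    by (simp add: cinner_Cauchy_Schwarz)
  also have "\<dots> \<le> (t * (norm (Q e))\<^sup>2 + (norm (Q (W f)))\<^sup>2 / t) / 2"
  proof -
    have "0 \<le> (t * norm (Q e) - norm (Q (W f)))\<^sup>2 / t" using \<open>t > 0\<close> by simp
    then show ?thesis using \<open>t > 0\<close> by (simp add: power2_diff field_simps power2_eq_square)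
  qed
  finally show ?thesis by (simp add: q)
qed

text \<open>The factor \<open>sqrt 2\<close> is the minimum over \<open>t > 0\<close> of \<open>(t + 2 / t) / 2\<close>: with respect to \<open>e\<close> the
  forms of \<open>|S|\<close> and \<open>|T|\<close> add up, whereas with respect to \<open>f\<close> each of them is estimated separately.\<close>

lemma sum_cinner_add_le:
  fixes S T :: "'a::chilbert \<Rightarrow> 'a"
  assumes S: "bounded_clinear S" and T: "bounded_clinear T"
    and e: "bessel k e" and f: "bessel k f" and a: "cmod a \<le> m" "cmod b \<le> m"
  shows "cmod (\<Sum>j<k. cinner (f j) (a *\<^sub>C S (e j) + b *\<^sub>C T (e j)))
    \<le> m * sqrt 2 * (\<Sum>j<k. sval j (\<lambda>x. abs_op S x + abs_op T x))"
proof -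
  define N where "N = (\<lambda>x. abs_op S x + abs_op T x)"
  note PS = positive_abs_op[OF S] and PT = positive_abs_op[OF T]
  have BN: "bounded_clinear N" unfolding N_def
    by (rule bounded_clinear_add_op[OF positive_op_bounded[OF PS] positive_op_bounded[OF PT]])
  obtain V where V: "bounded_clinear V" "\<And>x. norm (V x) \<le> norm x"
      "\<And>f x. cinner f (S x) = cinner (V f) (abs_op S x)"
    by (rule majorized_factor[OF positive_op_bounded[OF PS] S]) (auto simp: norm_abs_op[OF S])
  obtain W where W: "bounded_clinear W" "\<And>x. norm (W x) \<le> norm x"
      "\<And>f x. cinner f (T x) = cinner (W f) (abs_op T x)"
    by (rule majorized_factor[OF positive_op_bounded[OF PT] T]) (auto simp: norm_abs_op[OF T])
  define s where "s = (\<Sum>j<k. sval j N)"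
  define q where "q x = Re (cinner x (N x))" for x
  have q: "q x = Re (cinner x (abs_op S x)) + Re (cinner x (abs_op T x))" for x
    by (simp add: q_def N_def cinner_add_right)
  have qs: "(\<Sum>j<k. q (g j)) \<le> s" if "bessel k g" for g
  proof -
    have "(\<Sum>j<k. q (g j)) = Re (\<Sum>j<k. cinner (g j) (N (g j)))" by (simp add: q_def)
    also have "\<dots> \<le> cmod (\<Sum>j<k. cinner (g j) (N (g j)))" by (rule complex_Re_le_cmod)
    also have "\<dots> \<le> s" unfolding s_def by (rule sum_cinner_le_sum_sval[OF BN that that])
    finally show ?thesis .
  qed
  have m: "0 \<le> m" using a(1) norm_ge_zero order_trans by blast
  let ?t = "sqrt 2"
  have "cmod (cinner (f j) (a *\<^sub>C S (e j) + b *\<^sub>C T (e j))) \<le>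
      m * ((?t * q (e j) + (q (V (f j)) + q (W (f j))) / ?t) / 2)" for j
  proof -
    have "cmod (cinner (f j) (a *\<^sub>C S (e j) + b *\<^sub>C T (e j))) \<le>
        cmod a * cmod (cinner (f j) (S (e j))) + cmod b * cmod (cinner (f j) (T (e j)))"
      by (simp add: cinner_add_right cinner_scaleC_right norm_mult[symmetric] norm_triangle_ineq)
    also have "\<dots> \<le> m * cmod (cinner (f j) (S (e j))) + m * cmod (cinner (f j) (T (e j)))"
      by (intro add_mono mult_right_mono a) auto
    also have "\<dots> = m * (cmod (cinner (f j) (S (e j))) + cmod (cinner (f j) (T (e j))))"
      by (simp add: algebra_simps)
    also have "\<dots> \<le> m * ((?t * q (e j) + (q (V (f j)) + q (W (f j))) / ?t) / 2)"
    proof (rule mult_left_mono[OF _ m])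
      have "cmod (cinner (f j) (S (e j))) \<le>
          (?t * Re (cinner (e j) (abs_op S (e j))) + Re (cinner (V (f j)) (abs_op S (V (f j)))) / ?t) / 2"
        by (rule cmod_cinner_abs_op_le[OF S V(3)]) simp
      moreover have "cmod (cinner (f j) (T (e j))) \<le>
          (?t * Re (cinner (e j) (abs_op T (e j))) + Re (cinner (W (f j)) (abs_op T (W (f j)))) / ?t) / 2"
        by (rule cmod_cinner_abs_op_le[OF T W(3)]) simp
      moreover have "Re (cinner (V (f j)) (abs_op S (V (f j)))) / ?t \<le> q (V (f j)) / ?t"
        using positive_op_Re[OF PT, of "V (f j)"] by (simp add: q divide_right_mono)
      moreover have "Re (cinner (W (f j)) (abs_op T (W (f j)))) / ?t \<le> q (W (f j)) / ?t"
        using positive_op_Re[OF PS, of "W (f j)"] by (simp add: q divide_right_mono)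
      moreover have "x + y \<le> (z + w) / 2"
        if "x \<le> (x1 + x2) / 2" "y \<le> (y1 + y2) / 2" "x2 \<le> w1" "y2 \<le> w2" "z = x1 + y1" "w = w1 + w2"
        for x y z w x1 x2 y1 y2 w1 w2 :: real using that by (simp add: field_simps)
      ultimately show "cmod (cinner (f j) (S (e j))) + cmod (cinner (f j) (T (e j)))
          \<le> (?t * q (e j) + (q (V (f j)) + q (W (f j))) / ?t) / 2"
        by (simp only: q[of "e j"] add_divide_distrib[of _ _ ?t] distrib_left)
    qed
    finally show ?thesis .
  qed
  then have "cmod (\<Sum>j<k. cinner (f j) (a *\<^sub>C S (e j) + b *\<^sub>C T (e j)))
      \<le> (\<Sum>j<k. m * ((?t * q (e j) + (q (V (f j)) + q (W (f j))) / ?t) / 2))"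
    by (intro sum_norm_le)
  also have "\<dots> = m * ((?t * (\<Sum>j<k. q (e j)) + ((\<Sum>j<k. q (V (f j))) + (\<Sum>j<k. q (W (f j)))) / ?t) / 2)"
    by (simp add: sum_distrib_left sum.distrib sum_divide_distrib add_divide_distrib distrib_left)
  also have "\<dots> \<le> m * ((?t * s + (s + s) / ?t) / 2)"
    by (intro mult_left_mono divide_right_mono add_mono qs e bessel_image[OF f V(1,2)]
        bessel_image[OF f W(1,2)] m) auto
  also have "(?t * s + (s + s) / ?t) / 2 = ?t * s"
    by (simp add: field_simps)
  finally show ?thesis by (simp add: s_def N_def mult.assoc)
qed

section \<open>Weak majorization\<close>

lemma symm_norming_scale: "symm_norming \<Phi> \<Longrightarrow> fin_supp x \<Longrightarrow> \<Phi> (\<lambda>i. a * x i) = \<bar>a\<bar> * \<Phi> x"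
  and symm_norming_triangle:
    "symm_norming \<Phi> \<Longrightarrow> fin_supp x \<Longrightarrow> fin_supp y \<Longrightarrow> \<Phi> (\<lambda>i. x i + y i) \<le> \<Phi> x + \<Phi> y"
  and symm_norming_permute:
    "symm_norming \<Phi> \<Longrightarrow> fin_supp x \<Longrightarrow> bij \<pi> \<Longrightarrow> \<Phi> (\<lambda>i. \<bar>x (\<pi> i)\<bar>) = \<Phi> x"
  by (simp_all add: symm_norming_def)

lemma symm_norming_convex:
  assumes \<Phi>: "symm_norming \<Phi>" and "fin_supp x" "fin_supp y" "0 \<le> t" "t \<le> 1"
    and "\<Phi> x \<le> C" "\<Phi> y \<le> C"
  shows "\<Phi> (\<lambda>i. (1 - t) * x i + t * y i) \<le> C"
proof -
  note scale = symm_norming_scale[OF \<Phi>] and tri = symm_norming_triangle[OF \<Phi>]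
  have fs: "fin_supp (\<lambda>i. a * z i)" if "fin_supp z" for a z
    using that unfolding fin_supp_def by (rule rev_finite_subset) auto
  have "\<Phi> (\<lambda>i. (1 - t) * x i + t * y i) \<le> (1 - t) * \<Phi> x + t * \<Phi> y"
    using tri[OF fs[OF assms(2), of "1 - t"] fs[OF assms(3), of t]] scale[OF assms(2), of "1 - t"]
      scale[OF assms(3), of t] assms(4,5) by simp
  also have "\<dots> \<le> (1 - t) * C + t * C" using assms by (intro add_mono mult_left_mono) auto
  finally show ?thesis by (simp add: algebra_simps)
qed

text \<open>Taking the identity permutation in the symmetry axiom shows that sign changes preserve
  \<Phi>. The updated sequence lies on the segment between y and its sign change at j, so convexity
  applies.\<close>

lemma symm_norming_update_le:
  assumes \<Phi>: "symm_norming \<Phi>" and y: "fin_supp y" "\<And>i. 0 \<le> y i" and a: "0 \<le> a" "a \<le> y j"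
  shows "\<Phi> (y(j := a)) \<le> \<Phi> y"
proof (cases "y j = 0")
  case False
  then have j: "y j > 0" using y(2)[of j] by simp
  define z where "z = y(j := - y j)"
  have z: "fin_supp z" using y(1) unfolding fin_supp_def z_def
    by (rule rev_finite_subset) auto
  have sym: "\<And>w. fin_supp w \<Longrightarrow> \<Phi> (\<lambda>i. \<bar>w i\<bar>) = \<Phi> w"
    using symm_norming_permute[OF \<Phi> _ bij_id] by simp
  have "(\<lambda>i. \<bar>z i\<bar>) = (\<lambda>i. \<bar>y i\<bar>)" by (auto simp: z_def)
  then have zy: "\<Phi> z = \<Phi> y" using sym[OF z] sym[OF y(1)] by simp
  \<comment> \<open>Solves (1 - t) y_j - t y_j = a.\<close>
  define t where "t = (1 - a / y j) / 2"
  have t: "0 \<le> t" "t \<le> 1" using a j by (auto simp: t_def field_simps)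
  have "y(j := a) = (\<lambda>i. (1 - t) * y i + t * z i)"
    using j by (auto simp: z_def t_def field_simps)
  then show ?thesis using symm_norming_convex[OF \<Phi> y(1) z t order_refl[of "\<Phi> y"]] zy by simp
next
  case True
  then have "y(j := a) = y" using a by auto
  then show ?thesis by simp
qed

lemma symm_norming_mono:
  assumes \<Phi>: "symm_norming \<Phi>" and y: "fin_supp y" and xy: "\<And>i. 0 \<le> x i" "\<And>i. x i \<le> y i"
  shows "\<Phi> x \<le> \<Phi> y"
proof -
  have "\<Phi> (\<lambda>i. if i < n then x i else y i) \<le> \<Phi> y" for n
  proof (induction n)
    case (Suc n)
    define w where "w = (\<lambda>i. if i < n then x i else y i)"
    have eq: "(\<lambda>i. if i < Suc n then x i else y i) = w(n := x n)" by (auto simp: w_def fun_eq_iff)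
    have "\<Phi> (\<lambda>i. if i < Suc n then x i else y i) \<le> \<Phi> w" unfolding eq
    proof (rule symm_norming_update_le[OF \<Phi>])
      show "fin_supp w" using y unfolding fin_supp_def
        by (rule rev_finite_subset) (use xy in \<open>auto simp: w_def\<close>, metis order_antisym)
      show "0 \<le> w i" for i using xy order_trans[OF xy] by (auto simp: w_def)
    qed (use xy in \<open>auto simp: w_def\<close>)
    then show ?case using Suc unfolding w_def by (rule order_trans)
  qed auto
  moreover obtain n where "\<And>i. n \<le> i \<Longrightarrow> y i = 0"
  proof -
    have "finite {i. y i \<noteq> 0}" using y by (simp add: fin_supp_def)
    then obtain n where "{i. y i \<noteq> 0} \<subseteq> {..<n}" using finite_nat_iff_bounded by blast
    then show ?thesis using that[of n] by fastforce
  qed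
  then have "(\<lambda>i. if i < n then x i else y i) = x"
    using xy by (auto simp: fun_eq_iff not_less intro: order_antisym) (metis order_antisym)
  ultimately show ?thesis by metis
qed

text \<open>Each step averages \<open>y\<close> with a transposition of it, moving mass from an index \<open>i\<close> where \<open>x\<close> is
  smaller to the first later index \<open>j\<close> where \<open>x\<close> is larger, until one more coordinate agrees.\<close>

lemma symm_norming_weak_majorization:
  fixes x y :: "nat \<Rightarrow> real"
  assumes \<Phi>: "symm_norming \<Phi>" and y: "fin_supp y" and x: "fin_supp x"
    and x0: "\<And>i. 0 \<le> x i" and y0: "\<And>i. 0 \<le> y i" and dec: "\<And>i j. i \<le> j \<Longrightarrow> x j \<le> x i"
    and maj: "\<And>k. sum x {..<k} \<le> sum y {..<k}"
  shows "\<Phi> x \<le> \<Phi> y"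
  using y y0 maj
proof (induction "card {l. x l \<noteq> y l}" arbitrary: y rule: less_induct)
  case less
  show ?case
  proof (cases "\<forall>i. x i \<le> y i")
    case True
    show ?thesis by (rule symm_norming_mono[OF \<Phi> less.prems(1) x0]) (use True in simp)
  next
    case False
    define j where "j = (LEAST j. y j < x j)"
    have j: "y j < x j" unfolding j_def using False by (intro LeastI_ex[of "\<lambda>j. y j < x j"]) (auto simp: not_le)
    have before_j: "x l \<le> y l" if "l < j" for l
      using not_less_Least[of l "\<lambda>j. y j < x j"] that by (auto simp: j_def)
    have "\<exists>i<j. x i < y i"
    proof (rule ccontr)
      assume "\<not> ?thesis"
      then have "sum y {..<j} \<le> sum x {..<j}" by (intro sum_mono) force
      then have "sum y {..<Suc j} < sum x {..<Suc j}" using j by simp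
      with less.prems(3)[of "Suc j"] show False by simp
    qed
    then obtain i0 where i0: "i0 < j" "x i0 < y i0" by blast
    \<comment> \<open>The last surplus index before j is taken, so that x and y agree strictly
      between i and j.\<close>
    define i where "i = (GREATEST i. i < j \<and> x i < y i)"
    have i: "i < j \<and> x i < y i" unfolding i_def
      by (rule GreatestI_nat[of "\<lambda>i. i < j \<and> x i < y i" i0 j]) (use i0 in auto)
    have between: "x l = y l" if "i < l" "l < j" for l
    proof (rule ccontr)
      assume "x l \<noteq> y l"
      then have "l < j \<and> x l < y l" using before_j[OF that(2)] that by auto
      then have "l \<le> i" unfolding i_def by (rule Greatest_le_nat[of "\<lambda>i. i < j \<and> x i < y i" _ j]) auto
      with that show False by simp
    qed
    have ij: "x j \<le> x i" using dec i by simp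
    define \<delta> where "\<delta> = min (y i - x i) (x j - y j)"
    have \<delta>: "\<delta> > 0" "\<delta> \<le> y i - x i" "\<delta> \<le> x j - y j" "\<delta> = y i - x i \<or> \<delta> = x j - y j"
      using i j by (auto simp: \<delta>_def)
    \<comment> \<open>Monotonicity of x enters here: y j < x j \<le> x i < y i, so moving \<delta>
      from i to j does not overshoot and stays on the segment from y to its transposition.\<close>
    have gap: "\<delta> \<le> y i - y j" "y j < y i" using \<delta> ij i j by linarith+
    define z where "z = y(i := y i - \<delta>, j := y j + \<delta>)"
    have zi: "z i = y i - \<delta>" and zj: "z j = y j + \<delta>" and zl: "\<And>l. l \<noteq> i \<Longrightarrow> l \<noteq> j \<Longrightarrow> z l = y l"
      using i by (auto simp: z_def)
    have fz: "fin_supp z"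
    proof -
      have "{l. z l \<noteq> 0} \<subseteq> insert i (insert j {l. y l \<noteq> 0})" using zl by force
      then show ?thesis using less.prems(1) unfolding fin_supp_def by (meson finite.insertI finite_subset)
    qed
    have z0: "0 \<le> z l" for l
      using less.prems(2)[of l] \<delta> x0[of i] zi zj zl[of l]
      by (cases "l = i"; cases "l = j") auto
    have "\<Phi> x \<le> \<Phi> z"
    proof (rule less.hyps)
      have "{l. x l \<noteq> z l} \<subseteq> {l. x l \<noteq> y l}"
        using zl i j by (metis (mono_tags, lifting) Collect_mono less_irrefl)
      moreover have "\<exists>l. x l \<noteq> y l \<and> x l = z l"
      proof (cases "\<delta> = y i - x i")
        case True then show ?thesis using i zi by (intro exI[of _ i]) auto
      next
        case False then show ?thesis using \<delta>(4) j zj by (intro exI[of _ j]) auto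
      qed
      ultimately have "{l. x l \<noteq> z l} \<subset> {l. x l \<noteq> y l}" by blast
      moreover have "finite {l. x l \<noteq> y l}"
      proof -
        have "{l. x l \<noteq> y l} \<subseteq> {l. x l \<noteq> 0} \<union> {l. y l \<noteq> 0}" by auto
        then show ?thesis using x less.prems(1) unfolding fin_supp_def by (meson finite_UnI finite_subset)
      qed
      ultimately show "card {l. x l \<noteq> z l} < card {l. x l \<noteq> y l}" by (rule psubset_card_mono[rotated])
      show "fin_supp z" by (rule fz)
      show "0 \<le> z l" for l by (rule z0)
      fix k
      have zy: "sum z {..<k} = sum y {..<k} - (if i < k then \<delta> else 0) + (if j < k then \<delta> else 0)" for k
      proof (induction k)
        case (Suc k)
        show ?case using Suc zi zj zl[of k] i by (cases "k = i"; cases "k = j") auto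
      qed auto
      \<comment> \<open>Only the sums with i < k \<le> j decrease. For these the slack of y over x
        is the slack up to i, where the surplus y i - x i covers \<delta>.\<close>
      show "sum x {..<k} \<le> sum z {..<k}"
      proof (cases "i < k \<and> k \<le> j")
        case True
        have "sum x {..<k} - sum x {..<Suc i} = sum y {..<k} - sum y {..<Suc i}"
        proof -
          have "sum h {..<k} = sum h {..<Suc i} + sum h {Suc i..<k}" for h :: "nat \<Rightarrow> real"
            unfolding lessThan_atLeast0
            by (rule sum.atLeastLessThan_concat[symmetric]) (use True in auto)
          moreover have "sum x {Suc i..<k} = sum y {Suc i..<k}"
            using True by (intro sum.cong refl between) auto
          ultimately show ?thesis by simp
        qed
        moreover have "sum x {..<Suc i} \<le> sum y {..<Suc i} - \<delta>"
          using less.prems(3)[of i] \<delta>(2) by simp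
        ultimately show ?thesis using zy[of k] True by simp
      next
        case False
        then show ?thesis using zy[of k] less.prems(3)[of k] i by auto
      qed
    qed
    also have "\<Phi> z \<le> \<Phi> y"
    proof -
      define t where "t = \<delta> / (y i - y j)"
      have t: "0 \<le> t" "t \<le> 1" using gap \<delta>(1) by (auto simp: t_def)
      define \<pi> where "\<pi> = (\<lambda>l. if l = i then j else if l = j then i else l)"
      have \<pi>: "bij \<pi>" by (rule o_bij[of \<pi>]) (auto simp: \<pi>_def fun_eq_iff)
      define w where "w = (\<lambda>l. y (\<pi> l))"
      have wy: "\<Phi> w = \<Phi> y"
        using symm_norming_permute[OF \<Phi> less.prems(1) \<pi>] less.prems(2) by (simp add: w_def)
      have fw: "fin_supp w"
      proof -
        have "{l. w l \<noteq> 0} \<subseteq> insert i (insert j {l. y l \<noteq> 0})" by (auto simp: w_def \<pi>_def)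
        then show ?thesis using less.prems(1) unfolding fin_supp_def by (meson finite.insertI finite_subset)
      qed
      have t\<delta>: "t * (y i - y j) = \<delta>" using gap by (simp add: t_def)
      have "z l = (1 - t) * y l + t * w l" for l
        using t\<delta> zi zj zl[of l] i
        by (cases "l = i"; cases "l = j") (auto simp: w_def \<pi>_def algebra_simps)
      then have "z = (\<lambda>l. (1 - t) * y l + t * w l)" by blast
      then show ?thesis using symm_norming_convex[OF \<Phi> less.prems(1) fw t order_refl[of "\<Phi> y"]] wy by simp
    qed
    finally show ?thesis .
  qed
qed

text \<open>Truncating at n replaces partial sums up to k by those up to min k n, so the Ky Fan
  bounds give weak majorization of the truncated sequences. Membership of N in the ideal bounds its
  truncated values by the supremum.\<close>

lemma uinorm_le_of_Ky_Fan:
  fixes M N :: "'a::chilbert \<Rightarrow> 'a"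
  assumes \<Phi>: "symm_norming \<Phi>" and M: "in_ideal \<Phi> M" and N: "in_ideal \<Phi> N" and C: "0 \<le> C"
    and le: "\<And>k. (\<Sum>j<k. sval j M) \<le> C * (\<Sum>j<k. sval j N)"
  shows "uinorm \<Phi> M \<le> C * uinorm \<Phi> N"
proof -
  have BM: "bounded_clinear M" and BN: "bounded_clinear N" and bdd: "bdd_above (range (trunc_sv \<Phi> N))"
    using M N by (auto simp: in_ideal_def)
  have "trunc_sv \<Phi> M n \<le> C * uinorm \<Phi> N" for n
  proof -
    define x where "x = (\<lambda>i. if i < n then sval i M else 0)"
    define y where "y = (\<lambda>i. if i < n then sval i N else 0)"
    have fs: "fin_supp x" "fin_supp y" "fin_supp (\<lambda>i. C * y i)"
      unfolding fin_supp_def by (rule finite_subset[of _ "{..<n}"]; auto simp: x_def y_def split: if_splits)+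
    have partial: "(\<Sum>i<k. if i < n then h i else 0) = sum h {..<min k n}" for h :: "nat \<Rightarrow> real" and k
    proof -
      have "{..<min k n} = {..<k} \<inter> {i. i < n}" by auto
      then show ?thesis by (simp add: sum.inter_restrict)
    qed
    have "\<Phi> x \<le> \<Phi> (\<lambda>i. C * y i)"
    proof (rule symm_norming_weak_majorization[OF \<Phi> fs(3,1)])
      show "0 \<le> x i" "0 \<le> C * y i" for i
        using sval_nonneg[OF BM] sval_nonneg[OF BN] C by (auto simp: x_def y_def)
      have "sval j M \<le> sval i M" if "i \<le> j" for i j
        using that sval_Suc_le[OF BM] by (rule lift_Suc_antimono_le[rotated])
      then show "x j \<le> x i" if "i \<le> j" for i j
        using that sval_nonneg[OF BM] by (auto simp: x_def)
      show "sum x {..<k} \<le> (\<Sum>i<k. C * y i)" for k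
        using le[of "min k n"] unfolding x_def y_def partial sum_distrib_left[symmetric] .
    qed
    also have "\<dots> = C * \<Phi> y" using symm_norming_scale[OF \<Phi> fs(2), of C] C by simp
    also have "\<Phi> y \<le> uinorm \<Phi> N"
      unfolding uinorm_def y_def trunc_sv_def[symmetric] by (rule cSUP_upper[OF UNIV_I bdd])
    finally show ?thesis using C by (simp add: trunc_sv_def x_def mult_left_mono)
  qed
  then show ?thesis unfolding uinorm_def by (intro cSUP_least) auto
qed

section \<open>The functional calculus as a Poisson average\<close>

lemma has_integral_circle_mean:
  assumes h: "h holomorphic_on cball 0 r" and r: "0 < r"
  shows "((\<lambda>t. h (of_real r * cis t)) has_integral (2 * of_real pi * h 0)) {0..2*pi}"
proof -
  have "((\<lambda>u. h u / (u - 0)) has_contour_integral (2 * of_real pi * \<i> * h 0)) (circlepath 0 r)"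
    by (rule Cauchy_integral_circlepath_simple[OF h]) (use r in auto)
  then have "((\<lambda>t. h (0 + of_real r * cis t) / (0 + of_real r * cis t - 0) * of_real r * \<i> * cis t)
      has_integral (2 * of_real pi * \<i> * h 0)) {0..2*pi}"
    unfolding circlepath_def by (subst (asm) has_contour_integral_part_circlepath_iff) auto
  from has_integral_mult_left[OF this, of "- \<i>"] show ?thesis
    using r by (simp add: mult_ac)
qed

text \<open>The circles are homotopic along radii in the annulus, and h z / z is holomorphic there.
  This frees the calculus from the radius built into \<open>hfc\<close>, so that the radius can
  later tend to 1.\<close>

lemma integral_circle_annulus:
  assumes h: "h holomorphic_on {z. s < cmod z \<and> cmod z < R}" and s: "0 \<le> s"
    and r: "s < r" "r < R" and \<rho>: "s < \<rho>" "\<rho> < R"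
  shows "integral {0..2*pi} (\<lambda>t. h (of_real r * cis t)) = integral {0..2*pi} (\<lambda>t. h (of_real \<rho> * cis t))"
proof -
  define S where "S = {z::complex. s < cmod z \<and> cmod z < R}"
  have conv: "contour_integral (circlepath 0 a) (\<lambda>u. h u / u) = integral {0..2*pi} (\<lambda>t. h (of_real a * cis t)) * \<i>"
    if "a > 0" for a
  proof -
    have "contour_integral (circlepath 0 a) (\<lambda>u. h u / u) =
        integral {0..2*pi} (\<lambda>t. h (0 + of_real a * cis t) / (0 + of_real a * cis t) * of_real a * \<i> * cis t)"
      unfolding circlepath_def by (rule contour_integral_part_circlepath_eq) auto
    also have "\<dots> = integral {0..2*pi} (\<lambda>t. h (of_real a * cis t) * \<i>)"
      using that by (intro integral_cong) (simp add: mult_ac)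
    finally show ?thesis by simp
  qed
  have "homotopic_loops S (circlepath 0 r) (circlepath 0 \<rho>)"
  proof (rule homotopic_loops_linear)
    fix t :: real
    show "closed_segment (circlepath 0 r t) (circlepath 0 \<rho> t) \<subseteq> S"
    proof
      fix z assume "z \<in> closed_segment (circlepath 0 r t) (circlepath 0 \<rho> t)"
      then obtain u where u: "0 \<le> u" "u \<le> 1"
        "z = (1 - u) *\<^sub>R circlepath 0 r t + u *\<^sub>R circlepath 0 \<rho> t" by (auto simp: closed_segment_def)
      have z: "z = of_real ((1 - u) * r + u * \<rho>) * exp (2 * of_real pi * \<i> * of_real t)"
        by (simp add: u(3) circlepath scaleR_conv_of_real algebra_simps)
      have "(1 - u) * r + u * \<rho> > s" "(1 - u) * r + u * \<rho> < R"
        using convex_bound_lt[of "- r" "- s" "- \<rho>" "1 - u" u] convex_bound_lt[of r R \<rho> "1 - u" u] u r \<rho> by auto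
      moreover have "cmod z = \<bar>(1 - u) * r + u * \<rho>\<bar>"
        unfolding z norm_mult norm_of_real by (simp add: norm_exp_eq_Re)
      ultimately show "z \<in> S" using s by (simp add: S_def)
    qed
  qed auto
  moreover have "open S"
    unfolding S_def by (intro open_Collect_conj open_Collect_less continuous_intros)
  moreover have "(\<lambda>u. h u / u) holomorphic_on S"
    using h s unfolding S_def by (intro holomorphic_intros) auto
  ultimately have "contour_integral (circlepath 0 r) (\<lambda>u. h u / u) = contour_integral (circlepath 0 \<rho>) (\<lambda>u. h u / u)"
    by (intro Cauchy_theorem_homotopic_loops) auto
  then show ?thesis using conv[of r] conv[of \<rho>] r \<rho> s by simp
qed

text \<open>The Schwarz formula paired with a function \<open>\<psi>\<close> that is holomorphic in \<open>1 / z\<close>: the antiholomorphic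
  part of \<open>2 Re f = f + cnj f\<close> only sees \<open>\<psi> 0\<close>, since \<open>1 / z = cnj z / \<rho>\<^sup>2\<close> on the circle.\<close>

lemma has_integral_Schwarz:
  assumes f: "f holomorphic_on ball 0 1" "f 0 = 1"
    and \<psi>: "\<psi> holomorphic_on {w. cmod w * s < 1}" and s: "0 \<le> s" "s < \<rho>" "\<rho> < 1"
  shows "((\<lambda>t. of_real (Re (f (of_real \<rho> * cis t))) * (2 * \<psi> (1 / (of_real \<rho> * cis t)) - \<psi> 0)) has_integral
     integral {0..2*pi} (\<lambda>t. f (of_real \<rho> * cis t) * \<psi> (1 / (of_real \<rho> * cis t)))) {0..2*pi}"
proof -
  define z where "z t = complex_of_real \<rho> * cis t" for t
  have \<rho>: "\<rho> > 0" using s by simp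
  have cz: "cmod (z t) = \<rho>" for t using \<rho> by (simp add: z_def norm_mult)
  have contz: "continuous_on A z" for A unfolding z_def by (intro continuous_intros)
  have z0: "z t \<noteq> 0" for t using cz[of t] \<rho> by auto
  have openD: "open {w. cmod w * s < 1}" by (intro open_Collect_less continuous_intros)
  have f': "f holomorphic_on cball 0 \<rho>" using f(1) by (rule holomorphic_on_subset) (use s in auto)
  have I1: "((\<lambda>t. f (z t) * \<psi> (1 / z t)) has_integral
      integral {0..2*pi} (\<lambda>t. f (z t) * \<psi> (1 / z t))) {0..2*pi}"
  proof (intro integrable_integral integrable_continuous_interval continuous_on_mult)
    show "continuous_on {0..2*pi} (\<lambda>t. f (z t))"
      by (rule continuous_on_compose2[OF holomorphic_on_imp_continuous_on[OF f'] contz]) (auto simp: cz)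
    show "continuous_on {0..2*pi} (\<lambda>t. \<psi> (1 / z t))"
      by (rule continuous_on_compose2[OF holomorphic_on_imp_continuous_on[OF \<psi>]])
         (use s \<rho> in \<open>auto intro!: continuous_intros contz simp: z0 cz norm_divide\<close>)
  qed
  have I3: "((\<lambda>t. f (z t)) has_integral 2 * of_real pi) {0..2*pi}"
    using has_integral_circle_mean[OF f' \<rho>] f(2) by (simp add: z_def)
  then have I4: "((\<lambda>t. cnj (f (z t))) has_integral 2 * of_real pi) {0..2*pi}"
    using has_integral_cnj[of "\<lambda>t. f (z t)" "2 * of_real pi"] by (simp add: o_def)
  have I2: "((\<lambda>t. cnj (f (z t)) * \<psi> (1 / z t)) has_integral 2 * of_real pi * \<psi> 0) {0..2*pi}"
  proof -
    \<comment> \<open>On the circle h is the conjugate of the integrand, but it is holomorphic on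
      the whole closed disk because s < \<rho>; its mean is therefore its value at 0.\<close>
    define h where "h w = f w * cnj (\<psi> (cnj (w / of_real (\<rho>\<^sup>2))))" for w
    have "(cnj \<circ> \<psi> \<circ> cnj) holomorphic_on {w. cmod w * s < 1}"
    proof (rule holomorphic_on_compose_cnj_cnj[OF _ openD])
      have "cnj ` {w. cmod w * s < 1} \<subseteq> {w. cmod w * s < 1}" by auto
      with \<psi> show "\<psi> holomorphic_on cnj ` {w. cmod w * s < 1}" by (rule holomorphic_on_subset)
    qed
    then have "(cnj \<circ> \<psi> \<circ> cnj) \<circ> (\<lambda>w. w / of_real (\<rho>\<^sup>2)) holomorphic_on cball 0 \<rho>"
    proof (rule holomorphic_on_compose_gen[rotated])
      show "(\<lambda>w. w / of_real (\<rho>\<^sup>2)) ` cball 0 \<rho> \<subseteq> {w. cmod w * s < 1}"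
      proof safe
        fix w :: complex assume "w \<in> cball 0 \<rho>"
        then have "cmod w * s \<le> \<rho> * s" using s by (intro mult_right_mono) auto
        also have "\<dots> < \<rho>\<^sup>2" using s \<rho> by (simp add: power2_eq_square)
        finally show "cmod (w / of_real (\<rho>\<^sup>2)) * s < 1"
          using \<rho> by (simp add: norm_divide norm_power field_simps)
      qed
    qed (use \<rho> in \<open>auto intro!: holomorphic_intros\<close>)
    then have "h holomorphic_on cball 0 \<rho>"
      unfolding h_def using f' by (intro holomorphic_on_mult) (auto simp: o_def)
    from has_integral_circle_mean[OF this \<rho>]
    have "((\<lambda>t. h (z t)) has_integral 2 * of_real pi * cnj (\<psi> 0)) {0..2*pi}"
      by (simp add: z_def h_def f(2))
    then have "((\<lambda>t. cnj (h (z t))) has_integral 2 * of_real pi * \<psi> 0) {0..2*pi}"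
      using has_integral_cnj[of "\<lambda>t. h (z t)" "2 * of_real pi * cnj (\<psi> 0)"] by (simp add: o_def)
    moreover have "cnj (z t / of_real (\<rho>\<^sup>2)) = 1 / z t" for t
      using complex_norm_square[of "z t"] z0[of t] \<rho> by (simp add: cz field_simps)
    ultimately show ?thesis by (simp add: h_def)
  qed
  \<comment> \<open>The subtracted \<psi> 0 is chosen so that the means 2 pi \<psi> 0 cancel and
    only the integral of f \<psi> remains.\<close>
  have "((\<lambda>t. f (z t) * \<psi> (1 / z t) + cnj (f (z t)) * \<psi> (1 / z t) - (f (z t) * (\<psi> 0 / 2) + cnj (f (z t)) * (\<psi> 0 / 2)))
    has_integral integral {0..2*pi} (\<lambda>t. f (z t) * \<psi> (1 / z t)) + 2 * of_real pi * \<psi> 0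
      - (2 * of_real pi * (\<psi> 0 / 2) + 2 * of_real pi * (\<psi> 0 / 2))) {0..2*pi}"
    by (intro has_integral_add has_integral_diff has_integral_mult_left I1 I2 I3 I4)
  moreover have "f (z t) * \<psi> (1 / z t) + cnj (f (z t)) * \<psi> (1 / z t) - (f (z t) * (\<psi> 0 / 2) + cnj (f (z t)) * (\<psi> 0 / 2))
     = of_real (Re (f (z t))) * (2 * \<psi> (1 / z t) - \<psi> 0)" for t
  proof -
    have re: "of_real (Re (f (z t))) = (f (z t) + cnj (f (z t))) / 2" by (simp add: complex_add_cnj)
    show ?thesis unfolding re by (simp add: field_simps)
  qed
  ultimately show ?thesis unfolding z_def by simp
qed

section \<open>Resolvents of G1 operators\<close>

lemma resolvent_props:
  fixes A :: "'a::chilbert \<Rightarrow> 'a"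
  assumes z: "z \<notin> spec A"
  shows bounded_clinear_resolvent: "bounded_clinear (resolvent A z)"
    and resolvent_left: "resolvent A z (z *\<^sub>C x - A x) = x"
    and resolvent_right: "z *\<^sub>C resolvent A z y - A (resolvent A z y) = y"
proof -
  obtain S where S: "bounded_clinear S" "\<And>x. S (z *\<^sub>C x - A x) = x" "\<And>y. z *\<^sub>C S y - A (S y) = y"
    using z by (auto simp: spec_def)
  have "resolvent A z = S"
    unfolding resolvent_def by (intro ext the_equality) (use S in auto)
  with S show "bounded_clinear (resolvent A z)" "resolvent A z (z *\<^sub>C x - A x) = x"
    "z *\<^sub>C resolvent A z y - A (resolvent A z y) = y" by auto
qed

locale nontrivial_G1 =
  fixes A :: "'a::chilbert \<Rightarrow> 'a"
  assumes nontriv: "(UNIV :: 'a set) \<noteq> {0}" and G1: "G1 A" and spec_subset: "spec A \<subseteq> ball 0 1"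
begin

lemma bounded_A: "bounded_clinear A" using G1 by (simp add: G1_def)

text \<open>Distance 0, which is also the value of \<open>infdist\<close> for an empty spectrum,
  would turn the G1 condition into norm 1 / 0 = 0 for an invertible operator. Nonemptiness and
  closedness of the spectrum are both drawn from this.\<close>

lemma infdist_spec_pos:
  assumes z: "z \<notin> spec A"
  shows "0 < infdist z (spec A)"
proof (rule ccontr)
  assume "\<not> ?thesis"
  then have "infdist z (spec A) = 0" using infdist_nonneg[of z "spec A"] by linarith
  then have "onorm (resolvent A z) = 0" using G1 z by (simp add: G1_def)
  then have "resolvent A z x = 0" for x
    using onorm_eq_0[OF bounded_clinear_imp_bounded_linear[OF bounded_clinear_resolvent[OF z]]] by auto
  then have "x = 0" for x :: 'a
    using resolvent_left[OF z, of x] by simp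
  with nontriv show False by auto
qed

lemma norm_resolvent_le:
  assumes z: "z \<notin> spec A"
  shows "norm (resolvent A z x) \<le> norm x / infdist z (spec A)"
  using onorm[OF bounded_clinear_imp_bounded_linear[OF bounded_clinear_resolvent[OF z]], of x] G1 z
  by (simp add: G1_def)

lemma spec_nonempty: "spec A \<noteq> {}"
  using infdist_spec_pos[of 0] by (auto simp: infdist_def)

lemma closed_spec: "closed (spec A)"
proof -
  have "z \<in> spec A" if "z \<in> closure (spec A)" for z
    using infdist_spec_pos[of z] that in_closure_iff_infdist_zero[OF spec_nonempty, of z] by fastforce
  then show ?thesis by (meson closure_subset_eq subsetI)
qed

lemma compact_spec: "compact (spec A)"
  using closed_spec spec_subset bounded_ball bounded_subset compact_eq_bounded_closed by blast

definition spectral_radius :: real where "spectral_radius = Sup (cmod ` spec A)"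

lemma spectral_radius_bounds: "0 \<le> spectral_radius" "spectral_radius < 1"
  and norm_le_spectral_radius: "a \<in> spec A \<Longrightarrow> cmod a \<le> spectral_radius"
proof -
  obtain a where a: "a \<in> spec A" "\<And>b. b \<in> spec A \<Longrightarrow> cmod b \<le> cmod a"
    using continuous_attains_sup[OF compact_spec spec_nonempty continuous_on_norm[OF continuous_on_id]] by auto
  have "spectral_radius = cmod a"
    unfolding spectral_radius_def by (rule cSup_eq_maximum) (use a in auto)
  then show "0 \<le> spectral_radius" "spectral_radius < 1" "b \<in> spec A \<Longrightarrow> cmod b \<le> spectral_radius" for b
    using a spec_subset by auto
qed

text \<open>The inverse of \<open>1 - w A\<close>.\<close>

definition inv1 :: "complex \<Rightarrow> 'a \<Rightarrow> 'a" where
  "inv1 w = (if w = 0 then \<lambda>x. x else (\<lambda>x. (1 / w) *\<^sub>C resolvent A (1 / w) x))"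

text \<open>The image under 1 / z of the exterior of the spectral disk, with infinity placed at
  0.\<close>

definition dom1 :: "complex set" where "dom1 = {w. cmod w * spectral_radius < 1}"

lemma dom1_D: "w \<in> dom1 \<Longrightarrow> w \<noteq> 0 \<Longrightarrow> 1 / w \<notin> spec A"
  using norm_le_spectral_radius[of "1 / w"] by (auto simp: dom1_def norm_divide field_simps)

lemma open_dom1: "open dom1"
  unfolding dom1_def by (intro open_Collect_less continuous_intros)

lemma inv1_0: "inv1 0 x = x" by (simp add: inv1_def)

lemma bounded_clinear_inv1: "w \<in> dom1 \<Longrightarrow> bounded_clinear (inv1 w)"
  by (auto simp: inv1_def bounded_clinear_id dom1_D
      intro!: bounded_clinear_scaleC_op bounded_clinear_resolvent)

lemma inv1_left:
  assumes w: "w \<in> dom1" shows "inv1 w (x - w *\<^sub>C A x) = x"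
proof (cases "w = 0")
  case False
  note R = dom1_D[OF w False]
  have "x - w *\<^sub>C A x = w *\<^sub>C ((1 / w) *\<^sub>C x - A x)"
    using False by (simp add: scaleC_diff_right scaleC_scaleC)
  then show ?thesis using False resolvent_left[OF R, of x]
    by (simp add: inv1_def bounded_clinear_scaleC[OF bounded_clinear_resolvent[OF R]] scaleC_scaleC)
qed (simp add: inv1_def)

lemma inv1_right:
  assumes w: "w \<in> dom1" shows "inv1 w x - w *\<^sub>C A (inv1 w x) = x"
proof (cases "w = 0")
  case False
  then show ?thesis using resolvent_right[OF dom1_D[OF w False], of x]
    by (simp add: inv1_def bounded_clinear_scaleC[OF bounded_A] scaleC_scaleC)
qed (simp add: inv1_def)

lemma norm_inv1_le_infdist:
  assumes w: "w \<in> dom1" "w \<noteq> 0"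
  shows "norm (inv1 w x) \<le> norm x / (cmod w * infdist (1 / w) (spec A))"
  using norm_resolvent_le[OF dom1_D[OF w], of x] w(2)
  by (simp add: inv1_def norm_scaleC norm_divide divide_right_mono field_simps)

text \<open>A cruder bound than \<open>norm_inv1_le_infdist\<close>, but locally uniform and valid
  across w = 0; the continuity of \<open>inv1\<close> rests on it.\<close>

lemma norm_inv1_le:
  assumes w: "w \<in> dom1"
  shows "norm (inv1 w x) \<le> norm x / (1 - cmod w * spectral_radius)"
proof (cases "w = 0")
  case False
  obtain a where a: "a \<in> spec A" "infdist (1 / w) (spec A) = dist (1 / w) a"
    using infdist_attains_inf[OF closed_spec spec_nonempty] by metis
  have "1 / cmod w - spectral_radius \<le> infdist (1 / w) (spec A)"
    using norm_triangle_ineq2[of "1 / w" a] norm_le_spectral_radius[OF a(1)]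
    by (simp add: a(2) dist_norm norm_divide)
  then have "1 - cmod w * spectral_radius \<le> cmod w * infdist (1 / w) (spec A)"
    using mult_left_mono[of _ _ "cmod w"] False by (fastforce simp: right_diff_distrib)
  then have "norm x / (cmod w * infdist (1 / w) (spec A)) \<le> norm x / (1 - cmod w * spectral_radius)"
    using w False infdist_spec_pos[OF dom1_D[OF w False]]
    by (intro divide_left_mono mult_pos_pos) (auto simp: dom1_def)
  then show ?thesis using norm_inv1_le_infdist[OF w False, of x] by linarith
qed (simp add: inv1_def)

text \<open>The resolvent identity in the variable w = 1 / z, source of both continuity and the
  complex derivative.\<close>

lemma inv1_diff:
  assumes "w \<in> dom1" "v \<in> dom1"
  shows "inv1 w x - inv1 v x = (w - v) *\<^sub>C inv1 w (A (inv1 v x))"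
proof -
  let ?y = "inv1 v x"
  have "x = (?y - w *\<^sub>C A ?y) + (w - v) *\<^sub>C A ?y"
    using inv1_right[OF assms(2), of x] by (simp add: scaleC_diff_left)
  then have "inv1 w x = inv1 w (?y - w *\<^sub>C A ?y) + (w - v) *\<^sub>C inv1 w (A ?y)"
    by (metis assms(1) bounded_clinear_add bounded_clinear_inv1 bounded_clinear_scaleC)
  then show ?thesis by (simp add: inv1_left[OF assms(1)])
qed

lemma inv1_tendsto:
  assumes v: "v \<in> dom1" shows "((\<lambda>w. inv1 w x) \<longlongrightarrow> inv1 v x) (at v)"
proof -
  have "((\<lambda>w. inv1 w x - inv1 v x) \<longlongrightarrow> 0) (at v)"
  proof (rule Lim_null_comparison)
    show "\<forall>\<^sub>F w in at v. norm (inv1 w x - inv1 v x) \<le>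
        cmod (w - v) * (norm (A (inv1 v x)) / (1 - cmod w * spectral_radius))"
      using eventually_at_in_open'[OF open_dom1 v]
    proof eventually_elim
      case (elim w)
      show ?case
        using mult_left_mono[OF norm_inv1_le[OF elim, of "A (inv1 v x)"], of "cmod (w - v)"]
        by (simp add: inv1_diff[OF elim v] norm_scaleC)
    qed
    have "((\<lambda>w. cmod (w - v) * (norm (A (inv1 v x)) / (1 - cmod w * spectral_radius))) \<longlongrightarrow>
        cmod (v - v) * (norm (A (inv1 v x)) / (1 - cmod v * spectral_radius))) (at v)"
      using v by (intro tendsto_intros) (auto simp: dom1_def)
    then show "((\<lambda>w. cmod (w - v) * (norm (A (inv1 v x)) / (1 - cmod w * spectral_radius))) \<longlongrightarrow> 0) (at v)"
      by simp
  qed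
  then show ?thesis by (simp add: LIM_zero_iff)
qed

lemma continuous_on_inv1: "continuous_on dom1 (\<lambda>w. inv1 w x)"
  by (intro continuous_at_imp_continuous_on ballI) (simp add: isCont_def inv1_tendsto)

lemma holomorphic_on_inv1: "(\<lambda>w. cinner y (inv1 w x)) holomorphic_on dom1"
  unfolding holomorphic_on_def field_differentiable_def
proof
  fix v assume v: "v \<in> dom1"
  have "((\<lambda>w. cinner y (inv1 w x)) has_field_derivative cinner y (inv1 v (A (inv1 v x)))) (at v)"
    unfolding has_field_derivative_iff
  proof (rule Lim_transform_eventually)
    show "((\<lambda>w. cinner y (inv1 w (A (inv1 v x)))) \<longlongrightarrow> cinner y (inv1 v (A (inv1 v x)))) (at v)"
      by (intro tendsto_cinner tendsto_const inv1_tendsto v)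
    have "\<forall>\<^sub>F w in at v. w \<in> dom1 \<and> w \<noteq> v"
      using eventually_at_in_open[OF open_dom1 v] by simp
    then show "\<forall>\<^sub>F w in at v. cinner y (inv1 w (A (inv1 v x))) =
        (cinner y (inv1 w x) - cinner y (inv1 v x)) / (w - v)"
      by eventually_elim (simp add: cinner_diff_right[symmetric] inv1_diff v cinner_scaleC_right)
  qed
  then show "\<exists>D. ((\<lambda>w. cinner y (inv1 w x)) has_field_derivative D) (at v within dom1)"
    by (intro exI) (rule has_field_derivative_at_within)
qed

lemma circle_in_dom1:
  assumes "spectral_radius < \<rho>" shows "1 / (of_real \<rho> * cis t) \<in> dom1"
  using assms spectral_radius_bounds by (simp add: dom1_def norm_divide norm_mult)

text \<open>On the circle dz = i z dt, and z (z - A)^{-1} is \<open>inv1 (1 / z)\<close>; the factor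
  i cancels against 1 / (2 pi i).\<close>

lemma cinner_hfc:
  assumes f: "f holomorphic_on ball 0 1"
  shows "cinner y (hfc f A x) = (1 / (2 * of_real pi)) *
    integral {0..2*pi} (\<lambda>t. f (of_real (calc_radius A) * cis t) *
      cinner y (inv1 (1 / (of_real (calc_radius A) * cis t)) x))"
proof -
  define r where "r = calc_radius A"
  have r: "spectral_radius < r" "r < 1" "0 < r"
    using spectral_radius_bounds by (auto simp: r_def calc_radius_def spectral_radius_def[symmetric])
  define z where "z t = complex_of_real r * cis t" for t
  have z0: "z t \<noteq> 0" for t using r by (simp add: z_def)
  have contz: "continuous_on {0..2*pi} z" unfolding z_def by (intro continuous_intros)
  define F where "F t = (\<i> * f (z t)) *\<^sub>C inv1 (1 / z t) x" for t
  have "(f (of_real r * exp (\<i> * of_real t)) * (\<i> * of_real r * exp (\<i> * of_real t))) *\<^sub>C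
      resolvent A (of_real r * exp (\<i> * of_real t)) x = F t" for t
    using z0[of t] by (simp add: F_def inv1_def scaleC_scaleC z_def cis_conv_exp[symmetric] mult_ac)
  then have hfc: "hfc f A x = (1 / (2 * of_real pi * \<i>)) *\<^sub>C integral {0..2*pi} F"
    by (simp add: hfc_def r_def[symmetric])
  have "F integrable_on {0..2*pi}"
  proof (rule integrable_continuous_interval)
    have "bounded_bilinear (\<lambda>c x :: 'a. c *\<^sub>C x)"
      by (rule bounded_bilinear.intro)
         (auto simp: scaleC_add_left scaleC_add_right scaleR_eq_scaleC scaleC_scaleC mult.commute
           scaleR_conv_of_real norm_scaleC intro!: exI[of _ 1])
    moreover have "continuous_on {0..2*pi} (\<lambda>t. \<i> * f (z t))"
      by (intro continuous_intros continuous_on_compose2[OF holomorphic_on_imp_continuous_on[OF f] contz])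
         (use r in \<open>auto simp: z_def norm_mult\<close>)
    moreover have "continuous_on {0..2*pi} (\<lambda>t. inv1 (1 / z t) x)"
      by (rule continuous_on_compose2[OF continuous_on_inv1])
         (use z0 circle_in_dom1[OF r(1)] in \<open>auto intro!: continuous_intros contz simp: z_def\<close>)
    ultimately show "continuous_on {0..2*pi} F"
      unfolding F_def by (rule bounded_bilinear.continuous_on)
  qed
  from integral_linear[OF this bounded_linear_cinner_right[of y]]
  have "cinner y (integral {0..2*pi} F) = integral {0..2*pi} (\<lambda>t. cinner y (F t))" by (simp add: o_def)
  also have "\<dots> = \<i> * integral {0..2*pi} (\<lambda>t. f (z t) * cinner y (inv1 (1 / z t) x))"
    by (simp add: F_def cinner_scaleC_right mult.assoc)
  finally show ?thesis unfolding hfc by (simp add: cinner_scaleC_right z_def r_def)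
qed

text \<open>The Herglotz representation of f(A) on any admissible circle: 2 (1 - w A)^{-1} - 1 is (1
  + w A)(1 - w A)^{-1}. The radius is first changed from that of \<open>hfc\<close> to \<rho>, then
  the Schwarz formula is applied with \<psi> a coefficient of \<open>inv1\<close>, so that \<psi> 0
  is \<open>cinner y x\<close>.\<close>

lemma has_integral_hfc:
  assumes f: "herglotz f" and \<rho>: "spectral_radius < \<rho>" "\<rho> < 1"
  shows "((\<lambda>t. of_real (Re (f (of_real \<rho> * cis t)) / (2 * pi)) *
      cinner y (2 *\<^sub>R inv1 (1 / (of_real \<rho> * cis t)) x - x)) has_integral cinner y (hfc f A x)) {0..2*pi}"
proof -
  have hol: "f holomorphic_on ball 0 1" and f0: "f 0 = 1" using f by (auto simp: herglotz_def)
  define \<psi> where "\<psi> w = cinner y (inv1 w x)" for w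
  have \<psi>: "\<psi> holomorphic_on {w. cmod w * spectral_radius < 1}"
    using holomorphic_on_inv1[of y x] unfolding \<psi>_def[abs_def] dom1_def .
  define r where "r = calc_radius A"
  have r: "spectral_radius < r" "r < 1"
    using spectral_radius_bounds by (auto simp: r_def calc_radius_def spectral_radius_def[symmetric])
  have "integral {0..2*pi} (\<lambda>t. f (of_real r * cis t) * \<psi> (1 / (of_real r * cis t))) =
      integral {0..2*pi} (\<lambda>t. f (of_real \<rho> * cis t) * \<psi> (1 / (of_real \<rho> * cis t)))"
  proof (rule integral_circle_annulus[where h = "\<lambda>z. f z * \<psi> (1 / z)", OF _ spectral_radius_bounds(1) r \<rho>])
    have "\<psi> \<circ> (\<lambda>z. 1 / z) holomorphic_on {z. spectral_radius < cmod z \<and> cmod z < 1}"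
    proof (rule holomorphic_on_compose_gen[OF _ \<psi>])
      show "(\<lambda>z. 1 / z) ` {z. spectral_radius < cmod z \<and> cmod z < 1} \<subseteq> {w. cmod w * spectral_radius < 1}"
        using spectral_radius_bounds by (auto simp: norm_divide divide_less_eq_1)
    qed (use spectral_radius_bounds in \<open>auto intro!: holomorphic_intros\<close>)
    moreover have "f holomorphic_on {z. spectral_radius < cmod z \<and> cmod z < 1}"
      using hol by (rule holomorphic_on_subset) auto
    ultimately show "(\<lambda>z. f z * \<psi> (1 / z)) holomorphic_on {z. spectral_radius < cmod z \<and> cmod z < 1}"
      by (intro holomorphic_on_mult) (auto simp: o_def)
  qed
  then have "cinner y (hfc f A x) = (1 / (2 * of_real pi)) *
      integral {0..2*pi} (\<lambda>t. f (of_real \<rho> * cis t) * \<psi> (1 / (of_real \<rho> * cis t)))"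
    using cinner_hfc[OF hol, of y x] by (simp add: \<psi>_def r_def)
  moreover have "((\<lambda>t. (1 / (2 * of_real pi)) * (of_real (Re (f (of_real \<rho> * cis t))) *
      (2 * \<psi> (1 / (of_real \<rho> * cis t)) - \<psi> 0))) has_integral
      (1 / (2 * of_real pi)) * integral {0..2*pi} (\<lambda>t. f (of_real \<rho> * cis t) * \<psi> (1 / (of_real \<rho> * cis t)))) {0..2*pi}"
    by (intro has_integral_mult_right has_integral_Schwarz[OF hol f0 \<psi> spectral_radius_bounds(1) \<rho>])
  ultimately show ?thesis
    by (simp add: \<psi>_def inv1_0 cinner_diff_right cinner_scaleR_right)
qed

end

text \<open>Total mass one allows the constant c to be moved under the integral. Used once for each
  variable, it replaces a double integral.\<close>

lemma weighted_average_add_le: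
  fixes a :: "real \<Rightarrow> complex"
  assumes w: "\<And>t. 0 \<le> w t" "(w has_integral 1) I"
    and x: "((\<lambda>t. of_real (w t) * a t) has_integral x) I" and M: "\<And>t. cmod (a t + c) \<le> M"
  shows "cmod (x + c) \<le> M"
proof -
  have "((\<lambda>t. of_real (w t) * a t + of_real (w t) * c) has_integral x + of_real 1 * c) I"
    using has_integral_mult_left[OF has_integral_of_real[OF w(2)], of c] x by (intro has_integral_add) auto
  then have 1: "((\<lambda>t. of_real (w t) * (a t + c)) has_integral x + c) I" by (simp add: distrib_left)
  have 2: "((\<lambda>t. w t * M) has_integral M) I" using has_integral_mult_left[OF w(2), of M] by simp
  have "norm (of_real (w t) * (a t + c)) \<le> w t * M" for t
    using w(1)[of t] M[of t] by (simp add: norm_mult mult_left_mono)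
  from integral_norm_bound_integral[OF has_integral_integrable[OF 1] has_integral_integrable[OF 2] this]
  show ?thesis unfolding integral_unique[OF 1] integral_unique[OF 2] .
qed

lemma herglotz_weight:
  assumes f: "herglotz f" and \<rho>: "0 < \<rho>" "\<rho> < 1"
  shows "0 \<le> Re (f (of_real \<rho> * cis t)) / (2 * pi)"
    and "((\<lambda>t. Re (f (of_real \<rho> * cis t)) / (2 * pi)) has_integral 1) {0..2*pi}"
proof -
  have hol: "f holomorphic_on cball 0 \<rho>" and f0: "f 0 = 1"
    using f \<rho> by (auto simp: herglotz_def elim!: holomorphic_on_subset)
  show "0 \<le> Re (f (of_real \<rho> * cis t)) / (2 * pi)"
    using f \<rho> by (intro divide_nonneg_pos less_imp_le) (auto simp: herglotz_def norm_mult)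
  have "((\<lambda>t. Re (f (of_real \<rho> * cis t))) has_integral Re (2 * of_real pi * f 0)) {0..2*pi}"
    by (rule has_integral_Re[OF has_integral_circle_mean[OF hol \<rho>(1)]])
  from has_integral_divide[OF this, of "2 * pi"]
  show "((\<lambda>t. Re (f (of_real \<rho> * cis t)) / (2 * pi)) has_integral 1) {0..2*pi}"
    by (simp add: f0)
qed

section \<open>Bounds near the unit circle and the average over both circles\<close>

context nontrivial_G1
begin

lemma dD_pos: "0 < dD A"
  unfolding dD_def using setdist_gt_0_compact_closed[of "sphere (0::complex) 1" "spec A"]
    closed_spec spec_nonempty spec_subset by auto

text \<open>The radial projection of z to the unit circle is 1 - |z| away, so at most this much of
  \<open>dD A\<close> is lost.\<close>

lemma infdist_circle_ge:
  assumes "0 < cmod z" "cmod z < 1"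
  shows "dD A - 1 + cmod z \<le> infdist z (spec A)"
proof -
  obtain a where a: "a \<in> spec A" "infdist z (spec A) = dist z a"
    using infdist_attains_inf[OF closed_spec spec_nonempty] by metis
  define y where "y = z / of_real (cmod z)"
  have "y \<in> sphere 0 1" using assms by (simp add: y_def norm_divide)
  then have "dD A \<le> dist y a" unfolding dD_def using a(1) by (intro setdist_le_dist) auto
  also have "\<dots> \<le> dist y z + dist z a" by (rule dist_triangle)
  also have "dist y z = 1 - cmod z"
  proof -
    have "y - z = of_real (1 - cmod z) * y" using assms by (simp add: y_def field_simps)
    then show ?thesis using assms \<open>y \<in> sphere 0 1\<close> by (simp add: dist_norm norm_mult del: of_real_diff)
  qed
  finally show ?thesis using a(2) by simp
qed

lemma norm_inv1_circle_le:
  assumes \<rho>: "spectral_radius < \<rho>" "\<rho> < 1" "1 - dD A < \<rho>"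
  shows "norm (inv1 (1 / (of_real \<rho> * cis t)) x) \<le> \<rho> / (dD A - 1 + \<rho>) * norm x"
proof -
  define z where "z = complex_of_real \<rho> * cis t"
  have \<rho>0: "0 < \<rho>" using \<rho> spectral_radius_bounds by simp
  then have z: "cmod z = \<rho>" "z \<noteq> 0" by (auto simp: z_def norm_mult)
  have "norm (inv1 (1 / z) x) \<le> norm x / (cmod (1 / z) * infdist (1 / (1 / z)) (spec A))"
    using circle_in_dom1[OF \<rho>(1)] z(2) by (intro norm_inv1_le_infdist) (auto simp: z_def)
  also have "\<dots> = \<rho> * norm x / infdist z (spec A)" using z \<rho>0 by (simp add: norm_divide)
  also have "\<dots> \<le> \<rho> * norm x / (dD A - 1 + \<rho>)"
    using infdist_circle_ge[of z] z \<rho> \<rho>0 by (intro divide_left_mono mult_pos_pos) auto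
  finally show ?thesis by (simp add: z_def)
qed

end

text \<open>The hypothesis \<open>key\<close> is the algebraic identity for the middle factor, free
  of resolvents; the sign \<sigma> lets one proof serve both inequalities. The bound 2 / \<rho>^2 is
  matched to the resolvent bounds \<kappa> and \<mu>, whose factors \<rho> cancel it.\<close>

lemma sum_cinner_Poisson_le:
  fixes A B X S T :: "'a::chilbert \<Rightarrow> 'a"
  assumes A: "nontrivial_G1 A" and B: "nontrivial_G1 B" and X: "bounded_clinear X"
    and f: "herglotz f" and g: "herglotz g"
    and S: "bounded_clinear S" and T: "bounded_clinear T"
    and key: "\<And>\<rho> u v. 0 < \<rho> \<Longrightarrow> \<rho> < 1 \<Longrightarrow> cmod u = 1 / \<rho> \<Longrightarrow> cmod v = 1 / \<rho> \<Longrightarrow>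
      \<exists>\<alpha> \<beta>. cmod \<alpha> \<le> 2 / \<rho>\<^sup>2 \<and> cmod \<beta> \<le> 2 / \<rho>\<^sup>2 \<and>
        (\<forall>x. X (x - v *\<^sub>C B x) + u *\<^sub>C A (X (x - v *\<^sub>C B x)) +
          \<sigma> *\<^sub>C (X (x + v *\<^sub>C B x) - u *\<^sub>C A (X (x + v *\<^sub>C B x))) = \<alpha> *\<^sub>C S x + \<beta> *\<^sub>C T x)"
    and e: "bessel k e" and h: "bessel k h"
    and \<rho>: "nontrivial_G1.spectral_radius A < \<rho>" "nontrivial_G1.spectral_radius B < \<rho>"
      "1 - dD A < \<rho>" "1 - dD B < \<rho>" "\<rho> < 1"
  shows "cmod (\<Sum>j<k. cinner (h j) (hfc f A (X (e j)) + \<sigma> *\<^sub>C X (hfc g B (e j))))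
    \<le> 2 * sqrt 2 / ((dD A - 1 + \<rho>) * (dD B - 1 + \<rho>)) * (\<Sum>j<k. sval j (\<lambda>x. abs_op S x + abs_op T x))"
proof -
  interpret A: nontrivial_G1 A by (rule A)
  interpret B: nontrivial_G1 B by (rule B)
  define K where "K = (\<Sum>j<k. sval j (\<lambda>x. abs_op S x + abs_op T x))"
  have \<rho>0: "0 < \<rho>" using \<rho>(1) A.spectral_radius_bounds by simp
  define w where "w t = 1 / (complex_of_real \<rho> * cis t)" for t
  have cw: "cmod (w t) = 1 / \<rho>" for t using \<rho>0 by (simp add: w_def norm_divide norm_mult)
  define \<kappa> where "\<kappa> = \<rho> / (dD A - 1 + \<rho>)"
  define \<mu> where "\<mu> = \<rho> / (dD B - 1 + \<rho>)"
  have pos: "0 < \<kappa>" "0 < \<mu>" using \<rho> \<rho>0 by (auto simp: \<kappa>_def \<mu>_def)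
  define C where "C = 2 * sqrt 2 / ((dD A - 1 + \<rho>) * (dD B - 1 + \<rho>)) * K"
  \<comment> \<open>The variables are separated: a carries f(A) X, and b carries \<sigma> X g(B),
    with X moved to the test vector so that \<open>B.has_integral_hfc\<close> applies to e
    j.\<close>
  define a where "a t = (\<Sum>j<k. cinner (h j) (2 *\<^sub>R A.inv1 (w t) (X (e j)) - X (e j)))" for t
  define b where "b t = (\<Sum>j<k. \<sigma> * cinner (adj X (h j)) (2 *\<^sub>R B.inv1 (w t) (e j) - e j))" for t
  have ab: "cmod (a t + b s) \<le> C" for t s
  proof -
    obtain \<alpha> \<beta> where \<alpha>\<beta>: "cmod \<alpha> \<le> 2 / \<rho>\<^sup>2" "cmod \<beta> \<le> 2 / \<rho>\<^sup>2"
      "\<And>x. X (x - w s *\<^sub>C B x) + w t *\<^sub>C A (X (x - w s *\<^sub>C B x)) +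
          \<sigma> *\<^sub>C (X (x + w s *\<^sub>C B x) - w t *\<^sub>C A (X (x + w s *\<^sub>C B x))) = \<alpha> *\<^sub>C S x + \<beta> *\<^sub>C T x"
      using key[OF \<rho>0 \<rho>(5) cw[of t] cw[of s]] by blast
    have wA: "w t \<in> A.dom1" and wB: "w s \<in> B.dom1"
      using A.circle_in_dom1 B.circle_in_dom1 \<rho> by (auto simp: w_def)
    let ?R = "A.inv1 (w t)" and ?Q = "B.inv1 (w s)"
    note R = A.bounded_clinear_inv1[OF wA] and Q = B.bounded_clinear_inv1[OF wB]
    have normR: "norm (?R x) \<le> \<kappa> * norm x" and normQ: "norm (?Q x) \<le> \<mu> * norm x" for x
      using A.norm_inv1_circle_le[OF \<rho>(1,5,3)] B.norm_inv1_circle_le[OF \<rho>(2,5,4)]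
      by (auto simp: w_def \<kappa>_def \<mu>_def)
    \<comment> \<open>Dividing by \<mu> and \<kappa> makes the resolvent factors contractions, so p
      and q are again admissible test systems.\<close>
    define p where "p j = (1 / \<mu>) *\<^sub>R ?Q (e j)" for j
    define q where "q j = (1 / \<kappa>) *\<^sub>R adj ?R (h j)" for j
    have bp: "bessel k p" unfolding p_def
      by (rule bessel_image[OF e bounded_clinear_scaleR_op[OF Q]])
         (use normQ pos in \<open>simp add: field_simps\<close>)
    have bq: "bessel k q" unfolding q_def
      by (rule bessel_image[OF h bounded_clinear_scaleR_op[OF bounded_clinear_adj[OF R]]])
         (use norm_adj_le[OF R normR] pos in \<open>simp add: field_simps\<close>)
    have summand: "cinner (h j) (2 *\<^sub>R ?R (X (e j)) - X (e j)) + \<sigma> * cinner (adj X (h j)) (2 *\<^sub>R ?Q (e j) - e j)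
        = of_real (\<kappa> * \<mu>) * cinner (q j) (\<alpha> *\<^sub>C S (p j) + \<beta> *\<^sub>C T (p j))" for j
    proof -
      define x where "x = ?Q (e j)"
      \<comment> \<open>Expressing e j through x puts the resolvent of B on the right of both terms;
        the resolvent of A is then placed on the left of both.\<close>
      have ej: "e j = x - w s *\<^sub>C B x" using B.inv1_right[OF wB, of "e j"] by (simp add: x_def)
      define y where "y = X (x - w s *\<^sub>C B x)"
      define z where "z = X (x + w s *\<^sub>C B x)"
      have "X (e j) = y" by (simp add: ej y_def)
      moreover have "2 *\<^sub>R ?R y - y = ?R (y + w t *\<^sub>C A y)"
      proof -
        have "?R (y + w t *\<^sub>C A y) = ?R (2 *\<^sub>R y - (y - w t *\<^sub>C A y))" by (simp add: scaleR_2)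
        also have "\<dots> = 2 *\<^sub>R ?R y - ?R (y - w t *\<^sub>C A y)"
          by (simp only: bounded_clinear_diff[OF R] bounded_clinear_scaleR[OF R])
        finally show ?thesis by (simp add: A.inv1_left[OF wA])
      qed
      moreover have "cinner (adj X (h j)) (2 *\<^sub>R ?Q (e j) - e j) = cinner (h j) z"
      proof -
        have "2 *\<^sub>R ?Q (e j) - e j = x + w s *\<^sub>C B x"
          unfolding x_def[symmetric] by (simp add: ej scaleR_2)
        then show ?thesis by (simp only: cinner_adj_left[OF X] z_def)
      qed
      ultimately have "cinner (h j) (2 *\<^sub>R ?R (X (e j)) - X (e j)) + \<sigma> * cinner (adj X (h j)) (2 *\<^sub>R ?Q (e j) - e j)
          = cinner (h j) (?R (y + w t *\<^sub>C A y) + \<sigma> *\<^sub>C z)"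
        by (simp only: cinner_add_right cinner_scaleC_right)
      also have "z = ?R (z - w t *\<^sub>C A z)" by (simp add: A.inv1_left[OF wA])
      also have "?R (y + w t *\<^sub>C A y) + \<sigma> *\<^sub>C ?R (z - w t *\<^sub>C A z) =
          ?R ((y + w t *\<^sub>C A y) + \<sigma> *\<^sub>C (z - w t *\<^sub>C A z))"
        by (simp only: bounded_clinear_add[OF R] bounded_clinear_scaleC[OF R])
      also have "(y + w t *\<^sub>C A y) + \<sigma> *\<^sub>C (z - w t *\<^sub>C A z) = \<alpha> *\<^sub>C S x + \<beta> *\<^sub>C T x"
        unfolding y_def z_def by (rule \<alpha>\<beta>(3))
      also have "cinner (h j) (?R (\<alpha> *\<^sub>C S x + \<beta> *\<^sub>C T x)) = cinner (adj ?R (h j)) (\<alpha> *\<^sub>C S x + \<beta> *\<^sub>C T x)"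
        by (simp add: cinner_adj_left[OF R])
      also have "\<dots> = of_real (\<kappa> * \<mu>) * cinner (q j) (\<alpha> *\<^sub>C S (p j) + \<beta> *\<^sub>C T (p j))"
        using pos by (simp add: p_def q_def x_def[symmetric] bounded_clinear_scaleR[OF S]
            bounded_clinear_scaleR[OF T] cinner_scaleR_left cinner_scaleR_right cinner_add_right
            cinner_scaleC_right field_simps)
      finally show ?thesis .
    qed
    have "a t + b s = of_real (\<kappa> * \<mu>) * (\<Sum>j<k. cinner (q j) (\<alpha> *\<^sub>C S (p j) + \<beta> *\<^sub>C T (p j)))"
      unfolding a_def b_def sum.distrib[symmetric] summand sum_distrib_left ..
    then have "cmod (a t + b s) = \<kappa> * \<mu> * cmod (\<Sum>j<k. cinner (q j) (\<alpha> *\<^sub>C S (p j) + \<beta> *\<^sub>C T (p j)))"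
      using pos by (simp add: norm_mult)
    also have "\<dots> \<le> \<kappa> * \<mu> * (2 / \<rho>\<^sup>2 * sqrt 2 * K)"
      unfolding K_def using pos by (intro mult_left_mono sum_cinner_add_le S T bp bq \<alpha>\<beta>) auto
    also have "\<dots> = C"
      using \<rho>0 by (simp add: C_def \<kappa>_def \<mu>_def power2_eq_square)
    finally show ?thesis .
  qed
  define x where "x = (\<Sum>j<k. cinner (h j) (hfc f A (X (e j))))"
  define y where "y = (\<Sum>j<k. \<sigma> * cinner (adj X (h j)) (hfc g B (e j)))"
  have "((\<lambda>t. \<Sum>j<k. of_real (Re (f (of_real \<rho> * cis t)) / (2 * pi)) *
      cinner (h j) (2 *\<^sub>R A.inv1 (w t) (X (e j)) - X (e j))) has_integral x) {0..2*pi}"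
    unfolding x_def w_def by (intro has_integral_sum A.has_integral_hfc f \<rho>) auto
  then have x: "((\<lambda>t. of_real (Re (f (of_real \<rho> * cis t)) / (2 * pi)) * a t) has_integral x) {0..2*pi}"
    by (simp add: a_def sum_distrib_left)
  have "((\<lambda>t. \<Sum>j<k. \<sigma> * (of_real (Re (g (of_real \<rho> * cis t)) / (2 * pi)) *
      cinner (adj X (h j)) (2 *\<^sub>R B.inv1 (w t) (e j) - e j))) has_integral y) {0..2*pi}"
    unfolding y_def w_def by (intro has_integral_sum has_integral_mult_right B.has_integral_hfc g \<rho>) auto
  then have y: "((\<lambda>t. of_real (Re (g (of_real \<rho> * cis t)) / (2 * pi)) * b t) has_integral y) {0..2*pi}"
    by (simp add: b_def sum_distrib_left mult_ac)
  \<comment> \<open>Average over t with s frozen, then over s with the constant x.\<close>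
  have "cmod (x + b s) \<le> C" for s
    by (rule weighted_average_add_le[OF herglotz_weight[OF f \<rho>0 \<rho>(5)] x ab])
  then have "cmod (b s + x) \<le> C" for s by (simp add: add.commute)
  then have "cmod (y + x) \<le> C"
    by (rule weighted_average_add_le[OF herglotz_weight[OF g \<rho>0 \<rho>(5)] y])
  moreover have "y + x = (\<Sum>j<k. cinner (h j) (hfc f A (X (e j)) + \<sigma> *\<^sub>C X (hfc g B (e j))))"
    by (simp add: x_def y_def cinner_add_right cinner_scaleC_right cinner_adj_left[OF X] sum.distrib)
  ultimately show ?thesis by (simp add: C_def K_def)
qed

text \<open>f and g live on the open disk only, so \<rho> = 1 is reached as a limit from the left.
  The test vectors stay fixed while \<rho> varies, and the singular values are recovered afterwards
  through \<open>sum_sval_le\<close>.\<close>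

lemma Ky_Fan_Poisson_le:
  fixes A B X S T :: "'a::chilbert \<Rightarrow> 'a"
  assumes A: "nontrivial_G1 A" and B: "nontrivial_G1 B" and X: "bounded_clinear X"
    and f: "herglotz f" and g: "herglotz g"
    and S: "bounded_clinear S" and T: "bounded_clinear T"
    and key: "\<And>\<rho> u v. 0 < \<rho> \<Longrightarrow> \<rho> < 1 \<Longrightarrow> cmod u = 1 / \<rho> \<Longrightarrow> cmod v = 1 / \<rho> \<Longrightarrow>
      \<exists>\<alpha> \<beta>. cmod \<alpha> \<le> 2 / \<rho>\<^sup>2 \<and> cmod \<beta> \<le> 2 / \<rho>\<^sup>2 \<and>
        (\<forall>x. X (x - v *\<^sub>C B x) + u *\<^sub>C A (X (x - v *\<^sub>C B x)) +
          \<sigma> *\<^sub>C (X (x + v *\<^sub>C B x) - u *\<^sub>C A (X (x + v *\<^sub>C B x))) = \<alpha> *\<^sub>C S x + \<beta> *\<^sub>C T x)"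
    and M: "bounded_clinear (\<lambda>x. hfc f A (X x) + \<sigma> *\<^sub>C X (hfc g B x))"
  shows "(\<Sum>j<k. sval j (\<lambda>x. hfc f A (X x) + \<sigma> *\<^sub>C X (hfc g B x)))
    \<le> 2 * sqrt 2 / (dD A * dD B) * (\<Sum>j<k. sval j (\<lambda>x. abs_op S x + abs_op T x))"
proof (rule sum_sval_le[OF M])
  interpret A: nontrivial_G1 A by (rule A)
  interpret B: nontrivial_G1 B by (rule B)
  fix e h :: "nat \<Rightarrow> 'a" assume e: "bessel k e" and h: "bessel k h"
  let ?K = "\<Sum>j<k. sval j (\<lambda>x. abs_op S x + abs_op T x)"
  let ?F = "\<lambda>\<rho>. 2 * sqrt 2 / ((dD A - 1 + \<rho>) * (dD B - 1 + \<rho>)) * ?K"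
  have "(?F \<longlongrightarrow> 2 * sqrt 2 / ((dD A - 1 + 1) * (dD B - 1 + 1)) * ?K) (at_left 1)"
    using A.dD_pos B.dD_pos by (intro tendsto_intros) auto
  then have lim: "(?F \<longlongrightarrow> 2 * sqrt 2 / (dD A * dD B) * ?K) (at_left 1)" by simp
  define m where "m = Max {A.spectral_radius, B.spectral_radius, 1 - dD A, 1 - dD B}"
  have m: "m < 1"
    unfolding m_def using A.spectral_radius_bounds B.spectral_radius_bounds A.dD_pos B.dD_pos by simp
  have "\<forall>\<^sub>F \<rho> in at_left 1. \<rho> \<in> {m<..<1}" using m by (rule eventually_at_left_real)
  then have "\<forall>\<^sub>F \<rho> in at_left 1. cmod (\<Sum>j<k. cinner (h j) (hfc f A (X (e j)) + \<sigma> *\<^sub>C X (hfc g B (e j)))) \<le> ?F \<rho>"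
    by eventually_elim
       (rule sum_cinner_Poisson_le[OF A B X f g S T key e h]; simp add: m_def)
  then show "cmod (\<Sum>j<k. cinner (h j) (hfc f A (X (e j)) + \<sigma> *\<^sub>C X (hfc g B (e j)))) \<le> 2 * sqrt 2 / (dD A * dD B) * ?K"
    by (rule tendsto_lowerbound[OF lim]) simp
qed

theorem theorem3p1:
  fixes A B X :: "'a::{chilbert, second_countable_topology} \<Rightarrow> 'a"
    and f g :: "complex \<Rightarrow> complex"
    and \<Phi> :: "(nat \<Rightarrow> real) \<Rightarrow> real"
  assumes nontriv: "(UNIV :: 'a set) \<noteq> {0}"
    and "G1 A" and "G1 B"
    and "spec A \<union> spec B \<subseteq> ball 0 1"
    and "bounded_clinear X"
    and "herglotz f" and "herglotz g"
    and "symm_norming \<Phi>"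
  shows "(in_ideal \<Phi> (\<lambda>x. hfc f A (X x) + X (hfc g B x)) \<and>
         in_ideal \<Phi> (\<lambda>x. abs_op (A \<circ> X \<circ> B) x + abs_op X x) \<longrightarrow>
           uinorm \<Phi> (\<lambda>x. hfc f A (X x) + X (hfc g B x))
             \<le> 2 * sqrt 2 / (dD A * dD B) * uinorm \<Phi> (\<lambda>x. abs_op (A \<circ> X \<circ> B) x + abs_op X x)) \<and>
         (in_ideal \<Phi> (\<lambda>x. hfc f A (X x) - X (hfc g B x)) \<and>
         in_ideal \<Phi> (\<lambda>x. abs_op (A \<circ> X) x + abs_op (X \<circ> B) x) \<longrightarrow>
           uinorm \<Phi> (\<lambda>x. hfc f A (X x) - X (hfc g B x))
             \<le> 2 * sqrt 2 / (dD A * dD B) * uinorm \<Phi> (\<lambda>x. abs_op (A \<circ> X) x + abs_op (X \<circ> B) x))"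
proof -
  have A: "nontrivial_G1 A" and B: "nontrivial_G1 B"
    using assms by (auto intro!: nontrivial_G1.intro)
  interpret A: nontrivial_G1 A by (rule A)
  interpret B: nontrivial_G1 B by (rule B)
  note X = assms(5) and f = assms(6) and g = assms(7)
  have C: "0 \<le> 2 * sqrt 2 / (dD A * dD B)" using A.dD_pos B.dD_pos by simp
  note lin = bounded_clinear_add[OF X] bounded_clinear_diff[OF X] bounded_clinear_scaleC[OF X]
    bounded_clinear_add[OF A.bounded_A] bounded_clinear_diff[OF A.bounded_A]
    bounded_clinear_scaleC[OF A.bounded_A]
  have AX: "bounded_clinear (A \<circ> X)" and XB: "bounded_clinear (X \<circ> B)"
    unfolding o_def by (rule bounded_clinear_compose[OF A.bounded_A X] bounded_clinear_compose[OF X B.bounded_A])+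
  have AXB: "bounded_clinear (A \<circ> X \<circ> B)"
    using bounded_clinear_compose[OF AX B.bounded_A] by (simp add: o_def)
  \<comment> \<open>The coefficients of the middle factor have modulus 2 and 2 / \<rho>^2 for the
    sum and 2 / \<rho> for the difference; all are weakened to the common bound 2 / \<rho>^2, which
    is harmless as \<rho> tends to 1.\<close>
  have one: "2 \<le> 2 / \<rho>\<^sup>2" "2 / \<rho> \<le> 2 / \<rho>\<^sup>2" if "0 < \<rho>" "\<rho> < 1" for \<rho> :: real
  proof -
    have "\<rho>\<^sup>2 \<le> \<rho>" "\<rho>\<^sup>2 \<le> 1" using that by (auto simp: power2_eq_square mult_le_one)
    then show "2 \<le> 2 / \<rho>\<^sup>2" "2 / \<rho> \<le> 2 / \<rho>\<^sup>2" using that by (auto simp: field_simps intro: divide_left_mono)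
  qed
  have double: "(2 * c) *\<^sub>C x = c *\<^sub>C x + c *\<^sub>C x" "2 *\<^sub>C x = x + x" for c and x :: 'a
    using scaleC_add_left[of c c x] scaleC_add_left[of 1 1 x] by (simp_all flip: mult_2)
  have plus: "uinorm \<Phi> (\<lambda>x. hfc f A (X x) + X (hfc g B x))
      \<le> 2 * sqrt 2 / (dD A * dD B) * uinorm \<Phi> (\<lambda>x. abs_op (A \<circ> X \<circ> B) x + abs_op X x)"
    if M: "in_ideal \<Phi> (\<lambda>x. hfc f A (X x) + X (hfc g B x))"
      and N: "in_ideal \<Phi> (\<lambda>x. abs_op (A \<circ> X \<circ> B) x + abs_op X x)"
  proof (rule uinorm_le_of_Ky_Fan[OF assms(8) M N C])
    fix k
    have key: "\<exists>\<alpha> \<beta>. cmod \<alpha> \<le> 2 / \<rho>\<^sup>2 \<and> cmod \<beta> \<le> 2 / \<rho>\<^sup>2 \<and>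
        (\<forall>x. X (x - v *\<^sub>C B x) + u *\<^sub>C A (X (x - v *\<^sub>C B x)) +
          1 *\<^sub>C (X (x + v *\<^sub>C B x) - u *\<^sub>C A (X (x + v *\<^sub>C B x))) = \<alpha> *\<^sub>C (A \<circ> X \<circ> B) x + \<beta> *\<^sub>C X x)"
      if "0 < \<rho>" "\<rho> < 1" "cmod u = 1 / \<rho>" "cmod v = 1 / \<rho>" for \<rho> u v
    proof (intro exI conjI allI)
      show "cmod (- (2 * (u * v))) \<le> 2 / \<rho>\<^sup>2" using that by (simp add: norm_mult power2_eq_square)
      show "cmod 2 \<le> 2 / \<rho>\<^sup>2" using one(1)[OF that(1,2)] by simp
      \<comment> \<open>Expansion of (1 + u A) X (1 - v B) + (1 - u A) X (1 + v B): the terms with a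
        single factor u or v cancel.\<close>
      show "X (x - v *\<^sub>C B x) + u *\<^sub>C A (X (x - v *\<^sub>C B x)) +
          1 *\<^sub>C (X (x + v *\<^sub>C B x) - u *\<^sub>C A (X (x + v *\<^sub>C B x))) =
          (- (2 * (u * v))) *\<^sub>C (A \<circ> X \<circ> B) x + 2 *\<^sub>C X x" for x
        by (simp add: lin scaleC_add_right scaleC_diff_right scaleC_minus_left scaleC_scaleC double)
    qed
    have M': "bounded_clinear (\<lambda>x. hfc f A (X x) + 1 *\<^sub>C X (hfc g B x))"
      using M by (simp add: in_ideal_def)
    show "(\<Sum>j<k. sval j (\<lambda>x. hfc f A (X x) + X (hfc g B x))) \<le> 2 * sqrt 2 / (dD A * dD B) *
        (\<Sum>j<k. sval j (\<lambda>x. abs_op (A \<circ> X \<circ> B) x + abs_op X x))"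
      using Ky_Fan_Poisson_le[OF A B X f g AXB X _ M', of k] key by simp
  qed
  have minus: "uinorm \<Phi> (\<lambda>x. hfc f A (X x) - X (hfc g B x))
      \<le> 2 * sqrt 2 / (dD A * dD B) * uinorm \<Phi> (\<lambda>x. abs_op (A \<circ> X) x + abs_op (X \<circ> B) x)"
    if M: "in_ideal \<Phi> (\<lambda>x. hfc f A (X x) - X (hfc g B x))"
      and N: "in_ideal \<Phi> (\<lambda>x. abs_op (A \<circ> X) x + abs_op (X \<circ> B) x)"
  proof (rule uinorm_le_of_Ky_Fan[OF assms(8) M N C])
    fix k
    have key: "\<exists>\<alpha> \<beta>. cmod \<alpha> \<le> 2 / \<rho>\<^sup>2 \<and> cmod \<beta> \<le> 2 / \<rho>\<^sup>2 \<and>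
        (\<forall>x. X (x - v *\<^sub>C B x) + u *\<^sub>C A (X (x - v *\<^sub>C B x)) +
          (-1) *\<^sub>C (X (x + v *\<^sub>C B x) - u *\<^sub>C A (X (x + v *\<^sub>C B x))) = \<alpha> *\<^sub>C (A \<circ> X) x + \<beta> *\<^sub>C (X \<circ> B) x)"
      if "0 < \<rho>" "\<rho> < 1" "cmod u = 1 / \<rho>" "cmod v = 1 / \<rho>" for \<rho> u v
    proof (intro exI conjI allI)
      show "cmod (2 * u) \<le> 2 / \<rho>\<^sup>2" "cmod (- (2 * v)) \<le> 2 / \<rho>\<^sup>2"
        using that one(2)[OF that(1,2)] by (simp_all add: norm_mult)
      \<comment> \<open>With the minus sign the terms X and u v A X B cancel instead, which leaves 2
        u A X - 2 v X B.\<close>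
      show "X (x - v *\<^sub>C B x) + u *\<^sub>C A (X (x - v *\<^sub>C B x)) +
          (-1) *\<^sub>C (X (x + v *\<^sub>C B x) - u *\<^sub>C A (X (x + v *\<^sub>C B x))) =
          (2 * u) *\<^sub>C (A \<circ> X) x + (- (2 * v)) *\<^sub>C (X \<circ> B) x" for x
        by (simp add: lin scaleC_add_right scaleC_diff_right scaleC_minus_left scaleC_scaleC double)
    qed
    have M': "bounded_clinear (\<lambda>x. hfc f A (X x) + (-1) *\<^sub>C X (hfc g B x))"
      using M by (simp add: in_ideal_def scaleC_minus_left)
    show "(\<Sum>j<k. sval j (\<lambda>x. hfc f A (X x) - X (hfc g B x))) \<le> 2 * sqrt 2 / (dD A * dD B) *
        (\<Sum>j<k. sval j (\<lambda>x. abs_op (A \<circ> X) x + abs_op (X \<circ> B) x))"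
      using Ky_Fan_Poisson_le[OF A B X f g AX XB _ M', of k] key by (simp add: scaleC_minus_left)
  qed
  from plus minus show ?thesis by blast
qed

end
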